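(* Let $U\subseteq\mathbb{R}^d$ be open, $x_0\in U$, $u\in\mathcal{D}'(U)$, $\tau>0$ and $\sigma>1$. Then $x_0\notin\mathrm{singsupp}_{\{\tau,\sigma\}}(u)$ (resp. $x_0\notin\mathrm{singsupp}_{(\tau,\sigma)}(u)$) if and only if there exists a compact neighborhood $K$ of $x_0$ such that for every $\phi\in\mathcal{D}^{K-\{x_0\}}_{\{\tau,\sigma\}}$ (resp. $\phi\in\mathcal{D}^{K-\{x_0\}}_{(\tau,\sigma)}$) there exist $A,h>0$ (resp. for every $h>0$ there exists $A>0$) such that $$|V_\phi u(x,\xi)|\le A\,e^{-T_{\tau,\sigma,h}(|\xi|)},\qquad x\in K,\ \xi\in\mathbb{R}^d\setminus\{0\},$$ where $K-\{x_0\}=\{y\in\mathbb{R}^d : y+x_0\in K\}$.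
   Context: Notation: $\mathbb{N}=\{0,1,2,\dots\}$. $M_p^{\tau,\sigma}=p^{\tau p^{\sigma}}$ for $p\ge1$ and $M_0^{\tau,\sigma}=1$. Function spaces: for $h>0$ and a regular compact set $K\subset\mathbb{R}^d$, $\mathcal{E}_{\tau,\sigma,h}(K)$ is the Banach space of $\phi\in C^\infty(K)$ with $$\sup_{\alpha\in\mathbb{N}^d}\sup_{x\in K}\frac{|\partial^\alpha\phi(x)|}{h^{|\alpha|^\sigma}M^{\tau,\sigma}_{|\alpha|}}<\infty ,$$ and $\mathcal{D}^K_{\tau,\sigma,h}$ is the set of those $\phi\in\mathcal{E}_{\tau,\sigma,h}(K)$ whose support is contained in $K$. Put $\mathcal{D}^K_{\{\tau,\sigma\}}=\bigcup_{h>0}\mathcal{D}^K_{\tau,\sigma,h}$ (Roumieu) and $\mathcal{D}^K_{(\tau,\sigma)}=\bigcap_{h>0}\mathcal{D}^K_{\tau,\sigma,h}$ (Beurling). For open $\Omega\subseteq\mathbb{R}^d$, $\mathcal{E}_{\{\tau,\sigma\}}(\Omega)$ (resp. $\mathcal{E}_{(\tau,\sigma)}(\Omega)$) is the set of smooth functions on $\Omega$ whose restriction to every regular compact $K\subset\Omega$ belongs to $\mathcal{E}_{\tau,\sigma,h}(K)$ for some $h>0$ (resp. for every $h>0$). Singular support: for $u\in\mathcal{D}'(U)$, $x_0\notin\mathrm{singsupp}_{\{\tau,\sigma\}}(u)$ (resp. $x_0\notin\mathrm{singsupp}_{(\tau,\sigma)}(u)$) if and only if there exists an open neighborhood $\Omega\subset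 U$ of $x_0$ such that $u\in\mathcal{E}_{\{\tau,\sigma\}}(\Omega)$ (resp. $u\in\mathcal{E}_{(\tau,\sigma)}(\Omega)$). STFT: $V_\phi u(x,\xi)=\mathcal{F}(u\cdot T_x\overline{\phi})(\xi)$, where $T_x\phi(t)=\phi(t-x)$ and $\mathcal{F}f(\xi)=\int f(t)e^{-2\pi i t\cdot\xi}dt$ is extended to compactly supported distributions. The compact neighborhood $K$ is understood to be such that $\{x+y-x_0 : x,y\in K\}\subset U$, so that $V_\phi u(x,\xi)$ is defined for $x\in K$. Extended associated function: for $h,k>0$, $$T_{\tau,\sigma,h}(k)=\sup_{p\in\mathbb{N}}\ln_+\frac{h^{p^{\sigma}}k^{p}}{M_p^{\tau,\sigma}},\qquad \ln_+A=\max\{0,\ln A\}.$$ *)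

theory Defs
  imports "HOL-Analysis.Analysis"
begin

text \<open>
  Multi-indices in \<open>\<nat>\<^sup>d\<close> are functions \<open>'n \<Rightarrow> nat\<close>, where \<open>\<real>\<^sup>d\<close> is \<open>real ^ 'n\<close>. All functions are total on
  \<open>real ^ 'n\<close>; what a function does outside the set under consideration is irrelevant.
\<close>

section \<open>Smooth functions and their partial derivatives\<close>

definition partial :: "'n::finite \<Rightarrow> (real ^ 'n \<Rightarrow> complex) \<Rightarrow> real ^ 'n \<Rightarrow> complex"
  where "partial i f = (\<lambda>x. frechet_derivative f (at x) (axis i 1))"

text \<open>
  The index type carries no order, so an enumeration of the coordinates is chosen once and for
  all. On an open set where \<open>f\<close> is smooth, \<open>mderiv \<alpha> f\<close> does not depend on the choice.
\<close>

definition coords :: "'n::finite list"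
  where "coords = (SOME is. distinct is \<and> set is = UNIV)"

lemma coords: "distinct (coords :: 'n::finite list)" "set (coords :: 'n list) = UNIV"
proof -
  have "\<exists>is. distinct is \<and> set is = (UNIV :: 'n set)"
    using finite_distinct_list[of "UNIV :: 'n set"] by auto
  from someI_ex[OF this]
  show "distinct (coords :: 'n list)" "set (coords :: 'n list) = UNIV"
    by (auto simp: coords_def)
qed

definition mderiv :: "('n::finite \<Rightarrow> nat) \<Rightarrow> (real ^ 'n \<Rightarrow> complex) \<Rightarrow> real ^ 'n \<Rightarrow> complex"
  where "mderiv \<alpha> f = foldr (\<lambda>i. partial i ^^ \<alpha> i) coords f"

definition mlength :: "('n::finite \<Rightarrow> nat) \<Rightarrow> nat"
  where "mlength \<alpha> = (\<Sum>i\<in>UNIV. \<alpha> i)"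

lemma finite_mlength_le: "finite {\<alpha> :: 'n::finite \<Rightarrow> nat. mlength \<alpha> \<le> N}"
proof -
  have "\<alpha> i \<le> mlength \<alpha>" for \<alpha> :: "'n \<Rightarrow> nat" and i
    unfolding mlength_def by (rule member_le_sum) auto
  hence "{\<alpha> :: 'n \<Rightarrow> nat. mlength \<alpha> \<le> N} \<subseteq> (UNIV :: 'n set) \<rightarrow>\<^sub>E {..N}"
    by (auto simp: PiE_def Pi_def intro: order_trans)
  thus ?thesis
    by (rule finite_subset) (auto intro: finite_PiE)
qed

text \<open>The following two notions are meant for open sets \<open>S\<close>.\<close>

primrec C_on :: "nat \<Rightarrow> (real ^ 'n::finite) set \<Rightarrow> (real ^ 'n \<Rightarrow> complex) \<Rightarrow> bool"
  where
    "C_on 0 S f \<longleftrightarrow> continuous_on S f"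
  | "C_on (Suc k) S f \<longleftrightarrow> (\<forall>x\<in>S. f differentiable (at x)) \<and> (\<forall>i. C_on k S (partial i f))"

definition smooth_on :: "(real ^ 'n::finite) set \<Rightarrow> (real ^ 'n \<Rightarrow> complex) \<Rightarrow> bool"
  where "smooth_on S f \<longleftrightarrow> (\<forall>k. C_on k S f)"

definition supp :: "(real ^ 'n::finite \<Rightarrow> complex) \<Rightarrow> (real ^ 'n) set"
  where "supp f = closure {x. f x \<noteq> 0}"

section \<open>Extended Gevrey classes\<close>

definition M_seq :: "real \<Rightarrow> real \<Rightarrow> nat \<Rightarrow> real"
  where "M_seq \<tau> \<sigma> p = (if p = 0 then 1 else real p powr (\<tau> * real p powr \<sigma>))"

definition regular_compact :: "(real ^ 'n::finite) set \<Rightarrow> bool"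
  where "regular_compact K \<longleftrightarrow> compact K \<and> closure (interior K) = K"

text \<open>
  \<open>C\<^sup>\<infinity>(K)\<close> is read as the functions that are smooth on an open neighbourhood of \<open>K\<close>. In particular,
  such a function with support in the compact set \<open>K\<close> is a smooth function on all of \<open>\<real>\<^sup>d\<close>.
\<close>

definition E_h :: "real \<Rightarrow> real \<Rightarrow> real \<Rightarrow> (real ^ 'n::finite) set \<Rightarrow> (real ^ 'n \<Rightarrow> complex) set"
  where "E_h \<tau> \<sigma> h K =
    {\<phi>. (\<exists>W. open W \<and> K \<subseteq> W \<and> smooth_on W \<phi>) \<and>
         bdd_above {cmod (mderiv \<alpha> \<phi> x) /
             (h powr (real (mlength \<alpha>) powr \<sigma>) * M_seq \<tau> \<sigma> (mlength \<alpha>)) | \<alpha> x. x \<in> K}}"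

definition D_h :: "real \<Rightarrow> real \<Rightarrow> real \<Rightarrow> (real ^ 'n::finite) set \<Rightarrow> (real ^ 'n \<Rightarrow> complex) set"
  where "D_h \<tau> \<sigma> h K = {\<phi> \<in> E_h \<tau> \<sigma> h K. supp \<phi> \<subseteq> K}"

definition D_Roumieu :: "real \<Rightarrow> real \<Rightarrow> (real ^ 'n::finite) set \<Rightarrow> (real ^ 'n \<Rightarrow> complex) set"
  where "D_Roumieu \<tau> \<sigma> K = (\<Union>h\<in>{0<..}. D_h \<tau> \<sigma> h K)"

definition D_Beurling :: "real \<Rightarrow> real \<Rightarrow> (real ^ 'n::finite) set \<Rightarrow> (real ^ 'n \<Rightarrow> complex) set"
  where "D_Beurling \<tau> \<sigma> K = (\<Inter>h\<in>{0<..}. D_h \<tau> \<sigma> h K)"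

definition E_Roumieu :: "real \<Rightarrow> real \<Rightarrow> (real ^ 'n::finite) set \<Rightarrow> (real ^ 'n \<Rightarrow> complex) set"
  where "E_Roumieu \<tau> \<sigma> \<Omega> =
    {f. smooth_on \<Omega> f \<and> (\<forall>K. regular_compact K \<and> K \<subseteq> \<Omega> \<longrightarrow> (\<exists>h>0. f \<in> E_h \<tau> \<sigma> h K))}"

definition E_Beurling :: "real \<Rightarrow> real \<Rightarrow> (real ^ 'n::finite) set \<Rightarrow> (real ^ 'n \<Rightarrow> complex) set"
  where "E_Beurling \<tau> \<sigma> \<Omega> =
    {f. smooth_on \<Omega> f \<and> (\<forall>K. regular_compact K \<and> K \<subseteq> \<Omega> \<longrightarrow> (\<forall>h>0. f \<in> E_h \<tau> \<sigma> h K))}"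

section \<open>Distributions and singular supports\<close>

definition test_fun :: "(real ^ 'n::finite) set \<Rightarrow> (real ^ 'n \<Rightarrow> complex) set"
  where "test_fun U = {\<phi>. smooth_on UNIV \<phi> \<and> compact (supp \<phi>) \<and> supp \<phi> \<subseteq> U}"

text \<open>
  A distribution on \<open>U\<close> is a functional whose values outside \<open>test_fun U\<close> are irrelevant; continuity
  is expressed by the usual seminorm estimates on compact subsets of \<open>U\<close>.
\<close>

definition distribution :: "(real ^ 'n::finite) set \<Rightarrow> ((real ^ 'n \<Rightarrow> complex) \<Rightarrow> complex) \<Rightarrow> bool"
  where "distribution U u \<longleftrightarrow>
    (\<forall>\<phi>\<in>test_fun U. \<forall>\<psi>\<in>test_fun U. \<forall>a b.
        u (\<lambda>x. a * \<phi> x + b * \<psi> x) = a * u \<phi> + b * u \<psi>) \<and>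
    (\<forall>K. compact K \<and> K \<subseteq> U \<longrightarrow>
        (\<exists>C N. \<forall>\<phi>\<in>test_fun U. supp \<phi> \<subseteq> K \<longrightarrow>
            cmod (u \<phi>) \<le> C * (\<Sum>\<alpha> | mlength \<alpha> \<le> N. SUP x. cmod (mderiv \<alpha> \<phi> x))))"

text \<open>\<open>u \<in> F\<close> on \<open>\<Omega>\<close>, for a class \<open>F\<close> of smooth functions on \<open>\<Omega>\<close>, under the usual identification of a
  function with the distribution it induces. The integrand vanishes outside \<open>\<Omega>\<close>.\<close>

definition in_class_on ::
    "(real ^ 'n::finite) set \<Rightarrow> ((real ^ 'n \<Rightarrow> complex) \<Rightarrow> complex) \<Rightarrow> (real ^ 'n \<Rightarrow> complex) set \<Rightarrow> bool"
  where "in_class_on \<Omega> u F \<longleftrightarrow>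
    (\<exists>f\<in>F. \<forall>\<phi>\<in>test_fun \<Omega>. u \<phi> = (LINT x|lborel. f x * \<phi> x))"

definition singsupp_Roumieu ::
    "real \<Rightarrow> real \<Rightarrow> (real ^ 'n::finite) set \<Rightarrow> ((real ^ 'n \<Rightarrow> complex) \<Rightarrow> complex) \<Rightarrow> (real ^ 'n) set"
  where "singsupp_Roumieu \<tau> \<sigma> U u =
    {x \<in> U. \<not> (\<exists>\<Omega>. open \<Omega> \<and> x \<in> \<Omega> \<and> \<Omega> \<subseteq> U \<and> in_class_on \<Omega> u (E_Roumieu \<tau> \<sigma> \<Omega>))}"

definition singsupp_Beurling ::
    "real \<Rightarrow> real \<Rightarrow> (real ^ 'n::finite) set \<Rightarrow> ((real ^ 'n \<Rightarrow> complex) \<Rightarrow> complex) \<Rightarrow> (real ^ 'n) set"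
  where "singsupp_Beurling \<tau> \<sigma> U u =
    {x \<in> U. \<not> (\<exists>\<Omega>. open \<Omega> \<and> x \<in> \<Omega> \<and> \<Omega> \<subseteq> U \<and> in_class_on \<Omega> u (E_Beurling \<tau> \<sigma> \<Omega>))}"

section \<open>Short-time Fourier transform\<close>

definition translate :: "real ^ 'n::finite \<Rightarrow> (real ^ 'n \<Rightarrow> complex) \<Rightarrow> real ^ 'n \<Rightarrow> complex"
  where "translate x \<phi> = (\<lambda>t. \<phi> (t - x))"

text \<open>If \<open>g \<in> test_fun U\<close> and \<open>u\<close> is a distribution on \<open>U\<close>, then \<open>dist_mult u g\<close> is the compactly
  supported distribution \<open>u g\<close>, in its natural extension to a functional on all of \<open>C\<^sup>\<infinity>(\<real>\<^sup>d)\<close>.\<close>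

definition dist_mult ::
    "((real ^ 'n::finite \<Rightarrow> complex) \<Rightarrow> complex) \<Rightarrow> (real ^ 'n \<Rightarrow> complex) \<Rightarrow> (real ^ 'n \<Rightarrow> complex) \<Rightarrow> complex"
  where "dist_mult u g = (\<lambda>\<psi>. u (\<lambda>t. g t * \<psi> t))"

text \<open>Fourier transform of a compactly supported distribution \<open>v\<close>, regarded as a functional on
  \<open>C\<^sup>\<infinity>(\<real>\<^sup>d)\<close>: the pairing of \<open>v\<close> with \<open>t \<mapsto> e\<^bsup>-2\<pi>it\<cdot>\<xi>\<^esup>\<close>. If \<open>v\<close> is integration against \<open>f\<close>, this is
  the integral \<open>\<integral> f(t) e\<^bsup>-2\<pi>it\<cdot>\<xi>\<^esup> dt\<close>.\<close>

definition fourier_cs :: "((real ^ 'n::finite \<Rightarrow> complex) \<Rightarrow> complex) \<Rightarrow> real ^ 'n \<Rightarrow> complex"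
  where "fourier_cs v \<xi> = v (\<lambda>t. exp (- 2 * complex_of_real pi * \<i> * complex_of_real (t \<bullet> \<xi>)))"

definition stft ::
    "(real ^ 'n::finite \<Rightarrow> complex) \<Rightarrow> ((real ^ 'n \<Rightarrow> complex) \<Rightarrow> complex) \<Rightarrow> real ^ 'n \<Rightarrow> real ^ 'n \<Rightarrow> complex"
  where "stft \<phi> u x \<xi> = fourier_cs (dist_mult u (translate x (\<lambda>t. cnj (\<phi> t)))) \<xi>"

section \<open>Extended associated function\<close>

definition ln_plus :: "real \<Rightarrow> real"
  where "ln_plus a = max 0 (ln a)"

text \<open>For \<open>\<tau>, h, k > 0\<close> and \<open>\<sigma> > 1\<close> the supremum is over a bounded set.\<close>

definition assoc_fun :: "real \<Rightarrow> real \<Rightarrow> real \<Rightarrow> real \<Rightarrow> real"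
  where "assoc_fun \<tau> \<sigma> h k =
    (SUP p::nat. ln_plus (h powr (real p powr \<sigma>) * k ^ p / M_seq \<tau> \<sigma> p))"

end

(*
If u is given by a function f of the class near x0, then V_phi u(x, xi) is the Fourier transform of
f times a translate of conj(phi), and integrating by parts p times in the direction of a dominant
coordinate of xi, with M_j M_k <= M_(j+k) and superadditivity of t powr sigma, gives
|xi|^p |V_phi u(x, xi)| <= A H^(p powr sigma) M_p for all p. Factors c^p are harmless because
sigma > 1.

Conversely, the estimate is only needed at x = x0 for one window phi that equals 1 near 0. Such a
window exists in the Beurling class: the derivatives of exp(-1/t) grow like p^(C p), which
p^(tau p^sigma) dominates. If supp(phi) is small enough to fit in a unit cube, no Fourier inversion
on R^d is needed: expanding a test function in its Fourier series on the cube shows that u agrees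
near x0 with the sum over the integer vectors k of V_phi u(x0, -k) exp(2 pi i k.t), and the decay
bounds all derivatives of this series. Completeness of the exponentials follows by integrating
against powers of a trigonometric polynomial that peaks at a single point of the cube.
*)
theory Submission
  imports Defs "HOL-Real_Asymp.Real_Asymp"
begin

section \<open>Smooth functions\<close>

text \<open>Decay by \<open>exp (- assoc_fun \<tau> \<sigma> h (norm \<xi>))\<close> amounts to the
  bounds \<open>norm \<xi> ^ p * V \<le> A * ((1 / h) powr (p powr \<sigma>) * M_seq \<tau> \<sigma>
  p)\<close> for all \<open>p\<close>, and the estimates are made on these. The parameter
  \<open>h\<close> does not survive unchanged: products, shifts of the order and geometric factors
  degrade it. What matters is that it is degraded by maps onto the positive reals, so that both "for
  some h" and "for every h" are preserved. In the Beurling case the function that represents u near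
  x0 must not depend on h. The series has this property, since it is built from u and one window
  alone. Applying u to a Fourier series term by term requires test functions. The characters become
  such after multiplication by the window: all supports lie in one compact set, the seminorms grow
  only polynomially in the frequency, and the Fourier coefficients of a test function decay faster
  than any power.\<close>

lemma partial_eqI: "(f has_derivative f') (at x) \<Longrightarrow> partial i f x = f' (axis i 1)"
  unfolding partial_def by (metis frechet_derivative_at)

text \<open>\<open>frechet_derivative\<close> picks one of the derivatives at the point; locally
  equal functions have the same derivatives, so the same one is picked, even where there is
  none.\<close>

lemma partial_cong:
  assumes "open S" "x \<in> S" "\<And>y. y \<in> S \<Longrightarrow> f y = g y"
  shows "partial i f x = partial i g x"
proof -
  have "(f has_derivative D) (at x) \<longleftrightarrow> (g has_derivative D) (at x)" for D
    using has_derivative_transform_within_open[OF _ assms(1,2), of f D UNIV g]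
      has_derivative_transform_within_open[OF _ assms(1,2), of g D UNIV f] assms(3) by auto
  thus ?thesis unfolding partial_def frechet_derivative_def by simp
qed

text \<open>Turns bounds on partial derivatives into bounds on the total derivative, for the mean
  value inequality and for differentiation of series.\<close>

lemma has_derivative_partials:
  fixes f :: "real ^ 'n::finite \<Rightarrow> complex"
  assumes "f differentiable (at x)"
  shows "(f has_derivative (\<lambda>h. \<Sum>i\<in>UNIV. h $ i *\<^sub>R partial i f x)) (at x)"
proof -
  obtain f' where f': "(f has_derivative f') (at x)"
    using assms by (auto simp: differentiable_def)
  interpret f': bounded_linear f' by (rule has_derivative_bounded_linear[OF f'])
  have "f' h = (\<Sum>i\<in>UNIV. h $ i *\<^sub>R partial i f x)" for h
  proof -
    have "f' h = f' (\<Sum>i\<in>UNIV. h $ i *\<^sub>R axis i 1)"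
      using basis_expansion[of h] by (simp add: scalar_mult_eq_scaleR)
    also have "\<dots> = (\<Sum>i\<in>UNIV. h $ i *\<^sub>R partial i f x)"
      by (simp add: f'.sum f'.scaleR partial_eqI[OF f'])
    finally show ?thesis .
  qed
  hence "f' = (\<lambda>h. \<Sum>i\<in>UNIV. h $ i *\<^sub>R partial i f x)" by auto
  thus ?thesis using f' by simp
qed

lemma C_on_cong:
  assumes "open S" "\<And>x. x \<in> S \<Longrightarrow> f x = g x" "C_on k S f"
  shows "C_on k S g"
  using assms(2,3)
proof (induction k arbitrary: f g)
  case 0
  then show ?case using continuous_on_cong[of S S f g] by simp
next
  case (Suc k)
  have "g differentiable (at x)" if "x \<in> S" for x
  proof -
    have "f differentiable (at x)" using Suc.prems(2) that by simp
    then obtain D where D: "(f has_derivative D) (at x)"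
      unfolding differentiable_def by blast
    have "(g has_derivative D) (at x)"
      by (rule has_derivative_transform_within_open[OF D assms(1) that Suc.prems(1)])
    thus ?thesis by (auto simp: differentiable_def)
  qed
  moreover have "C_on k S (partial i g)" for i
  proof (rule Suc.IH)
    show "partial i f x = partial i g x" if "x \<in> S" for x
      by (rule partial_cong[OF assms(1) that Suc.prems(1)])
    show "C_on k S (partial i f)" using Suc.prems(2) by simp
  qed
  ultimately show ?case by simp
qed

lemma C_on_Suc_imp: "C_on (Suc k) S f \<Longrightarrow> C_on k S f"
proof (induction k arbitrary: f)
  case 0
  then show ?case
    by (auto intro!: differentiable_imp_continuous_on differentiable_at_imp_differentiable_on)
next
  case (Suc k)
  then show ?case by (metis C_on.simps(2))
qed

lemma partial_add:
  assumes "f differentiable (at x)" "g differentiable (at x)"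
  shows "partial i (\<lambda>x. f x + g x) x = partial i f x + partial i g x"
proof -
  obtain f' g' where "(f has_derivative f') (at x)" "(g has_derivative g') (at x)"
    using assms by (auto simp: differentiable_def)
  from partial_eqI[OF has_derivative_add[OF this]] partial_eqI[OF this(1)] partial_eqI[OF this(2)]
  show ?thesis by simp
qed

lemma partial_mult:
  assumes "f differentiable (at x)" "g differentiable (at x)"
  shows "partial i (\<lambda>x. f x * g x) x = partial i f x * g x + f x * partial i g x"
proof -
  obtain f' g' where "(f has_derivative f') (at x)" "(g has_derivative g') (at x)"
    using assms by (auto simp: differentiable_def)
  from partial_eqI[OF has_derivative_mult[OF this]] partial_eqI[OF this(1)] partial_eqI[OF this(2)]
  show ?thesis by simp
qed

lemma C_on_add:
  assumes "open S" "C_on k S f" "C_on k S g"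
  shows "C_on k S (\<lambda>x. f x + g x)"
  using assms(2,3)
proof (induction k arbitrary: f g)
  case 0
  then show ?case by (auto intro: continuous_intros)
next
  case (Suc k)
  have "C_on k S (\<lambda>x. partial i f x + partial i g x)" for i
    by (rule Suc.IH) (use Suc.prems in auto)
  hence "C_on k S (partial i (\<lambda>x. f x + g x))" for i
    by (rule C_on_cong[OF assms(1), rotated]) (use Suc.prems in \<open>simp add: partial_add\<close>)
  then show ?case using Suc.prems by (simp add: differentiable_add)
qed

lemma C_on_mult:
  assumes "open S" "C_on k S f" "C_on k S g"
  shows "C_on k S (\<lambda>x. f x * g x)"
  using assms(2,3)
proof (induction k arbitrary: f g)
  case 0
  then show ?case by (auto intro: continuous_intros)
next
  case (Suc k)
  have "C_on k S (\<lambda>x. partial i f x * g x + f x * partial i g x)" for i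
    by (intro C_on_add[OF assms(1)] Suc.IH)
      (use Suc.prems C_on_Suc_imp[OF Suc.prems(1)] C_on_Suc_imp[OF Suc.prems(2)] in auto)
  hence "C_on k S (partial i (\<lambda>x. f x * g x))" for i
    by (rule C_on_cong[OF assms(1), rotated]) (use Suc.prems in \<open>simp add: partial_mult\<close>)
  then show ?case using Suc.prems by (simp add: differentiable_mult)
qed

lemma partial_const [simp]: "partial i (\<lambda>x. c) = (\<lambda>x. 0)"
  using partial_eqI[OF has_derivative_const] by auto

lemma C_on_const: "C_on k S (\<lambda>x. c)"
  by (induction k arbitrary: c) auto

lemma C_on_Un: "open S \<Longrightarrow> open T \<Longrightarrow> C_on k S f \<Longrightarrow> C_on k T f \<Longrightarrow> C_on k (S \<union> T) f"
  by (induction k arbitrary: f) (auto intro: continuous_on_open_Un)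

lemma C_on_subset: "C_on k S f \<Longrightarrow> T \<subseteq> S \<Longrightarrow> C_on k T f"
  by (induction k arbitrary: f) (auto intro: continuous_on_subset)

lemma smooth_on_differentiable: "smooth_on S f \<Longrightarrow> x \<in> S \<Longrightarrow> f differentiable (at x)"
  unfolding smooth_on_def by (metis C_on.simps(2))

lemma smooth_on_partial: "smooth_on S f \<Longrightarrow> smooth_on S (partial i f)"
  unfolding smooth_on_def by (metis C_on.simps(2))

lemma smooth_on_continuous: "smooth_on S f \<Longrightarrow> continuous_on S f"
  unfolding smooth_on_def by (metis C_on.simps(1))

lemma smooth_on_cong:
  "open S \<Longrightarrow> (\<And>x. x \<in> S \<Longrightarrow> f x = g x) \<Longrightarrow> smooth_on S f \<Longrightarrow> smooth_on S g"
  unfolding smooth_on_def using C_on_cong by metis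

lemma smooth_on_mult: "open S \<Longrightarrow> smooth_on S f \<Longrightarrow> smooth_on S g \<Longrightarrow> smooth_on S (\<lambda>x. f x * g x)"
  unfolding smooth_on_def using C_on_mult by blast

lemma smooth_on_const: "smooth_on S (\<lambda>x. c)"
  unfolding smooth_on_def using C_on_const by blast

lemma smooth_on_Un: "open S \<Longrightarrow> open T \<Longrightarrow> smooth_on S f \<Longrightarrow> smooth_on T f \<Longrightarrow> smooth_on (S \<union> T) f"
  unfolding smooth_on_def using C_on_Un by blast

lemma smooth_on_subset: "smooth_on S f \<Longrightarrow> T \<subseteq> S \<Longrightarrow> smooth_on T f"
  unfolding smooth_on_def using C_on_subset by blast

text \<open>Any class of differentiable functions that is closed under \<open>partial\<close>
  consists of smooth functions. Translates, series and plateau functions are handled by naming such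
  a class.\<close>

lemma smooth_on_coinduct:
  assumes "P f"
    and "\<And>f x. P f \<Longrightarrow> x \<in> S \<Longrightarrow> f differentiable (at x)"
    and "\<And>f i. P f \<Longrightarrow> P (partial i f)"
  shows "smooth_on S f"
proof -
  have "C_on k S f" for k
    using assms(1)
  proof (induction k arbitrary: f)
    case 0
    then show ?case
      using assms(2) by (auto intro!: differentiable_imp_continuous_on differentiable_at_imp_differentiable_on)
  next
    case (Suc k)
    then show ?case using assms(2,3) by simp
  qed
  thus ?thesis unfolding smooth_on_def by blast
qed

lemma smooth_on_funpow: "smooth_on S f \<Longrightarrow> smooth_on S ((partial i ^^ n) f)"
  by (induction n) (auto intro: smooth_on_partial)

lemma supp_subset: "f x \<noteq> 0 \<Longrightarrow> x \<in> supp f"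
  unfolding supp_def using closure_subset[of "{x. f x \<noteq> 0}"] by auto

lemma not_in_supp: "x \<notin> supp f \<Longrightarrow> f x = 0"
  using supp_subset by blast

lemma closed_supp [simp]: "closed (supp f)"
  unfolding supp_def by simp

lemma supp_minimal: "closed K \<Longrightarrow> (\<And>x. x \<notin> K \<Longrightarrow> f x = 0) \<Longrightarrow> supp f \<subseteq> K"
  unfolding supp_def by (intro closure_minimal) auto

lemma supp_partial: "supp (partial i f) \<subseteq> supp f"
proof (rule supp_minimal)
  fix x assume "x \<notin> supp f"
  hence "partial i f x = partial i (\<lambda>x. 0) x"
    by (intro partial_cong[of "- supp f"]) (auto simp: not_in_supp)
  thus "partial i f x = 0" by simp
qed simp

lemma supp_funpow: "supp ((partial i ^^ n) f) \<subseteq> supp f"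
  by (induction n) (use supp_partial in force)+

text \<open>The open sets \<open>W\<close> and \<open>- supp f\<close> cover the space, and
  \<open>f\<close> is zero on the second. This makes windows, and products of a local function with
  a window, smooth everywhere.\<close>

lemma smooth_on_extend:
  assumes "open W" "smooth_on W f" "supp f \<subseteq> W"
  shows "smooth_on UNIV f"
proof -
  have "smooth_on (- supp f) f"
    by (rule smooth_on_cong[OF _ _ smooth_on_const[of _ 0]]) (auto simp: not_in_supp)
  hence "smooth_on (W \<union> - supp f) f"
    by (intro smooth_on_Un assms) auto
  thus ?thesis by (rule smooth_on_subset) (use assms in auto)
qed

lemma funpow_partial_cong:
  assumes "open S" "\<And>y. y \<in> S \<Longrightarrow> f y = g y" "x \<in> S"
  shows "(partial i ^^ n) f x = (partial i ^^ n) g x"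
  using assms(3) by (induction n arbitrary: x) (auto intro: assms partial_cong[of S])

lemma funpow_partial_add:
  assumes "open S" "smooth_on S f" "smooth_on S g" "x \<in> S"
  shows "(partial i ^^ n) (\<lambda>x. f x + g x) x = (partial i ^^ n) f x + (partial i ^^ n) g x"
  using assms(4)
proof (induction n arbitrary: x)
  case (Suc n)
  have "partial i ((partial i ^^ n) (\<lambda>x. f x + g x)) x
      = partial i (\<lambda>x. (partial i ^^ n) f x + (partial i ^^ n) g x) x"
    by (rule partial_cong[of S]) (use assms Suc in auto)
  also have "\<dots> = partial i ((partial i ^^ n) f) x + partial i ((partial i ^^ n) g) x"
    by (rule partial_add)
      (use assms Suc in \<open>auto intro: smooth_on_differentiable[of S] smooth_on_funpow\<close>)
  finally show ?case by simp
qed auto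

text \<open>A Leibniz estimate in which the hypothesis on all splittings of the order replaces the
  binomial formula, so that the induction shifts \<open>Z\<close> instead of manipulating sums.\<close>

lemma Leibniz_bound:
  assumes "open S" "smooth_on S f" "smooth_on S g" "x \<in> S"
    and "\<And>j k. cmod ((partial i ^^ j) f x) * cmod ((partial i ^^ k) g x) \<le> Z (j + k)"
  shows "cmod ((partial i ^^ n) (\<lambda>x. f x * g x) x) \<le> 2 ^ n * Z n"
  using assms(2,3,5)
proof (induction n arbitrary: f g Z)
  case 0
  then show ?case using 0(3)[of 0 0] by (simp add: norm_mult)
next
  case (Suc n)
  let ?f = "partial i f" and ?g = "partial i g"
  have *: "cmod ((partial i ^^ n) (\<lambda>x. ?f x * g x) x) \<le> 2 ^ n * Z (Suc n)"
    by (rule Suc.IH[of _ _ "\<lambda>n. Z (Suc n)"])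
      (use Suc.prems(1,2) Suc.prems(3)[of "Suc _"] in \<open>auto intro: smooth_on_partial simp: funpow_swap1\<close>)
  have **: "cmod ((partial i ^^ n) (\<lambda>x. f x * ?g x) x) \<le> 2 ^ n * Z (Suc n)"
    by (rule Suc.IH[of _ _ "\<lambda>n. Z (Suc n)"])
      (use Suc.prems(1,2) Suc.prems(3)[of _ "Suc _"] in \<open>auto intro: smooth_on_partial simp: funpow_swap1\<close>)
  have "(partial i ^^ Suc n) (\<lambda>x. f x * g x) x = (partial i ^^ n) (partial i (\<lambda>x. f x * g x)) x"
    by (simp add: funpow_swap1)
  also have "\<dots> = (partial i ^^ n) (\<lambda>x. ?f x * g x + f x * ?g x) x"
    by (rule funpow_partial_cong[OF assms(1) _ assms(4)])
      (use Suc.prems in \<open>auto intro!: partial_mult smooth_on_differentiable[of S]\<close>)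
  also have "\<dots> = (partial i ^^ n) (\<lambda>x. ?f x * g x) x + (partial i ^^ n) (\<lambda>x. f x * ?g x) x"
    by (rule funpow_partial_add[OF assms(1) _ _ assms(4)])
      (use Suc.prems in \<open>auto intro!: smooth_on_mult smooth_on_partial assms(1)\<close>)
  finally show ?case
    using * ** norm_triangle_ineq[of "(partial i ^^ n) (\<lambda>x. ?f x * g x) x" "(partial i ^^ n) (\<lambda>x. f x * ?g x) x"]
    by (simp add: algebra_simps)
qed

section \<open>Iterated partial derivatives along lists of coordinates\<close>

abbreviation partials :: "'n::finite list \<Rightarrow> (real ^ 'n \<Rightarrow> complex) \<Rightarrow> real ^ 'n \<Rightarrow> complex"
  where "partials l f \<equiv> foldr partial l f"

lemma foldr_replicate: "foldr f (replicate n i) = f i ^^ n"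
  by (induction n) auto

definition index_list :: "('n::finite \<Rightarrow> nat) \<Rightarrow> 'n list"
  where "index_list \<alpha> = concat (map (\<lambda>i. replicate (\<alpha> i) i) coords)"

text \<open>A list can be extended by one derivative at either end, which a multi-index with its
  fixed order of differentiation cannot without commuting partial derivatives. Bounds that prove
  membership in \<open>E_h\<close> are therefore shown for all lists and read off for
  \<open>mderiv\<close> here.\<close>

lemma mderiv_eq_partials: "mderiv \<alpha> f = partials (index_list \<alpha>) f"
proof -
  have "foldr (\<lambda>i. partial i ^^ \<alpha> i) is f = partials (concat (map (\<lambda>i. replicate (\<alpha> i) i) is)) f" for "is"
    by (induction "is") (auto simp: foldr_replicate)
  thus ?thesis unfolding mderiv_def index_list_def by blast
qed

lemma length_index_list: "length (index_list \<alpha>) = mlength \<alpha>"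
  unfolding index_list_def mlength_def
  by (simp add: length_concat comp_def sum_list_distinct_conv_sum_set coords)

text \<open>The passage from the class to pure derivatives, the only ones that the decay estimate
  uses.\<close>

lemma mderiv_single: "mderiv (\<lambda>j. if j = i then n else 0) f = (partial i ^^ n) f"
proof -
  have "distinct is \<Longrightarrow> foldr (\<lambda>j. partial j ^^ (if j = i then n else 0)) is f =
      (if i \<in> set is then (partial i ^^ n) f else f)" for "is"
    by (induction "is") (auto split: if_splits)
  from this[OF coords(1)] show ?thesis unfolding mderiv_def by (simp add: coords(2))
qed

lemma mlength_single: "mlength (\<lambda>j. if j = i then n else 0) = n"
  unfolding mlength_def by simp

lemma smooth_on_partials: "smooth_on S f \<Longrightarrow> smooth_on S (partials l f)"
  by (induction l) (auto intro: smooth_on_partial)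

lemma partials_add:
  assumes "smooth_on UNIV f" "smooth_on UNIV g"
  shows "partials l (\<lambda>x. f x + g x) = (\<lambda>x. partials l f x + partials l g x)"
proof (induction l)
  case (Cons i l)
  show ?case unfolding foldr_Cons o_apply Cons.IH
    by (intro ext partial_add smooth_on_differentiable[of UNIV] smooth_on_partials assms UNIV_I)
qed simp

lemma partial_cmult:
  assumes "f differentiable (at x)"
  shows "partial i (\<lambda>x. c * f x) x = c * partial i f x"
  using partial_mult[of "\<lambda>x. c" x f i] assms by simp

lemma partials_cmult:
  assumes "smooth_on UNIV f"
  shows "partials l (\<lambda>x. c * f x) = (\<lambda>x. c * partials l f x)"
proof (induction l)
  case (Cons i l)
  show ?case unfolding foldr_Cons o_apply Cons.IH
    by (intro ext partial_cmult smooth_on_differentiable[of UNIV] smooth_on_partials assms UNIV_I)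
qed simp

section \<open>Translated conjugate windows and characters\<close>

lemma has_derivative_translate_cnj:
  assumes "(f has_derivative f') (at (t - x))"
  shows "((\<lambda>t. cnj (f (t - x))) has_derivative (\<lambda>h. cnj (f' h))) (at t)"
proof -
  have "((\<lambda>t. t - x) has_derivative (\<lambda>h. h)) (at t)"
    by (auto intro!: derivative_eq_intros)
  from has_derivative_compose[OF this assms] show ?thesis
    by (rule bounded_linear.has_derivative[OF bounded_linear_cnj])
qed

lemma partial_translate_cnj:
  assumes "smooth_on UNIV f"
  shows "partial i (\<lambda>t. cnj (f (t - x))) = (\<lambda>t. cnj (partial i f (t - x)))"
proof
  fix t
  obtain f' where f': "(f has_derivative f') (at (t - x))"
    using smooth_on_differentiable[OF assms UNIV_I] unfolding differentiable_def by blast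
  show "partial i (\<lambda>t. cnj (f (t - x))) t = cnj (partial i f (t - x))"
    unfolding partial_eqI[OF has_derivative_translate_cnj[OF f']] partial_eqI[OF f'] ..
qed

lemma differentiable_translate_cnj:
  assumes "smooth_on UNIV f"
  shows "(\<lambda>t. cnj (f (t - x))) differentiable (at t)"
proof -
  obtain f' where f': "(f has_derivative f') (at (t - x))"
    using smooth_on_differentiable[OF assms UNIV_I] unfolding differentiable_def by blast
  from has_derivative_translate_cnj[OF f'] show ?thesis
    unfolding differentiable_def by blast
qed

lemma smooth_on_translate_cnj:
  assumes "smooth_on UNIV f"
  shows "smooth_on UNIV (\<lambda>t. cnj (f (t - x)))"
proof (rule smooth_on_coinduct[of "\<lambda>g. \<exists>f. smooth_on UNIV f \<and> g = (\<lambda>t. cnj (f (t - x)))"])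
qed (use assms in \<open>auto simp: partial_translate_cnj intro: differentiable_translate_cnj smooth_on_partial\<close>)

lemma funpow_translate_cnj:
  assumes "smooth_on UNIV f"
  shows "(partial i ^^ n) (\<lambda>t. cnj (f (t - x))) = (\<lambda>t. cnj ((partial i ^^ n) f (t - x)))"
  by (induction n) (auto simp: partial_translate_cnj smooth_on_funpow assms)

text \<open>The kernel in \<open>fourier_cs\<close>, that is, the character of frequency
  \<open>- \<xi>\<close>. The sign is the reason why \<open>phase (- k)\<close> carries the
  coefficient at \<open>k\<close> in Fourier series.\<close>

definition phase :: "real ^ 'n::finite \<Rightarrow> real ^ 'n \<Rightarrow> complex"
  where "phase \<xi> t = exp (- 2 * complex_of_real pi * \<i> * complex_of_real (t \<bullet> \<xi>))"

lemma norm_phase [simp]: "cmod (phase \<xi> t) = 1"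
  unfolding phase_def by simp

lemma phase_has_derivative:
  "(phase \<xi> has_derivative (\<lambda>h. - 2 * complex_of_real pi * \<i> * complex_of_real (h \<bullet> \<xi>) * phase \<xi> t)) (at t)"
proof -
  have "((\<lambda>t. - 2 * complex_of_real pi * \<i> * complex_of_real (t \<bullet> \<xi>)) has_derivative
      (\<lambda>h. - 2 * complex_of_real pi * \<i> * complex_of_real (h \<bullet> \<xi>))) (at t)"
    by (intro bounded_linear_imp_has_derivative bounded_linear_const_mult
        bounded_linear_compose[OF bounded_linear_of_real] bounded_linear_inner_left)
  from has_derivative_compose[OF this DERIV_exp[unfolded has_field_derivative_def]]
  show ?thesis unfolding phase_def by (simp add: mult_ac)
qed

lemma partial_phase: "partial i (phase \<xi>) = (\<lambda>t. - 2 * complex_of_real pi * \<i> * complex_of_real (\<xi> $ i) * phase \<xi> t)"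
  using partial_eqI[OF phase_has_derivative] by (auto simp: inner_axis' )

lemma differentiable_phase: "phase \<xi> differentiable (at t)"
  using phase_has_derivative by (auto simp: differentiable_def)

lemma smooth_on_phase: "smooth_on UNIV (phase \<xi>)"
proof -
  have "C_on k UNIV (phase \<xi>)" for k
  proof (induction k)
    case 0
    show ?case using differentiable_phase
      by (auto intro!: differentiable_imp_continuous_on differentiable_at_imp_differentiable_on)
  next
    case (Suc k)
    show ?case unfolding C_on.simps partial_phase
      by (intro conjI allI ballI differentiable_phase C_on_mult[OF open_UNIV] C_on_const Suc)
  qed
  thus ?thesis unfolding smooth_on_def by blast
qed

lemma continuous_on_phase: "continuous_on S (phase \<xi>)"
  using continuous_on_subset[OF smooth_on_continuous[OF smooth_on_phase]] by blast

lemma phase_add: "phase (\<xi> + \<eta>) t = phase \<xi> t * phase \<eta> t"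
  unfolding phase_def by (simp add: inner_add_right distrib_left exp_add[symmetric])

lemma phase_translate: "phase \<xi> (s + t) = phase \<xi> s * phase \<xi> t"
  unfolding phase_def by (simp add: inner_add_left distrib_left exp_add[symmetric])

lemma phase_0 [simp]: "phase 0 t = 1"
  unfolding phase_def by simp

section \<open>Termwise differentiation and Fourier transforms of test functions\<close>

text \<open>For each coordinate the M-test makes the series of partial derivatives converge
  uniformly. Errors below \<open>e / CARD('n)\<close> in every coordinate add up to an error of at
  most \<open>e\<close> for the total derivative, uniformly in the point, which is what
  \<open>has_derivative_series\<close> asks for.\<close>

lemma suminf_partial:
  fixes F :: "nat \<Rightarrow> real ^ 'n::finite \<Rightarrow> complex"
  assumes diff: "\<And>n x. F n differentiable (at x)"
    and sum: "\<And>x. summable (\<lambda>n. F n x)"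
    and bound: "\<And>i. \<exists>M. summable M \<and> (\<forall>n x. cmod (partial i (F n) x) \<le> M n)"
  shows "(\<lambda>x. \<Sum>n. F n x) differentiable (at x)"
    and "partial i (\<lambda>x. \<Sum>n. F n x) x = (\<Sum>n. partial i (F n) x)"
proof -
  define f' where "f' n x h = (\<Sum>i\<in>UNIV. h $ i *\<^sub>R partial i (F n) x)" for n and x h :: "real ^ 'n"
  define g' where "g' x h = (\<Sum>i\<in>UNIV. h $ i *\<^sub>R (\<Sum>n. partial i (F n) x))" for x h :: "real ^ 'n"
  have lim: "uniform_limit UNIV (\<lambda>n x. \<Sum>j<n. partial i (F j) x) (\<lambda>x. \<Sum>n. partial i (F n) x) sequentially" for i
  proof -
    obtain M where "summable M" "\<And>n x. cmod (partial i (F n) x) \<le> M n" using bound[of i] by blast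
    thus ?thesis by (intro Weierstrass_m_test)
  qed
  have "\<exists>g. \<forall>x\<in>UNIV. (\<lambda>n. F n x) sums g x \<and> (g has_derivative g' x) (at x within UNIV)"
  proof (rule has_derivative_series)
    show "(F n has_derivative f' n x) (at x within UNIV)" for n x
      unfolding f'_def by (rule has_derivative_partials[OF diff])
    show "(\<lambda>n. F n 0) sums (\<Sum>n. F n 0)" using sum by (rule summable_sums)
    fix e :: real assume e: "e > 0"
    have "eventually (\<lambda>n. \<forall>i\<in>(UNIV::'n set). \<forall>x\<in>UNIV. dist (\<Sum>j<n. partial i (F j) x) (\<Sum>n. partial i (F n) x) < e / CARD('n)) sequentially"
      using e by (intro eventually_ball_finite ballI uniform_limitD[OF lim]) auto
    thus "eventually (\<lambda>n. \<forall>x\<in>UNIV. \<forall>h. norm ((\<Sum>j<n. f' j x h) - g' x h) \<le> e * norm h) sequentially"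
    proof eventually_elim
      case (elim n)
      have "norm ((\<Sum>j<n. f' j x h) - g' x h) \<le> e * norm h" for x h
      proof -
        have "(\<Sum>j<n. f' j x h) = (\<Sum>i\<in>UNIV. h $ i *\<^sub>R (\<Sum>j<n. partial i (F j) x))"
          unfolding f'_def by (subst sum.swap) (simp add: scaleR_sum_right)
        hence "(\<Sum>j<n. f' j x h) - g' x h = (\<Sum>i\<in>UNIV. h $ i *\<^sub>R ((\<Sum>j<n. partial i (F j) x) - (\<Sum>n. partial i (F n) x)))"
          unfolding g'_def by (simp add: sum_subtractf scaleR_diff_right)
        also have "norm \<dots> \<le> (\<Sum>i\<in>(UNIV::'n set). norm h * (e / CARD('n)))"
        proof (rule sum_norm_le)
          fix i
          have "norm ((\<Sum>j<n. partial i (F j) x) - (\<Sum>n. partial i (F n) x)) \<le> e / CARD('n)"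
          proof -
            have "dist (\<Sum>j<n. partial i (F j) x) (\<Sum>n. partial i (F n) x) < e / CARD('n)"
              using elim by blast
            thus ?thesis by (simp add: dist_norm)
          qed
          thus "norm (h $ i *\<^sub>R ((\<Sum>j<n. partial i (F j) x) - (\<Sum>n. partial i (F n) x))) \<le> norm h * (e / CARD('n))"
            using component_le_norm_cart[of h i] by (simp only: norm_scaleR, intro mult_mono) auto
        qed
        also have "\<dots> = e * norm h" by simp
        finally show ?thesis .
      qed
      thus ?case by blast
    qed
  qed auto
  then obtain g where g: "\<And>x. (\<lambda>n. F n x) sums g x" "\<And>x. (g has_derivative g' x) (at x)"
    by auto
  have "g = (\<lambda>x. \<Sum>n. F n x)" using g(1) by (auto simp: sums_iff)
  with g(2) have *: "((\<lambda>x. \<Sum>n. F n x) has_derivative g' x) (at x)" for x by simp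
  show "(\<lambda>x. \<Sum>n. F n x) differentiable (at x)" using * unfolding differentiable_def by blast
  have "g' x (axis i 1) = (\<Sum>j\<in>UNIV. if j = i then (\<Sum>n. partial j (F n) x) else 0)"
    unfolding g'_def by (intro sum.cong refl) (simp add: axis_def)
  thus "partial i (\<lambda>x. \<Sum>n. F n x) x = (\<Sum>n. partial i (F n) x)"
    unfolding partial_eqI[OF *] by simp
qed

text \<open>Normal convergence of the series and of all its derivatives on the whole space. Since
  all lists are allowed, the property passes from \<open>F\<close> to its partial derivatives, and
  smoothness of the sum follows by coinduction.\<close>

definition normally_summable :: "(nat \<Rightarrow> real ^ 'n::finite \<Rightarrow> complex) \<Rightarrow> bool"
  where "normally_summable F \<longleftrightarrow> (\<forall>n. smooth_on UNIV (F n)) \<and>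
    (\<forall>l. \<exists>M. summable M \<and> (\<forall>n x. cmod (partials l (F n) x) \<le> M n))"

lemma normally_summable_smooth: "normally_summable F \<Longrightarrow> smooth_on UNIV (F n)"
  unfolding normally_summable_def by simp

lemma normally_summable_bound:
  assumes "normally_summable F"
  shows "\<exists>M. summable M \<and> (\<forall>n x. cmod (partials l (F n) x) \<le> M n)"
  using assms unfolding normally_summable_def by simp

lemma normally_summable_summable:
  assumes "normally_summable F"
  shows "summable (\<lambda>n. partials l (F n) x)"
proof -
  obtain M where M: "summable M" "\<And>n x. cmod (partials l (F n) x) \<le> M n"
    using normally_summable_bound[OF assms, of l] by blast
  show ?thesis by (rule summable_comparison_test'[OF M(1), of 0]) (rule M(2))
qed

lemma normally_summable_partial:
  assumes "normally_summable F"
  shows "normally_summable (\<lambda>n. partial i (F n))"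
  unfolding normally_summable_def
proof (intro conjI allI)
  show "smooth_on UNIV (partial i (F n))" for n
    by (rule smooth_on_partial[OF normally_summable_smooth[OF assms]])
  fix l
  \<comment> \<open>With \<open>foldr\<close> the last entry of the list is differentiated first, so
    \<open>l @ [i]\<close> means \<open>l\<close> applied to \<open>partial i\<close>. For the same
    reason \<open>partials_suminf\<close> inducts from the right end.\<close>
  obtain M where "summable M" "\<And>n x. cmod (partials (l @ [i]) (F n) x) \<le> M n"
    using normally_summable_bound[OF assms, of "l @ [i]"] by blast
  thus "\<exists>M. summable M \<and> (\<forall>n x. cmod (partials l (partial i (F n)) x) \<le> M n)" by auto
qed

lemma normally_summable_suminf_partial:
  assumes "normally_summable F"
  shows "(\<lambda>x. \<Sum>n. F n x) differentiable (at x)"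
    and "partial i (\<lambda>x. \<Sum>n. F n x) = (\<lambda>x. \<Sum>n. partial i (F n) x)"
proof -
  have 1: "F n differentiable (at x)" for n x
    by (rule smooth_on_differentiable[OF normally_summable_smooth[OF assms] UNIV_I])
  have 2: "summable (\<lambda>n. F n x)" for x
    using normally_summable_summable[OF assms, of "[]"] by simp
  have 3: "\<exists>M. summable M \<and> (\<forall>n x. cmod (partial i (F n) x) \<le> M n)" for i
    using assms[unfolded normally_summable_def, THEN conjunct2, rule_format, of "[i]"] by simp
  show "(\<lambda>x. \<Sum>n. F n x) differentiable (at x)" by (rule suminf_partial(1)[OF 1 2 3])
  show "partial i (\<lambda>x. \<Sum>n. F n x) = (\<lambda>x. \<Sum>n. partial i (F n) x)"
    by (rule ext) (rule suminf_partial(2)[OF 1 2 3])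
qed

lemma smooth_on_suminf:
  assumes "normally_summable F"
  shows "smooth_on UNIV (\<lambda>x. \<Sum>n. F n x)"
proof (rule smooth_on_coinduct[of "\<lambda>f. \<exists>F. normally_summable F \<and> f = (\<lambda>x. \<Sum>n. F n x)"])
  show "\<exists>F'. normally_summable F' \<and> (\<lambda>x. \<Sum>n. F n x) = (\<lambda>x. \<Sum>n. F' n x)"
    using assms by blast
  show "\<exists>F'. normally_summable F' \<and> partial i f = (\<lambda>x. \<Sum>n. F' n x)"
    if "\<exists>F. normally_summable F \<and> f = (\<lambda>x. \<Sum>n. F n x)" for f i
  proof -
    from that obtain F where F: "normally_summable F" and f: "f = (\<lambda>x. \<Sum>n. F n x)" by blast
    show ?thesis
      using normally_summable_partial[OF F] normally_summable_suminf_partial(2)[OF F] unfolding f by blast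
  qed
qed (use normally_summable_suminf_partial(1) in auto)

lemma partials_suminf:
  assumes "normally_summable F"
  shows "partials l (\<lambda>x. \<Sum>n. F n x) = (\<lambda>x. \<Sum>n. partials l (F n) x)"
  using assms
proof (induction l arbitrary: F rule: rev_induct)
  case (snoc i l)
  show ?case
    using snoc.IH[OF normally_summable_partial[OF snoc.prems]]
    by (simp add: normally_summable_suminf_partial(2)[OF snoc.prems])
qed simp

section \<open>Compact supports, translation invariance and integrals of derivatives\<close>

lemma smooth_compact_supp_bounded:
  assumes "smooth_on UNIV f" "compact (supp f)"
  shows "\<exists>C>0. \<forall>x. cmod (f x) \<le> C"
proof -
  have "compact (f ` supp f)"
    by (intro compact_continuous_image assms continuous_on_subset[OF smooth_on_continuous[OF assms(1)]]) auto
  hence "bounded (f ` supp f)" by (rule compact_imp_bounded)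
  then obtain C where C: "C > 0" "\<And>x. x \<in> supp f \<Longrightarrow> cmod (f x) \<le> C"
    unfolding bounded_pos by blast
  moreover have "cmod (f x) \<le> C" for x
    using C not_in_supp[of x f] by (cases "x \<in> supp f") auto
  ultimately show ?thesis by blast
qed

lemma compact_supp_subset: "supp f \<subseteq> B \<Longrightarrow> compact B \<Longrightarrow> compact (supp f)"
  by (metis closed_supp compact_Int_closed inf.absorb2)

lemma compact_supp_mono: "supp f \<subseteq> supp g \<Longrightarrow> compact (supp g) \<Longrightarrow> compact (supp f)"
  by (rule compact_supp_subset)

lemma compact_supp_partial: "compact (supp f) \<Longrightarrow> compact (supp (partial i f))"
  by (rule compact_supp_mono[OF supp_partial])

lemma compact_supp_funpow: "compact (supp f) \<Longrightarrow> compact (supp ((partial i ^^ n) f))"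
  by (rule compact_supp_mono[OF supp_funpow])

lemma supp_mult: "supp (\<lambda>x. f x * g x) \<subseteq> supp f"
  by (rule supp_minimal) (auto simp: not_in_supp)

lemma integrable_compact_supp:
  fixes f :: "real ^ 'n::finite \<Rightarrow> complex"
  assumes "continuous_on UNIV f" "compact (supp f)"
  shows "integrable lborel f"
proof -
  have "integrable lborel (\<lambda>x. indicator (supp f) x *\<^sub>R f x)"
    by (intro borel_integrable_compact assms continuous_on_subset[OF assms(1)]) auto
  also have "(\<lambda>x. indicator (supp f) x *\<^sub>R f x) = f"
    by (auto simp: fun_eq_iff indicator_def not_in_supp)
  finally show ?thesis .
qed

lemma integral_translate:
  fixes f :: "real ^ 'n::finite \<Rightarrow> complex"
  assumes [measurable]: "f \<in> borel_measurable borel"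
  shows "(LINT x|lborel. f (c + x)) = (LINT x|lborel. f x)"
proof -
  have "(LINT x|lborel. f x) = (LINT x|distr lborel borel ((+) c). f x)"
    by (simp add: lborel_distr_plus)
  also have "\<dots> = (LINT x|lborel. f (c + x))" by (rule integral_distr) auto
  finally show ?thesis ..
qed

text \<open>Difference quotients have integral 0 by translation invariance. They converge to the
  partial derivative and are dominated by a Lipschitz constant on a fixed ball, so dominated
  convergence finishes the proof without iterated integrals.\<close>

lemma integral_partial_eq_0:
  fixes F :: "real ^ 'n::finite \<Rightarrow> complex"
  assumes sm: "smooth_on UNIV F" and cs: "compact (supp F)"
  shows "(LINT x|lborel. partial i F x) = 0"
proof -
  define e :: "real ^ 'n" where "e = axis i 1"
  have [simp]: "norm e = 1" unfolding e_def by (simp add: norm_axis_1)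
  have cont: "continuous_on UNIV F" by (rule smooth_on_continuous[OF sm])
  have "\<forall>j. \<exists>C>0. \<forall>x. cmod (partial j F x) \<le> C"
    by (intro allI smooth_compact_supp_bounded smooth_on_partial sm compact_supp_partial cs)
  then obtain C where C: "\<And>j. C j > 0" "\<And>j x. cmod (partial j F x) \<le> C j" by metis
  \<comment> \<open>A bound for the operator norm of the derivative everywhere, hence a global
    Lipschitz constant; it also serves as the dominating constant.\<close>
  define B where "B = (\<Sum>j\<in>UNIV. C j)"
  have B: "B > 0" unfolding B_def using C(1) by (intro sum_pos) auto
  have onorm: "onorm (\<lambda>h. \<Sum>i\<in>UNIV. h $ i *\<^sub>R partial i F x) \<le> B" for x
  proof (rule onorm_le)
    fix h :: "real ^ 'n"
    have "cmod (\<Sum>i\<in>UNIV. h $ i *\<^sub>R partial i F x) \<le> (\<Sum>i\<in>UNIV. norm h * C i)"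
      by (intro sum_norm_le) (auto intro!: mult_mono component_le_norm_cart C(2))
    thus "cmod (\<Sum>i\<in>UNIV. h $ i *\<^sub>R partial i F x) \<le> B * norm h"
      unfolding B_def by (simp add: sum_distrib_left mult.commute)
  qed
  have Lip: "cmod (F x - F y) \<le> B * norm (x - y)" for x y
    using differentiable_bound[of UNIV F, OF _ has_derivative_partials onorm]
      smooth_on_differentiable[OF sm] by auto
  obtain R where R: "R > 0" "\<And>x. x \<in> supp F \<Longrightarrow> norm x \<le> R"
    using compact_imp_bounded[OF cs] unfolding bounded_pos by blast
  \<comment> \<open>Steps of length at most 1 keep all difference quotients supported in the ball of
    radius \<open>R + 1\<close>.\<close>
  define h :: "nat \<Rightarrow> real" where "h m = 1 / Suc m" for m
  have h: "h m > 0" "h m \<le> 1" for m unfolding h_def by auto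
  have h0: "h \<longlonglongrightarrow> 0" unfolding h_def using LIMSEQ_inverse_real_of_nat by (simp add: inverse_eq_divide)
  define G where "G m x = (F (h m *\<^sub>R e + x) - F x) /\<^sub>R h m" for m x
  have far: "F (h m *\<^sub>R e + x) = 0" "F x = 0" if "norm x > R + 1" for x m
  proof -
    have "norm x \<le> norm (h m *\<^sub>R e + x) + norm (h m *\<^sub>R e)"
      using norm_triangle_sub[of x "- (h m *\<^sub>R e)"] by (simp add: add.commute)
    hence "norm (h m *\<^sub>R e + x) > R" "norm x > R" using h[of m] that by simp_all
    thus "F (h m *\<^sub>R e + x) = 0" "F x = 0" using R(2) not_in_supp by (meson not_le)+
  qed
  have contG: "continuous_on UNIV (\<lambda>x. F (h m *\<^sub>R e + x))" for m
    by (rule continuous_on_compose2[OF cont]) (auto intro: continuous_intros)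
  have csG: "compact (supp (\<lambda>x. F (h m *\<^sub>R e + x)))" for m
  proof (rule compact_supp_subset[OF _ compact_cball])
    show "supp (\<lambda>x. F (h m *\<^sub>R e + x)) \<subseteq> cball 0 (R + 1)"
    proof (rule supp_minimal)
      fix x :: "real ^ 'n" assume "x \<notin> cball 0 (R + 1)"
      thus "F (h m *\<^sub>R e + x) = 0" using far[of x] by simp
    qed simp
  qed
  have "(LINT x|lborel. G m x) = 0" for m
    unfolding G_def using integral_translate[OF borel_measurable_continuous_onI[OF cont], of "h m *\<^sub>R e"]
    by (simp add: Bochner_Integration.integral_diff integrable_compact_supp contG cont csG cs)
  moreover have "(\<lambda>m. LINT x|lborel. G m x) \<longlonglongrightarrow> (LINT x|lborel. partial i F x)"
  proof (rule integral_dominated_convergence[where w = "\<lambda>x. indicator (cball 0 (R + 1)) x *\<^sub>R B"])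
    show "partial i F \<in> borel_measurable lborel"
      using smooth_on_continuous[OF smooth_on_partial[OF sm]] borel_measurable_continuous_onI by auto
    show "G m \<in> borel_measurable lborel" for m
      unfolding G_def using borel_measurable_continuous_onI[OF contG] borel_measurable_continuous_onI[OF cont]
      by (intro borel_measurable_scaleR borel_measurable_diff) auto
    show "integrable lborel (\<lambda>x::real^'n. indicator (cball 0 (R + 1)) x *\<^sub>R B)"
      by (intro borel_integrable_compact) auto
    show "AE x in lborel. (\<lambda>m. G m x) \<longlonglongrightarrow> partial i F x"
    proof (rule AE_I2)
      fix x
      obtain F' where F': "(F has_derivative F') (at x)"
        using smooth_on_differentiable[OF sm UNIV_I] unfolding differentiable_def by blast
      interpret F': bounded_linear F' by (rule has_derivative_bounded_linear[OF F'])
      have eq: "F' e = partial i F x" unfolding e_def by (rule partial_eqI[OF F', symmetric])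
      have hne: "filterlim (\<lambda>m. h m *\<^sub>R e) (at 0) sequentially"
      proof (rule filterlim_atI)
        show "(\<lambda>m. h m *\<^sub>R e) \<longlonglongrightarrow> 0" using tendsto_scaleR[OF h0 tendsto_const[of e]] by simp
        show "eventually (\<lambda>m. h m *\<^sub>R e \<noteq> 0) sequentially"
        proof (intro always_eventually allI)
          fix m
          have "norm (h m *\<^sub>R e) = h m" using h(1)[of m] by simp
          thus "h m *\<^sub>R e \<noteq> 0" using h(1)[of m] by (metis norm_zero less_irrefl)
        qed
      qed
      have "(\<lambda>y. norm (F (x + y) - F x - F' y) / norm y) \<midarrow>0\<rightarrow> 0"
        using F' by (simp add: has_derivative_at)
      from filterlim_compose[OF this hne]
      have "(\<lambda>m. norm (F (x + h m *\<^sub>R e) - F x - F' (h m *\<^sub>R e)) / norm (h m *\<^sub>R e)) \<longlonglongrightarrow> 0" .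
      also have "(\<lambda>m. norm (F (x + h m *\<^sub>R e) - F x - F' (h m *\<^sub>R e)) / norm (h m *\<^sub>R e)) =
          (\<lambda>m. norm (G m x - partial i F x))"
      proof
        fix m
        have "G m x - partial i F x = (F (x + h m *\<^sub>R e) - F x - F' (h m *\<^sub>R e)) /\<^sub>R h m"
          unfolding G_def using h(1)[of m] by (simp add: F'.scaleR eq scaleR_diff_right add.commute)
        thus "norm (F (x + h m *\<^sub>R e) - F x - F' (h m *\<^sub>R e)) / norm (h m *\<^sub>R e) = norm (G m x - partial i F x)"
          using h(1)[of m] by (simp add: divide_inverse mult.commute)
      qed
      finally show "(\<lambda>m. G m x) \<longlonglongrightarrow> partial i F x"
        by (rule LIM_zero_cancel[OF tendsto_norm_zero_cancel])
    qed
    show "AE x in lborel. cmod (G m x) \<le> indicator (cball 0 (R + 1)) x *\<^sub>R B" for m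
    proof (rule AE_I2)
      fix x
      show "cmod (G m x) \<le> indicator (cball 0 (R + 1)) x *\<^sub>R B"
      proof (cases "x \<in> cball 0 (R + 1)")
        case True
        have "cmod (F (h m *\<^sub>R e + x) - F x) \<le> B * h m"
          using Lip[of "h m *\<^sub>R e + x" x] h(1)[of m] by simp
        hence "cmod (G m x) \<le> B"
          unfolding G_def using h(1)[of m] by (simp add: divide_simps flip: divide_inverse_commute)
        thus ?thesis using True by simp
      next
        case False
        hence "F (h m *\<^sub>R e + x) = 0" "F x = 0" using far[of x] by simp_all
        thus ?thesis using False unfolding G_def by simp
      qed
    qed
  qed
  ultimately show ?thesis by (simp add: LIMSEQ_const_iff)
qed

section \<open>Fourier transforms of test functions\<close>

definition fourier :: "(real ^ 'n::finite \<Rightarrow> complex) \<Rightarrow> real ^ 'n \<Rightarrow> complex"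
  where "fourier F \<xi> = (LINT t|lborel. F t * phase \<xi> t)"

text \<open>Integration by parts: the product rule for \<open>F t * phase \<xi> t\<close>, whose
  partial derivative has integral 0.\<close>

lemma fourier_partial:
  assumes sm: "smooth_on UNIV F" and cs: "compact (supp F)"
  shows "fourier (partial i F) \<xi> = 2 * complex_of_real pi * \<i> * complex_of_real (\<xi> $ i) * fourier F \<xi>"
proof -
  let ?c = "2 * complex_of_real pi * \<i> * complex_of_real (\<xi> $ i)"
  have cs': "compact (supp (\<lambda>t. F t * phase \<xi> t))"
    by (rule compact_supp_mono[OF supp_mult cs])
  have "partial i (\<lambda>t. F t * phase \<xi> t) t = partial i F t * phase \<xi> t - ?c * (F t * phase \<xi> t)" for t
    using partial_mult[OF smooth_on_differentiable[OF sm UNIV_I] differentiable_phase]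
    by (simp add: partial_phase)
  hence "0 = (LINT t|lborel. partial i F t * phase \<xi> t - ?c * (F t * phase \<xi> t))"
    using integral_partial_eq_0[of "\<lambda>t. F t * phase \<xi> t" i, OF smooth_on_mult[OF open_UNIV sm smooth_on_phase] cs'] by simp
  also have "\<dots> = fourier (partial i F) \<xi> - ?c * fourier F \<xi>"
    unfolding fourier_def
    by (subst Bochner_Integration.integral_diff)
      (auto intro!: integrable_mult_right integrable_compact_supp cs' compact_supp_mono[OF supp_mult compact_supp_partial[OF cs]]
        smooth_on_continuous smooth_on_mult smooth_on_phase sm smooth_on_partial)
  finally show ?thesis by simp
qed

lemma fourier_funpow:
  assumes "smooth_on UNIV F" "compact (supp F)"
  shows "fourier ((partial i ^^ n) F) \<xi> = (2 * complex_of_real pi * \<i> * complex_of_real (\<xi> $ i)) ^ n * fourier F \<xi>"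
  by (induction n) (simp_all add: fourier_partial smooth_on_funpow compact_supp_funpow assms)

text \<open>Only pure derivatives occur: at each frequency, integrate by parts in the direction of a
  dominant coordinate.\<close>

lemma fourier_decay:
  fixes F :: "real ^ 'n::finite \<Rightarrow> complex"
  assumes sm: "smooth_on UNIV F" and cs: "compact B" "supp F \<subseteq> B"
    and bound: "\<And>i t. cmod ((partial i ^^ p) F t) \<le> Z"
  shows "norm \<xi> ^ p * cmod (fourier F \<xi>) \<le> (CARD('n)) ^ p * (measure lborel B * Z)"
proof -
  have cs': "compact (supp F)" by (rule compact_supp_subset[OF cs(2,1)])
  obtain i where i: "\<And>j. \<bar>\<xi> $ j\<bar> \<le> \<bar>\<xi> $ i\<bar>"
    using Max_in[of "range (\<lambda>j. \<bar>\<xi> $ j\<bar>)"] Max_ge[of "range (\<lambda>j. \<bar>\<xi> $ j\<bar>)"] by fastforce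
  have "norm \<xi> \<le> (\<Sum>j\<in>UNIV. \<bar>\<xi> $ j\<bar>)" by (rule norm_le_l1_cart)
  also have "\<dots> \<le> CARD('n) * \<bar>\<xi> $ i\<bar>"
    using sum_bounded_above[of UNIV "\<lambda>j. \<bar>\<xi> $ j\<bar>" "\<bar>\<xi> $ i\<bar>"] i by simp
  \<comment> \<open>The factor \<open>2 * pi\<close>, which exceeds 1, is inserted to match the
    multiplier in \<open>fourier_funpow\<close>.\<close>
  also have "\<dots> \<le> CARD('n) * \<bar>2 * pi * \<xi> $ i\<bar>"
  proof -
    have "1 * \<bar>\<xi> $ i\<bar> \<le> (2 * pi) * \<bar>\<xi> $ i\<bar>"
      using pi_gt3 by (intro mult_right_mono) auto
    thus ?thesis by (simp add: abs_mult)
  qed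
  finally have "norm \<xi> ^ p \<le> (CARD('n) * \<bar>2 * pi * \<xi> $ i\<bar>) ^ p" by (intro power_mono) auto
  hence "norm \<xi> ^ p * cmod (fourier F \<xi>) \<le> (CARD('n) * \<bar>2 * pi * \<xi> $ i\<bar>) ^ p * cmod (fourier F \<xi>)"
    by (intro mult_right_mono) auto
  also have "\<dots> = CARD('n) ^ p * cmod (fourier ((partial i ^^ p) F) \<xi>)"
    by (simp add: fourier_funpow[OF sm cs'] norm_mult norm_power power_mult_distrib abs_mult)
  also have "\<dots> \<le> CARD('n) ^ p * (measure lborel B * Z)"
  proof (intro mult_left_mono)
    have zero: "(partial i ^^ p) F t = 0" if "t \<notin> B" for t
      using supp_funpow[where f = F and i = i and n = p] cs(2) that by (intro not_in_supp) auto
    have "cmod (fourier ((partial i ^^ p) F) \<xi>) \<le> (LINT t|lborel. cmod ((partial i ^^ p) F t * phase \<xi> t))"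
      unfolding fourier_def by (rule integral_norm_bound)
    also have "\<dots> \<le> (LINT t|lborel. indicator B t *\<^sub>R Z)"
    proof (rule integral_mono)
      show "integrable lborel (\<lambda>t. cmod ((partial i ^^ p) F t * phase \<xi> t))"
        by (intro integrable_norm integrable_compact_supp compact_supp_mono[OF supp_mult compact_supp_funpow[OF cs']]
            continuous_on_mult continuous_on_phase smooth_on_continuous sm smooth_on_funpow)
      show "integrable lborel (\<lambda>t. indicator B t *\<^sub>R Z)" by (intro borel_integrable_compact cs) auto
    qed (use bound zero in \<open>auto simp: norm_mult indicator_def\<close>)
    also have "\<dots> = measure lborel B * Z"
      using emeasure_compact_finite[OF cs(1)] compact_imp_closed[OF cs(1)] by simp
    finally show "cmod (fourier ((partial i ^^ p) F) \<xi>) \<le> measure lborel B * Z" .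
  qed auto
  finally show ?thesis by simp
qed

section \<open>Fourier series on a cube\<close>

definition lattice :: "(real ^ 'n::finite) set"
  where "lattice = {k. \<forall>i. k $ i \<in> \<int>}"

text \<open>A product over the coordinates, so that its sum over the lattice reduces to one
  dimension; at the same time it is bounded below by a constant times the power
  \<open>- 2 * CARD('n)\<close> of the norm at nonzero lattice points.\<close>

definition weight :: "real ^ 'n::finite \<Rightarrow> real"
  where "weight k = (\<Prod>i\<in>UNIV. 1 / (1 + (k $ i)\<^sup>2))"

lemma summable_inverse_one_plus_square: "summable (\<lambda>n::nat. 1 / (1 + (real n)\<^sup>2))"
proof (rule summable_comparison_test')
  show "summable (\<lambda>n. 2 * (1 / (real n + 1)\<^sup>2))"
    using inverse_squares_sums by (intro summable_mult) (simp add: sums_iff add.commute)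
  show "norm (1 / (1 + (real n)\<^sup>2)) \<le> 2 * (1 / (real n + 1)\<^sup>2)" for n
  proof -
    have "(real n + 1)\<^sup>2 \<le> 2 * (1 + (real n)\<^sup>2)"
      using zero_le_power2[of "real n - 1"] by (simp add: power2_eq_square algebra_simps)
    moreover have "1 + (real n)\<^sup>2 > 0" by (simp add: add_pos_nonneg)
    ultimately show ?thesis by (simp add: divide_simps)
  qed
qed

lemma abs_summable_int: "Infinite_Set_Sum.abs_summable_on (\<lambda>k::int. 1 / (1 + (real_of_int k)\<^sup>2)) UNIV"
proof -
  let ?f = "\<lambda>k::int. 1 / (1 + (real_of_int k)\<^sup>2)"
  have *: "norm (1 / (1 + (real n)\<^sup>2)) = 1 / (1 + (real n)\<^sup>2)" for n
    by (simp add: add_nonneg_nonneg)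
  have "Infinite_Set_Sum.abs_summable_on ?f (range int)"
    by (rule abs_summable_on_reindex)
      (simp only: abs_summable_on_nat_iff' * of_int_of_nat_eq summable_inverse_one_plus_square)
  moreover have "Infinite_Set_Sum.abs_summable_on ?f (range (\<lambda>n. - int n))"
    by (rule abs_summable_on_reindex)
      (simp only: abs_summable_on_nat_iff' * of_int_of_nat_eq of_int_minus power2_minus summable_inverse_one_plus_square)
  ultimately have "Infinite_Set_Sum.abs_summable_on ?f (range int \<union> range (\<lambda>n. - int n))"
    by (rule abs_summable_on_union)
  also have "range int \<union> range (\<lambda>n. - int n) = UNIV"
  proof -
    have "k \<in> range int \<union> range (\<lambda>n. - int n)" for k
      by (cases k rule: int_cases2) auto
    thus ?thesis by blast
  qed
  finally show ?thesis .
qed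

text \<open>Sums over the lattice become ordinary series, to which termwise differentiation and
  integration apply. The weights are summable because a product over coordinates of absolutely
  summable families is absolutely summable.\<close>

lemma lattice_enumeration:
  "\<exists>\<kappa> :: nat \<Rightarrow> real ^ 'n::finite. inj \<kappa> \<and> range \<kappa> = lattice \<and> summable (\<lambda>n. weight (\<kappa> n))"
proof -
  let ?v = "\<lambda>g::'n \<Rightarrow> int. (\<chi> i. real_of_int (g i)) :: real ^ 'n"
  have "infinite (UNIV :: ('n \<Rightarrow> int) set)" by (simp add: finite_UNIV_fun)
  then obtain b :: "nat \<Rightarrow> 'n \<Rightarrow> int" where b: "bij_betw b UNIV UNIV"
    using countable_infiniteE'[of "UNIV :: ('n \<Rightarrow> int) set"] by auto
  define \<kappa> where "\<kappa> n = ?v (b n)" for n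
  have "inj ?v" by (auto simp: inj_def vec_eq_iff)
  hence "inj \<kappa>"
    using b unfolding \<kappa>_def bij_betw_def inj_def by blast
  moreover have "range \<kappa> = lattice"
  proof -
    have "k \<in> range ?v" if "k \<in> lattice" for k
    proof -
      show ?thesis
        by (rule image_eqI[where x = "\<lambda>i. \<lfloor>k $ i\<rfloor>"]) (use that in \<open>simp_all add: lattice_def vec_eq_iff\<close>)
    qed
    hence "range ?v = lattice" unfolding lattice_def by auto
    moreover have "range \<kappa> = ?v ` range b" unfolding \<kappa>_def by blast
    ultimately show ?thesis using b by (simp add: bij_betw_def)
  qed
  moreover have "summable (\<lambda>n. weight (\<kappa> n))"
  proof -
    let ?w = "\<lambda>g::'n \<Rightarrow> int. \<Prod>i\<in>UNIV. 1 / (1 + (real_of_int (g i))\<^sup>2)"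
    have "Infinite_Set_Sum.abs_summable_on ?w (PiE UNIV (\<lambda>_. UNIV))"
      by (intro abs_summable_on_prod_PiE abs_summable_int) auto
    hence "Infinite_Set_Sum.abs_summable_on ?w UNIV" by simp
    hence "Infinite_Set_Sum.abs_summable_on (\<lambda>n. ?w (b n)) UNIV"
      by (simp add: abs_summable_on_reindex_bij_betw[OF b, of ?w])
    hence "summable (\<lambda>n. norm (?w (b n)))" by (simp only: abs_summable_on_nat_iff')
    moreover have "norm (?w (b n)) = weight (\<kappa> n)" for n
      unfolding weight_def \<kappa>_def by (simp add: prod_nonneg add_nonneg_nonneg)
    ultimately show ?thesis by simp
  qed
  ultimately show ?thesis by blast
qed

definition zvec :: "nat \<Rightarrow> real ^ 'n::finite"
  where "zvec = (SOME \<kappa>. inj \<kappa> \<and> range \<kappa> = lattice \<and> summable (\<lambda>n. weight (\<kappa> n)))"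

lemma inj_zvec: "inj zvec" and range_zvec: "range zvec = lattice"
  and summable_weight: "summable (\<lambda>n. weight (zvec n))"
  using someI_ex[OF lattice_enumeration] unfolding zvec_def by auto

lemma zvec_in_lattice: "zvec n \<in> lattice"
  using range_zvec by blast

lemma weight_pos: "weight k > 0"
  unfolding weight_def by (intro prod_pos) (simp add: add_pos_nonneg)

lemma norm_lattice_ge_1:
  assumes "k \<in> lattice" "k \<noteq> 0"
  shows "norm k \<ge> 1"
proof -
  obtain i where "k $ i \<noteq> 0" using assms(2) by (auto simp: vec_eq_iff)
  moreover have "k $ i \<in> \<int>" using assms(1) by (simp add: lattice_def)
  ultimately have "1 \<le> \<bar>k $ i\<bar>" by (auto elim!: Ints_cases)
  thus ?thesis using component_le_norm_cart[of k i] by simp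
qed

text \<open>A nonzero lattice point has norm at least 1, so each factor \<open>1 + (k $ i)^2\<close>
  is at most \<open>2 * (norm k)^2\<close>.\<close>

lemma norm_power_le_weight:
  fixes k :: "real ^ 'n::finite"
  assumes "k \<in> lattice" "k \<noteq> 0"
  shows "1 \<le> 2 ^ CARD('n) * norm k ^ (2 * CARD('n)) * weight k"
proof -
  have "(\<Prod>i\<in>UNIV. 1 + (k $ i)\<^sup>2) \<le> (\<Prod>i\<in>(UNIV::'n set). 2 * (norm k)\<^sup>2)"
  proof (intro prod_mono conjI)
    fix i
    have "(k $ i)\<^sup>2 \<le> (norm k)\<^sup>2"
      using power_mono[OF component_le_norm_cart[of k i], of 2] by simp
    moreover have "1 \<le> (norm k)\<^sup>2" using norm_lattice_ge_1[OF assms] by simp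
    ultimately show "1 + (k $ i)\<^sup>2 \<le> 2 * (norm k)\<^sup>2" by simp
  qed simp
  hence "(\<Prod>i\<in>UNIV. 1 + (k $ i)\<^sup>2) \<le> 2 ^ CARD('n) * norm k ^ (2 * CARD('n))"
    by (simp add: power_mult_distrib power_mult)
  moreover have "(\<Prod>i\<in>UNIV. 1 + (k $ i)\<^sup>2) > 0" by (intro prod_pos) (simp add: add_pos_nonneg)
  moreover have "weight k = 1 / (\<Prod>i\<in>UNIV. 1 + (k $ i)\<^sup>2)"
    unfolding weight_def by (simp add: prod_dividef)
  ultimately show ?thesis by (simp add: pos_le_divide_eq)
qed

text \<open>Spends \<open>2 * CARD('n)\<close> additional powers of \<open>norm k\<close> on
  summability over the lattice. At \<open>k = 0\<close> these powers give no information, so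
  \<open>C0\<close> covers that term; it counts only for \<open>p = 0\<close>, where
  \<open>0 ^ 0 = 1\<close>.\<close>

lemma le_weight:
  fixes k :: "real ^ 'n::finite"
  assumes "k \<in> lattice" "A \<ge> 0" "C \<ge> 0" "C0 \<ge> 0"
    and "norm k ^ (p + 2 * CARD('n)) * A \<le> C"
    and "k = 0 \<Longrightarrow> p = 0 \<Longrightarrow> A \<le> C0"
  shows "norm k ^ p * A \<le> (2 ^ CARD('n) * C + C0) * weight k"
proof (cases "k = 0")
  case True
  have "norm k ^ p * A \<le> C0" using assms(4,6) True by (cases p) auto
  also have "\<dots> \<le> 2 ^ CARD('n) * C + C0" using assms by simp
  also have "\<dots> = (2 ^ CARD('n) * C + C0) * weight k" using True by (simp add: weight_def)
  finally show ?thesis .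
next
  case False
  have "norm k ^ p * A * 1 \<le> norm k ^ p * A * (2 ^ CARD('n) * norm k ^ (2 * CARD('n)) * weight k)"
    using assms(2) norm_power_le_weight[OF assms(1) False] by (intro mult_left_mono) auto
  also have "\<dots> = 2 ^ CARD('n) * weight k * (norm k ^ (p + 2 * CARD('n)) * A)"
    by (simp add: power_add)
  also have "\<dots> \<le> 2 ^ CARD('n) * weight k * C"
    using assms(5) weight_pos[of k] by (intro mult_left_mono) auto
  also have "\<dots> \<le> (2 ^ CARD('n) * C + C0) * weight k"
    using assms(4) weight_pos[of k] by (simp add: algebra_simps)
  finally show ?thesis by simp
qed

section \<open>Derivatives and normal convergence of trigonometric series\<close>

lemma partials_phase: "\<exists>\<mu>. partials l (phase \<xi>) = (\<lambda>t. \<mu> * phase \<xi> t) \<and> cmod \<mu> \<le> (2 * pi * norm \<xi>) ^ length l"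
proof (induction l)
  case Nil
  show ?case by (intro exI[of _ 1]) simp
next
  case (Cons i l)
  then obtain \<mu> where \<mu>: "partials l (phase \<xi>) = (\<lambda>t. \<mu> * phase \<xi> t)" "cmod \<mu> \<le> (2 * pi * norm \<xi>) ^ length l"
    by blast
  let ?\<nu> = "- 2 * complex_of_real pi * \<i> * complex_of_real (\<xi> $ i)"
  have "partials (i # l) (phase \<xi>) = (\<lambda>t. (\<mu> * ?\<nu>) * phase \<xi> t)"
    by (simp add: \<mu>(1) fun_eq_iff partial_cmult[OF differentiable_phase] partial_phase)
  moreover have "cmod (\<mu> * ?\<nu>) \<le> (2 * pi * norm \<xi>) ^ length (i # l)"
  proof -
    have "cmod (\<mu> * ?\<nu>) = cmod \<mu> * (2 * pi * \<bar>\<xi> $ i\<bar>)" by (simp add: norm_mult)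
    also have "\<dots> \<le> (2 * pi * norm \<xi>) ^ length l * (2 * pi * norm \<xi>)"
      by (intro mult_mono \<mu>(2)) (simp_all add: component_le_norm_cart)
    finally show ?thesis by (simp add: mult.commute)
  qed
  ultimately show ?case by blast
qed

lemma norm_partials_cmult_phase:
  "cmod (partials l (\<lambda>t. c * phase \<xi> t) x) \<le> cmod c * (2 * pi * norm \<xi>) ^ length l"
proof -
  obtain \<mu> where "partials l (phase \<xi>) = (\<lambda>t. \<mu> * phase \<xi> t)" "cmod \<mu> \<le> (2 * pi * norm \<xi>) ^ length l"
    using partials_phase by blast
  thus ?thesis by (simp add: partials_cmult[OF smooth_on_phase] norm_mult mult_left_mono)
qed

lemma smooth_on_cmult_phase: "smooth_on UNIV (\<lambda>t. c * phase \<xi> t)"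
  by (intro smooth_on_mult smooth_on_const smooth_on_phase open_UNIV)

lemma normally_summable_phase:
  assumes "\<And>p. summable (\<lambda>n. norm (\<xi> n) ^ p * cmod (a n))"
  shows "normally_summable (\<lambda>n t. a n * phase (\<xi> n) t)"
  unfolding normally_summable_def
proof (intro conjI allI smooth_on_cmult_phase)
  fix l :: "'a list"
  let ?M = "\<lambda>n. (2 * pi) ^ length l * (norm (\<xi> n) ^ length l * cmod (a n))"
  have "summable ?M" by (intro summable_mult assms)
  moreover have "cmod (partials l (\<lambda>t. a n * phase (\<xi> n) t) x) \<le> ?M n" for n x
    using norm_partials_cmult_phase[of l "a n" "\<xi> n" x] by (simp add: power_mult_distrib mult_ac)
  ultimately show "\<exists>M. summable M \<and> (\<forall>n x. cmod (partials l (\<lambda>t. a n * phase (\<xi> n) t) x) \<le> M n)" by blast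
qed

text \<open>The half-open cube makes the cutting and shifting below exact, without null sets.\<close>

definition hcube :: "real ^ 'n::finite \<Rightarrow> (real ^ 'n) set"
  where "hcube c = {x. \<forall>i. c $ i - 1 / 2 \<le> x $ i \<and> x $ i < c $ i + 1 / 2}"

definition ccube :: "real ^ 'n::finite \<Rightarrow> (real ^ 'n) set"
  where "ccube c = cbox (c - vec (1 / 2)) (c + vec (1 / 2))"

lemma mem_ccube: "x \<in> ccube c \<longleftrightarrow> (\<forall>i. c $ i - 1 / 2 \<le> x $ i \<and> x $ i \<le> c $ i + 1 / 2)"
  unfolding ccube_def by (simp add: mem_box_cart)

lemma hcube_subset_ccube: "hcube c \<subseteq> ccube c"
  unfolding hcube_def by (auto simp: mem_ccube less_imp_le)

lemma compact_ccube: "compact (ccube c)"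
  unfolding ccube_def by (rule compact_cbox)

section \<open>Integration over the unit cube and orthogonality of characters\<close>

lemma sets_halfspaces [measurable]:
  "{x :: real ^ 'n::finite. a \<le> x $ i} \<in> sets borel" "{x :: real ^ 'n. x $ i < a} \<in> sets borel"
proof -
  have "closed {x :: real ^ 'n. a \<le> x $ i}" by (rule closed_halfspace_component_ge_cart)
  thus "{x :: real ^ 'n. a \<le> x $ i} \<in> sets borel" by simp
  have "open {x :: real ^ 'n. x $ i < a}" by (rule open_halfspace_component_lt_cart)
  thus "{x :: real ^ 'n. x $ i < a} \<in> sets borel" by simp
qed

lemma sets_hcube [measurable]: "hcube c \<in> sets borel"
proof -
  have "hcube c = (\<Inter>i\<in>UNIV. {x. c $ i - 1 / 2 \<le> x $ i} \<inter> {x. x $ i < c $ i + 1 / 2})"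
    unfolding hcube_def by auto
  also have "\<dots> \<in> sets borel" by (intro sets.finite_INT sets.Int sets_halfspaces) auto
  finally show ?thesis .
qed

text \<open>The half-open cube lies between the open and the closed box, which have the same
  measure.\<close>

lemma measure_hcube: "measure lborel (hcube (c :: real ^ 'n::finite)) = 1"
proof -
  let ?a = "c - vec (1 / 2)" and ?b = "c + vec (1 / 2)"
  have 1: "measure lborel (cbox ?a ?b) = 1"
    by (subst content_cbox_cart) (auto simp: interval_eq_empty_cart)
  hence 2: "measure lborel (box ?a ?b) = 1"
    by (simp add: measure_lborel_box_eq measure_lborel_cbox_eq)
  have sub: "box ?a ?b \<subseteq> hcube c" unfolding hcube_def by (auto simp: mem_box_cart intro: less_imp_le)
  have fin: "emeasure lborel (cbox ?a ?b) < \<infinity>" by (intro emeasure_bounded_finite bounded_cbox)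
  have fmc: "cbox ?a ?b \<in> fmeasurable lborel" using fin by (intro fmeasurableI) auto
  have fmh: "hcube c \<in> fmeasurable lborel"
    by (rule fmeasurableI2[OF fmc hcube_subset_ccube[of c, unfolded ccube_def]]) simp
  have "measure lborel (box ?a ?b) \<le> measure lborel (hcube c)"
    by (rule measure_mono_fmeasurable[OF sub _ fmh]) simp
  moreover have "measure lborel (hcube c) \<le> measure lborel (cbox ?a ?b)"
    by (rule measure_mono_fmeasurable[OF hcube_subset_ccube[of c, unfolded ccube_def] _ fmc]) simp
  ultimately show ?thesis using 1 2 by simp
qed

lemma integrable_on_hcube:
  fixes f :: "real ^ 'n::finite \<Rightarrow> 'b::{banach, second_countable_topology}"
  assumes "continuous_on UNIV f" "A \<subseteq> ccube c" "A \<in> sets borel"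
  shows "integrable lborel (\<lambda>x. indicator A x *\<^sub>R f x)"
proof -
  have "compact (f ` ccube c)"
    by (intro compact_continuous_image compact_ccube continuous_on_subset[OF assms(1)]) simp
  hence "bounded (f ` ccube c)" by (rule compact_imp_bounded)
  then obtain B where B: "\<And>x. x \<in> ccube c \<Longrightarrow> norm (f x) \<le> B"
    unfolding bounded_iff by blast
  have "bounded A" by (rule bounded_subset[OF compact_imp_bounded[OF compact_ccube] assms(2)])
  hence "emeasure lborel A < \<infinity>" by (rule emeasure_bounded_finite)
  moreover have "f \<in> borel_measurable lborel" using borel_measurable_continuous_onI[OF assms(1)] by simp
  ultimately show ?thesis
    using assms(2,3) B by (intro integrableI_bounded_set_indicator[where B = B] AE_I2) auto
qed

text \<open>The cube shifted by \<open>s\<close> in direction \<open>i\<close> is the original cube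
  with its bottom slab of thickness \<open>s\<close> moved up by one period.\<close>

lemma hcube_shift_split:
  fixes c y :: "real ^ 'n::finite" and i :: 'n
  assumes s: "0 \<le> s" "s \<le> 1"
  defines "e \<equiv> axis i 1 :: real ^ 'n"
  shows "indicator (hcube c) (y - s *\<^sub>R e) =
    (indicator (hcube c \<inter> {x. c $ i - 1 / 2 + s \<le> x $ i}) y
      + indicator (hcube c \<inter> {x. x $ i < c $ i - 1 / 2 + s}) (y - e) :: real)"
proof -
  have 1: "y - t *\<^sub>R e \<in> hcube c \<longleftrightarrow>
      (\<forall>j. j \<noteq> i \<longrightarrow> c $ j - 1 / 2 \<le> y $ j \<and> y $ j < c $ j + 1 / 2) \<and>
      c $ i - 1 / 2 + t \<le> y $ i \<and> y $ i < c $ i + 1 / 2 + t" for t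
  proof -
    have comp: "(y - t *\<^sub>R e) $ j = (if j = i then y $ i - t else y $ j)" for j
      unfolding e_def by (simp add: axis_def)
    have "(\<forall>j. P j) \<longleftrightarrow> (\<forall>j. j \<noteq> i \<longrightarrow> P j) \<and> P i" for P by metis
    from this[of "\<lambda>j. c $ j - 1 / 2 \<le> (y - t *\<^sub>R e) $ j \<and> (y - t *\<^sub>R e) $ j < c $ j + 1 / 2"]
    show ?thesis unfolding hcube_def mem_Collect_eq comp by (simp add: algebra_simps)
  qed
  have 2: "(y - e) $ i = y $ i - 1" unfolding e_def by (simp add: axis_def)
  show ?thesis
    using 1[of s] 1[of 0] 1[of 1] 2 s by (auto simp: indicator_def)
qed

text \<open>A change of variables shifts the cube instead of the function. The slab that sticks out
  is moved back by one period, where \<open>f\<close> has the same values.\<close>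

lemma integral_hcube_shift:
  fixes f :: "real ^ 'n::finite \<Rightarrow> complex" and c :: "real ^ 'n"
  assumes cont: "continuous_on UNIV f" and per: "\<And>x. f (axis i 1 + x) = f x" and s: "0 \<le> s" "s \<le> 1"
  shows "(LINT x|lborel. indicator (hcube c) x *\<^sub>R f (s *\<^sub>R axis i 1 + x)) = (LINT x|lborel. indicator (hcube c) x *\<^sub>R f x)"
proof -
  define e :: "real ^ 'n" where "e = axis i 1"
  define P where "P = hcube c \<inter> {x. x $ i < c $ i - 1 / 2 + s}"
  define P' where "P' = hcube c \<inter> {x. c $ i - 1 / 2 + s \<le> x $ i}"
  have sets [measurable]: "P \<in> sets borel" "P' \<in> sets borel" unfolding P_def P'_def by measurable
  have sub: "P \<subseteq> ccube c" "P' \<subseteq> ccube c" using hcube_subset_ccube[of c] unfolding P_def P'_def by auto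
  have [measurable]: "f \<in> borel_measurable borel" by (rule borel_measurable_continuous_onI[OF cont])
  let ?I = "\<lambda>P. LINT x|lborel. indicator P x *\<^sub>R f x"
  have "(LINT x|lborel. indicator (hcube c) x *\<^sub>R f (s *\<^sub>R e + x))
      = (LINT x|lborel. indicator (hcube c) (s *\<^sub>R e + x - s *\<^sub>R e) *\<^sub>R f (s *\<^sub>R e + x))"
    by simp
  also have "\<dots> = (LINT y|lborel. indicator (hcube c) (y - s *\<^sub>R e) *\<^sub>R f y)"
    by (rule integral_translate[of "\<lambda>y. indicator (hcube c) (y - s *\<^sub>R e) *\<^sub>R f y"]) measurable
  also have "\<dots> = (LINT y|lborel. indicator P' y *\<^sub>R f y + indicator P (y - e) *\<^sub>R f y)"
    unfolding P_def P'_def e_def by (simp add: hcube_shift_split[OF s] scaleR_add_left)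
  also have "\<dots> = ?I P' + (LINT y|lborel. indicator P (y - e) *\<^sub>R f y)"
  proof (rule Bochner_Integration.integral_add)
    show "integrable lborel (\<lambda>y. indicator P' y *\<^sub>R f y)"
      by (rule integrable_on_hcube[OF cont sub(2) sets(2)])
    have per': "f y = f (- e + y)" for y using per[of "- e + y"] unfolding e_def by simp
    have "integrable (distr lborel borel ((+) (- e))) (\<lambda>y. indicator P y *\<^sub>R f y)"
      unfolding lborel_distr_plus by (rule integrable_on_hcube[OF cont sub(1) sets(1)])
    hence "integrable lborel (\<lambda>y. indicator P (- e + y) *\<^sub>R f (- e + y))"
      by (subst (asm) integrable_distr_eq) auto
    thus "integrable lborel (\<lambda>y. indicator P (y - e) *\<^sub>R f y)"
      using per' by (simp add: add.commute)
  qed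
  also have "(LINT y|lborel. indicator P (y - e) *\<^sub>R f y) = (LINT x|lborel. indicator P (e + x - e) *\<^sub>R f (e + x))"
    by (rule integral_translate[symmetric, of "\<lambda>y. indicator P (y - e) *\<^sub>R f y"]) measurable
  also have "\<dots> = ?I P" using per unfolding e_def by simp
  also have "?I P' + ?I P = (LINT x|lborel. indicator P' x *\<^sub>R f x + indicator P x *\<^sub>R f x)"
    by (intro Bochner_Integration.integral_add[symmetric]
        integrable_on_hcube[OF cont sub(2) sets(2)] integrable_on_hcube[OF cont sub(1) sets(1)])
  also have "\<dots> = ?I (hcube c)"
    unfolding P_def P'_def by (intro Bochner_Integration.integral_cong refl) (auto simp: indicator_def)
  finally show ?thesis unfolding e_def .
qed

text \<open>For \<open>k \<noteq> 0\<close> no integral is computed: a shift by half a period in a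
  coordinate with \<open>k $ i \<noteq> 0\<close> preserves the integral and flips the sign of the
  character.\<close>

lemma phase_lattice_orthogonal:
  fixes k c :: "real ^ 'n::finite"
  assumes k: "k \<in> lattice"
  shows "(LINT x|lborel. indicator (hcube c) x *\<^sub>R phase k x) = (if k = 0 then 1 else 0)"
proof (cases "k = 0")
  case True
  have "integrable lborel (indicator (hcube c) :: _ \<Rightarrow> real)"
    using integrable_on_hcube[of "\<lambda>_. 1 :: real", OF _ hcube_subset_ccube sets_hcube] by simp
  thus ?thesis using True measure_hcube[of c] by simp
next
  case False
  then obtain i where i: "k $ i \<noteq> 0" by (auto simp: vec_eq_iff)
  obtain m :: int where m: "k $ i = of_int m" using k by (auto simp: lattice_def elim: Ints_cases)
  have m0: "m \<noteq> 0" using i m by simp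
  \<comment> \<open>Half the period of the character in direction \<open>i\<close>; it does not
    exceed 1 because \<open>k $ i\<close> is a nonzero integer.\<close>
  define s where "s = 1 / (2 * \<bar>k $ i\<bar>)"
  have "\<bar>m\<bar> \<ge> 1" using m0 by simp
  hence "\<bar>k $ i\<bar> \<ge> 1" unfolding m by simp
  hence s: "0 \<le> s" "s \<le> 1" unfolding s_def by (auto simp: divide_simps)
  have inner: "(t *\<^sub>R axis i 1) \<bullet> k = t * k $ i" for t by (simp add: inner_axis')
  have "phase k (axis i 1) = exp (- (2 * complex_of_real pi * \<i> * of_int m))"
    unfolding phase_def using inner[of 1] m by (simp add: mult_ac)
  also have "\<dots> = 1" using exp_integer_2pi[of "of_int (- m)"] by (simp add: mult_ac)
  finally have per: "phase k (axis i 1 + x) = phase k x" for x by (simp add: phase_translate)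
  have sk: "s * k $ i = sgn (k $ i) / 2" unfolding s_def using i by (simp add: sgn_if)
  have "phase k (s *\<^sub>R axis i 1) = exp (- 2 * complex_of_real pi * \<i> * complex_of_real (sgn (k $ i) / 2))"
    unfolding phase_def inner sk ..
  also have "\<dots> = -1"
  proof (cases "k $ i > 0")
    case True
    thus ?thesis by (simp add: exp_minus mult_ac)
  next
    case False
    thus ?thesis using i by (simp add: mult_ac)
  qed
  finally have "phase k (s *\<^sub>R axis i 1) = -1" .
  hence "phase k (s *\<^sub>R axis i 1 + x) = - phase k x" for x by (simp add: phase_translate)
  with integral_hcube_shift[OF continuous_on_phase per s, of c]
  have "- (LINT x|lborel. indicator (hcube c) x *\<^sub>R phase k x) = (LINT x|lborel. indicator (hcube c) x *\<^sub>R phase k x)"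
    by (simp del: integral_indicator)
  thus ?thesis using False by simp
qed

section \<open>Trigonometric polynomials and completeness of the characters\<close>

lemma lattice_0: "0 \<in> lattice" and lattice_axis: "axis j 1 \<in> lattice"
  by (auto simp: lattice_def axis_def)

lemma lattice_add: "k \<in> lattice \<Longrightarrow> l \<in> lattice \<Longrightarrow> k + l \<in> lattice"
  and lattice_minus: "k \<in> lattice \<Longrightarrow> - k \<in> lattice"
  by (auto simp: lattice_def)

text \<open>The linear span of the lattice characters. As an inductive predicate it makes closure
  under products, and the vanishing of integrals against all of them, plain inductions.\<close>

inductive trig_poly :: "(real ^ 'n::finite \<Rightarrow> complex) \<Rightarrow> bool" where
  phase: "k \<in> lattice \<Longrightarrow> trig_poly (\<lambda>t. a * phase k t)"
| add: "trig_poly f \<Longrightarrow> trig_poly g \<Longrightarrow> trig_poly (\<lambda>t. f t + g t)"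

lemma trig_poly_const: "trig_poly (\<lambda>t. a)"
  using trig_poly.phase[OF lattice_0, of a] by simp

lemma trig_poly_mult:
  assumes "trig_poly f" "trig_poly g"
  shows "trig_poly (\<lambda>t. f t * g t)"
  using assms
proof (induction f rule: trig_poly.induct)
  case (phase k a)
  from phase.prems show ?case
  proof (induction g rule: trig_poly.induct)
    case (phase l b)
    have "trig_poly (\<lambda>t. (a * b) * phase (k + l) t)"
      by (intro trig_poly.phase lattice_add phase.hyps \<open>k \<in> lattice\<close>)
    thus ?case by (simp add: phase_add mult_ac)
  next
    case (add f g)
    from trig_poly.add[OF add.IH] show ?case by (simp add: distrib_left)
  qed
next
  case (add f f')
  from trig_poly.add[OF add.IH(1)[OF add.prems] add.IH(2)[OF add.prems]]
  show ?case by (simp add: distrib_right)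
qed

lemma trig_poly_power: "trig_poly f \<Longrightarrow> trig_poly (\<lambda>t. f t ^ n)"
  by (induction n) (auto intro: trig_poly_const trig_poly_mult)

lemma trig_poly_prod:
  "finite A \<Longrightarrow> (\<And>i. i \<in> A \<Longrightarrow> trig_poly (f i)) \<Longrightarrow> trig_poly (\<lambda>t. \<Prod>i\<in>A. f i t)"
  by (induction A rule: finite_induct) (auto intro: trig_poly_const trig_poly_mult)

text \<open>A trigonometric polynomial with values in \<open>[0, 1]\<close> that equals 1 only at points congruent to
  \<open>x\<close>: its powers concentrate at \<open>x\<close>.\<close>

definition peak :: "real ^ 'n::finite \<Rightarrow> real ^ 'n \<Rightarrow> real"
  where "peak x t = (\<Prod>j\<in>UNIV. (1 + cos (2 * pi * (t $ j - x $ j))) / 2)"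

lemma trig_poly_peak: "trig_poly (\<lambda>t. complex_of_real (peak x t))"
proof -
  have eq: "complex_of_real ((1 + cos (2 * pi * (t $ j - x $ j))) / 2) =
      1 / 2 + (exp (- 2 * complex_of_real pi * \<i> * x $ j) / 4 * phase (- axis j 1) t
        + exp (2 * complex_of_real pi * \<i> * x $ j) / 4 * phase (axis j 1) t)" for j t
  proof -
    have 1: "t \<bullet> axis j 1 = t $ j" by (simp add: inner_axis)
    have "cos (complex_of_real (2 * pi * (t $ j - x $ j))) =
        (exp (\<i> * complex_of_real (2 * pi * (t $ j - x $ j))) + exp (- (\<i> * complex_of_real (2 * pi * (t $ j - x $ j))))) / 2"
      by (rule cos_exp_eq)
    also have "exp (\<i> * complex_of_real (2 * pi * (t $ j - x $ j))) =
        exp (- 2 * complex_of_real pi * \<i> * x $ j) * phase (- axis j 1) t"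
      unfolding phase_def by (simp add: 1 exp_add[symmetric] algebra_simps)
    also have "exp (- (\<i> * complex_of_real (2 * pi * (t $ j - x $ j)))) =
        exp (2 * complex_of_real pi * \<i> * x $ j) * phase (axis j 1) t"
      unfolding phase_def by (simp add: 1 exp_add[symmetric] algebra_simps)
    finally have 2: "cos (complex_of_real (2 * pi * (t $ j - x $ j))) =
        (exp (- 2 * complex_of_real pi * \<i> * x $ j) * phase (- axis j 1) t
          + exp (2 * complex_of_real pi * \<i> * x $ j) * phase (axis j 1) t) / 2" .
    have 3: "(1 + (p * e + q * f) / 2) / 2 = 1 / 2 + (p / 4 * e + q / 4 * f)" for p q e f :: complex
      by (simp add: field_simps)
    have "complex_of_real ((1 + cos (2 * pi * (t $ j - x $ j))) / 2) =
        (1 + cos (complex_of_real (2 * pi * (t $ j - x $ j)))) / 2"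
      by (simp only: of_real_divide of_real_add of_real_1 of_real_numeral cos_of_real)
    thus ?thesis unfolding 2 3 .
  qed
  have "trig_poly (\<lambda>t. complex_of_real ((1 + cos (2 * pi * (t $ j - x $ j))) / 2))" for j
    unfolding eq by (intro trig_poly.add trig_poly_const trig_poly.phase lattice_minus lattice_axis)
  from trig_poly_prod[OF finite this] show ?thesis
    unfolding peak_def of_real_prod .
qed

lemma peak_factor: "0 \<le> (1 + cos (y :: real)) / 2" "(1 + cos y) / 2 \<le> (1 :: real)"
proof -
  have "0 \<le> (1 + z) / 2" if "- 1 \<le> z" for z :: real using that by simp
  from this[OF cos_ge_minus_one] show "0 \<le> (1 + cos y) / 2" .
  show "(1 + cos y) / 2 \<le> 1" by simp
qed

lemma peak_nonneg: "0 \<le> peak x t"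
  unfolding peak_def by (intro prod_nonneg peak_factor ballI)

lemma continuous_on_peak: "continuous_on UNIV (peak x)"
  unfolding peak_def by (intro continuous_intros) simp

text \<open>Some coordinate differs, and its factor is below 1: the cosine equals 1 only at integer
  distances, and a nonzero distance below 1 is not an integer.\<close>

lemma peak_less_1:
  assumes "t \<noteq> x" "\<And>j. \<bar>t $ j - x $ j\<bar> < 1"
  shows "peak x t < 1"
proof -
  let ?f = "\<lambda>j. (1 + cos (2 * pi * (t $ j - x $ j))) / 2"
  obtain j where j: "t $ j \<noteq> x $ j" using assms(1) by (auto simp: vec_eq_iff)
  have "cos (2 * pi * (t $ j - x $ j)) \<noteq> 1"
  proof
    assume "cos (2 * pi * (t $ j - x $ j)) = 1"
    then obtain n :: int where "2 * pi * (t $ j - x $ j) = of_int n * 2 * pi"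
      unfolding cos_one_2pi_int by blast
    hence n: "t $ j - x $ j = of_int n" by simp
    hence "\<bar>real_of_int n\<bar> < 1" using assms(2)[of j] by simp
    hence "n = 0" by linarith
    thus False using n j by simp
  qed
  hence "cos (2 * pi * (t $ j - x $ j)) < 1" by (rule le_neq_trans[OF cos_le_one])
  hence "?f j < 1" by simp
  moreover have "(\<Prod>j\<in>UNIV. ?f j) = ?f j * (\<Prod>j\<in>UNIV - {j}. ?f j)" by (rule prod.remove) auto
  moreover have "?f j * (\<Prod>j\<in>UNIV - {j}. ?f j) \<le> ?f j * 1"
    by (intro mult_left_mono prod_le_1 conjI peak_factor)
  ultimately show ?thesis unfolding peak_def by simp
qed

text \<open>If \<open>R x \<noteq> 0\<close>, then \<open>S\<close> is bounded below by
  \<open>\<delta> > 0\<close> near \<open>x\<close>, while its integral against every power of the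
  peak is 0. Near \<open>x\<close> the \<open>N\<close>-th power contributes at least a multiple of
  \<open>\<rho>' ^ N\<close>, far from \<open>x\<close> at most a multiple of
  \<open>\<rho> ^ N\<close> in absolute value, and \<open>\<rho> < \<rho>'\<close>. The point
  \<open>x\<close> has to be interior because then no other point of the closed cube is congruent to
  it.\<close>

lemma fourier_unique:
  fixes R :: "real ^ 'n::finite \<Rightarrow> complex"
  assumes cont: "continuous_on UNIV R"
    and zero: "\<And>k. k \<in> lattice \<Longrightarrow> (LINT t|lborel. indicator (hcube c) t *\<^sub>R (R t * phase k t)) = 0"
    and x: "\<And>i. \<bar>x $ i - c $ i\<bar> < 1 / 2"
  shows "R x = 0"
proof (rule ccontr)
  assume Rx: "R x \<noteq> 0"
  have trig: "continuous_on UNIV f \<and> (LINT t|lborel. indicator (hcube c) t *\<^sub>R (R t * f t)) = 0" if "trig_poly f" for f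
    using that
  proof (induction f rule: trig_poly.induct)
    case (phase k a)
    have "(LINT t|lborel. indicator (hcube c) t *\<^sub>R (R t * (a * phase k t)))
        = (LINT t|lborel. a * (indicator (hcube c) t *\<^sub>R (R t * phase k t)))" by (simp add: mult_ac)
    also have "\<dots> = a * (LINT t|lborel. indicator (hcube c) t *\<^sub>R (R t * phase k t))"
      by (rule integral_mult_right_zero)
    finally show ?case using zero[OF phase] by (simp add: continuous_on_mult_left continuous_on_phase)
  next
    case (add f g)
    have "(LINT t|lborel. indicator (hcube c) t *\<^sub>R (R t * (f t + g t)))
        = (LINT t|lborel. indicator (hcube c) t *\<^sub>R (R t * f t) + indicator (hcube c) t *\<^sub>R (R t * g t))"
      by (simp add: distrib_left scaleR_add_right)
    also have "\<dots> = 0"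
      by (subst Bochner_Integration.integral_add)
        (use add.IH in \<open>auto intro!: integrable_on_hcube[OF _ hcube_subset_ccube] continuous_on_mult cont\<close>)
    finally show ?case using add.IH by (simp add: continuous_on_add)
  qed
  \<comment> \<open>Rotated so that the value at \<open>x\<close> is the positive number
    \<open>cmod (R x) ^ 2\<close>.\<close>
  define S where "S t = Re (cnj (R x) * R t)" for t
  have contS: "continuous_on UNIV S" unfolding S_def by (intro continuous_intros cont)
  define \<delta> where "\<delta> = S x / 2"
  have Sx: "S x = (cmod (R x))\<^sup>2" unfolding S_def by (metis complex_norm_square mult.commute Re_complex_of_real)
  have \<delta>: "\<delta> > 0" "S x > \<delta>" unfolding \<delta>_def Sx using Rx by simp_all
  let ?box = "box (c - vec (1 / 2)) (c + vec (1 / 2))"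
  have "c $ i - 1 / 2 < x $ i \<and> x $ i < c $ i + 1 / 2" for i using x[of i] by linarith
  hence xbox: "x \<in> ?box" by (simp add: mem_box_cart)
  have "open (?box \<inter> {t. \<delta> < S t})"
    by (intro open_Int open_box open_Collect_less contS continuous_on_const)
  then obtain r where r: "r > 0" "ball x r \<subseteq> ?box \<inter> {t. \<delta> < S t}"
    using xbox \<delta>(2) openE[of "?box \<inter> {t. \<delta> < S t}" x] by blast
  have box_hcube: "?box \<subseteq> hcube c" unfolding hcube_def by (auto simp: mem_box_cart less_imp_le)
  have "compact (ccube c - ball x r)" by (intro compact_diff compact_ccube open_ball)
  moreover have less1: "peak x t < 1" if "t \<in> ccube c - ball x r" for t
  proof (rule peak_less_1)
    show "t \<noteq> x" using that r(1) by auto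
    fix j
    have "c $ j - 1 / 2 \<le> t $ j" "t $ j \<le> c $ j + 1 / 2" using that by (auto simp: mem_ccube)
    thus "\<bar>t $ j - x $ j\<bar> < 1" using x[of j] by linarith
  qed
  ultimately obtain \<rho> where \<rho>: "0 \<le> \<rho>" "\<rho> < 1" "\<And>t. t \<in> ccube c - ball x r \<Longrightarrow> peak x t \<le> \<rho>"
  proof (cases "ccube c - ball x r = {}")
    case True
    show ?thesis by (rule that[of 0]) (use True in auto)
  next
    case False
    from continuous_attains_sup[OF \<open>compact (ccube c - ball x r)\<close> False, of "peak x"]
    obtain t where t: "t \<in> ccube c - ball x r" "\<forall>s\<in>ccube c - ball x r. peak x s \<le> peak x t"
      using continuous_on_subset[OF continuous_on_peak] by blast
    show ?thesis using that[of "peak x t"] peak_nonneg less1[OF t(1)] t(2) by blast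
  qed
  \<comment> \<open>Any number strictly between \<open>\<rho>\<close> and 1 would do; by continuity
    the peak exceeds it on a small ball around \<open>x\<close>.\<close>
  define \<rho>' where "\<rho>' = (1 + \<rho>) / 2"
  have \<rho>': "\<rho> < \<rho>'" "\<rho>' < 1" "0 < \<rho>'" using \<rho> unfolding \<rho>'_def by auto
  have "open {t. \<rho>' < peak x t}" by (intro open_Collect_less continuous_on_peak continuous_on_const)
  moreover have "x \<in> {t. \<rho>' < peak x t}" using \<rho>'(2) by (simp add: peak_def)
  ultimately obtain s where s: "s > 0" "ball x s \<subseteq> {t. \<rho>' < peak x t}"
    using openE by blast
  define r' where "r' = min r s"
  have r': "r' > 0" "ball x r' \<subseteq> ball x r" "ball x r' \<subseteq> ball x s" unfolding r'_def using r s by auto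
  have ball_sub: "ball x r' \<subseteq> ccube c"
    using r'(2) r(2) box_hcube hcube_subset_ccube[of c] by blast
  have "compact (S ` ccube c)"
    by (intro compact_continuous_image compact_ccube continuous_on_subset[OF contS]) simp
  hence "bounded (S ` ccube c)" by (rule compact_imp_bounded)
  then obtain B where B: "B > 0" "\<And>t. t \<in> ccube c \<Longrightarrow> \<bar>S t\<bar> \<le> B"
    unfolding bounded_pos by auto
  define v where "v = measure lborel (ball x r')"
  have v: "v > 0" unfolding v_def by (rule content_ball_pos[OF r'(1)])
  have key: "\<rho>' ^ N * (\<delta> * v) \<le> B * \<rho> ^ N" for N
  proof -
    have contN: "continuous_on UNIV (\<lambda>t. S t * peak x t ^ N)"
      by (intro continuous_intros contS continuous_on_peak)
    have tN: "trig_poly (\<lambda>t. complex_of_real (peak x t) ^ N)"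
      by (rule trig_poly_power[OF trig_poly_peak])
    have contRN: "continuous_on UNIV (\<lambda>t. cnj (R x) * (R t * complex_of_real (peak x t) ^ N))"
      by (intro continuous_intros cont conjunct1[OF trig[OF tN]])
    have "(LINT t|lborel. indicator (hcube c) t *\<^sub>R (S t * peak x t ^ N)) =
        (LINT t|lborel. Re (indicator (hcube c) t *\<^sub>R (cnj (R x) * (R t * complex_of_real (peak x t) ^ N))))"
    proof (rule Bochner_Integration.integral_cong[OF refl])
      fix t
      have "cnj (R x) * (R t * complex_of_real (peak x t) ^ N) = (cnj (R x) * R t) * complex_of_real (peak x t ^ N)"
        by simp
      thus "indicator (hcube c) t *\<^sub>R (S t * peak x t ^ N) =
          Re (indicator (hcube c) t *\<^sub>R (cnj (R x) * (R t * complex_of_real (peak x t) ^ N)))"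
        unfolding S_def by (simp add: algebra_simps)
    qed
    also have "\<dots> = Re (LINT t|lborel. indicator (hcube c) t *\<^sub>R (cnj (R x) * (R t * complex_of_real (peak x t) ^ N)))"
      by (intro integral_Re integrable_on_hcube[OF contRN hcube_subset_ccube sets_hcube])
    also have "(LINT t|lborel. indicator (hcube c) t *\<^sub>R (cnj (R x) * (R t * complex_of_real (peak x t) ^ N)))
        = (LINT t|lborel. cnj (R x) * (indicator (hcube c) t *\<^sub>R (R t * complex_of_real (peak x t) ^ N)))"
      by simp
    also have "\<dots> = cnj (R x) * (LINT t|lborel. indicator (hcube c) t *\<^sub>R (R t * complex_of_real (peak x t) ^ N))"
      by (rule integral_mult_right_zero)
    also have "\<dots> = 0" using conjunct2[OF trig[OF tN]] by simp
    finally have I0: "(LINT t|lborel. indicator (hcube c) t *\<^sub>R (S t * peak x t ^ N)) = 0" by simp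
    have int1: "integrable lborel (\<lambda>t. indicator (ball x r') t *\<^sub>R (\<delta> * \<rho>' ^ N))"
      by (rule integrable_on_hcube[where c = c])
        (use ball_sub in \<open>simp_all add: continuous_on_const\<close>)
    have int2: "integrable lborel (\<lambda>t. indicator (hcube c) t *\<^sub>R (B * \<rho> ^ N))"
      by (rule integrable_on_hcube[OF _ hcube_subset_ccube sets_hcube]) (rule continuous_on_const)
    have "(LINT t|lborel. indicator (ball x r') t *\<^sub>R (\<delta> * \<rho>' ^ N) - indicator (hcube c) t *\<^sub>R (B * \<rho> ^ N))
        \<le> (LINT t|lborel. indicator (hcube c) t *\<^sub>R (S t * peak x t ^ N))"
    proof (rule integral_mono)
      show "integrable lborel (\<lambda>t. indicator (hcube c) t *\<^sub>R (S t * peak x t ^ N))"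
        by (rule integrable_on_hcube[OF contN hcube_subset_ccube sets_hcube])
      show "integrable lborel (\<lambda>t. indicator (ball x r') t *\<^sub>R (\<delta> * \<rho>' ^ N) - indicator (hcube c) t *\<^sub>R (B * \<rho> ^ N))"
        by (intro Bochner_Integration.integrable_diff int1 int2)
      fix t
      have B\<rho>: "0 \<le> B * \<rho> ^ N" using B(1) \<rho>(1) by simp
      consider "t \<in> ball x r'" | "t \<in> ball x r" "t \<notin> ball x r'" | "t \<notin> ball x r" "t \<in> hcube c" | "t \<notin> ball x r" "t \<notin> hcube c"
        by blast
      thus "indicator (ball x r') t *\<^sub>R (\<delta> * \<rho>' ^ N) - indicator (hcube c) t *\<^sub>R (B * \<rho> ^ N)
          \<le> indicator (hcube c) t *\<^sub>R (S t * peak x t ^ N)"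
      proof cases
        case 1
        have "t \<in> hcube c" "\<delta> < S t" "\<rho>' < peak x t" using 1 r' r(2) s(2) box_hcube by blast+
        moreover from this have "\<delta> * \<rho>' ^ N \<le> S t * peak x t ^ N"
          using \<delta> \<rho>' by (intro mult_mono power_mono) auto
        ultimately show ?thesis using 1 B\<rho> by simp
      next
        case 2
        have "t \<in> hcube c" "\<delta> < S t" using 2 r(2) box_hcube by blast+
        moreover from this have "0 \<le> S t" using \<delta> by linarith
        hence "0 \<le> S t * peak x t ^ N" by (simp add: peak_nonneg)
        ultimately show ?thesis using 2 B\<rho> by simp
      next
        case 3
        hence tc: "t \<in> ccube c - ball x r" using hcube_subset_ccube by blast
        have "\<bar>S t * peak x t ^ N\<bar> = \<bar>S t\<bar> * peak x t ^ N" by (simp add: abs_mult peak_nonneg)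
        also have "\<dots> \<le> B * \<rho> ^ N"
          using \<rho>(3)[OF tc] B(2)[of t] tc peak_nonneg B(1) by (intro mult_mono power_mono) auto
        finally have "- (B * \<rho> ^ N) \<le> S t * peak x t ^ N" by linarith
        moreover have "t \<notin> ball x r'" using 3 r'(2) by blast
        ultimately show ?thesis using 3 by simp
      next
        case 4
        moreover have "t \<notin> ball x r'" using 4 r'(2) by blast
        ultimately show ?thesis by simp
      qed
    qed
    also have "(LINT t|lborel. indicator (ball x r') t *\<^sub>R (\<delta> * \<rho>' ^ N) - indicator (hcube c) t *\<^sub>R (B * \<rho> ^ N))
        = v * (\<delta> * \<rho>' ^ N) - B * \<rho> ^ N"
    proof -
      have 1: "integrable lborel (indicator (hcube c) :: _ \<Rightarrow> real)"
        using integrable_on_hcube[of "\<lambda>_. 1 :: real", OF _ hcube_subset_ccube sets_hcube] by simp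
      have 2: "integrable lborel (indicator (ball x r') :: _ \<Rightarrow> real)"
        using integrable_on_hcube[of "\<lambda>_. 1 :: real", OF _ ball_sub] by simp
      show ?thesis
        by (subst Bochner_Integration.integral_diff[OF int1 int2])
          (use 1 2 measure_hcube[of c] in \<open>simp add: v_def\<close>)
    qed
    finally show ?thesis using I0 by (simp add: mult_ac)
  qed
  have "\<rho> / \<rho>' < 1" using \<rho>' by simp
  moreover have "0 < \<delta> * v / B" using \<delta> v B by simp
  ultimately obtain N where N: "(\<rho> / \<rho>') ^ N < \<delta> * v / B"
    using real_arch_pow_inv by blast
  have "\<rho> ^ N * B < \<rho>' ^ N * (\<delta> * v)"
    using N B(1) \<rho>'(3) by (simp add: power_divide field_simps)
  thus False using key[of N] by (simp add: mult.commute)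
qed

section \<open>Fourier series of test functions\<close>

lemma fourier_rapid_decay:
  fixes \<psi> :: "real ^ 'n::finite \<Rightarrow> complex"
  assumes sm: "smooth_on UNIV \<psi>" and cs: "compact (supp \<psi>)"
  shows "\<exists>C. \<forall>\<xi>. norm \<xi> ^ p * cmod (fourier \<psi> \<xi>) \<le> C"
proof -
  have "\<forall>i. \<exists>C>0. \<forall>x. cmod ((partial i ^^ p) \<psi> x) \<le> C"
    by (intro allI smooth_compact_supp_bounded smooth_on_funpow sm compact_supp_funpow cs)
  then obtain C where C: "\<And>i x. C i > 0" "\<And>i x. cmod ((partial i ^^ p) \<psi> x) \<le> C i" by metis
  have "cmod ((partial i ^^ p) \<psi> x) \<le> (\<Sum>i\<in>UNIV. C i)" for i x
    using C(2)[of i x] member_le_sum[of i UNIV C] C(1) by (force intro: less_imp_le)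
  from fourier_decay[OF sm cs order_refl this] show ?thesis by blast
qed

lemma fourier_lattice_summable:
  fixes \<psi> :: "real ^ 'n::finite \<Rightarrow> complex"
  assumes sm: "smooth_on UNIV \<psi>" and cs: "compact (supp \<psi>)"
  shows "summable (\<lambda>n. norm (zvec n :: real ^ 'n) ^ p * cmod (fourier \<psi> (zvec n)))"
proof -
  obtain C where C: "\<And>\<xi>. norm \<xi> ^ (p + 2 * CARD('n)) * cmod (fourier \<psi> \<xi>) \<le> C"
    using fourier_rapid_decay[OF sm cs] by blast
  have "0 \<le> norm (0 :: real ^ 'n) ^ (p + 2 * CARD('n)) * cmod (fourier \<psi> 0)" by simp
  with C[of 0] have C0: "C \<ge> 0" by linarith
  let ?C = "2 ^ CARD('n) * C + cmod (fourier \<psi> 0)"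
  have le: "norm (zvec n :: real ^ 'n) ^ p * cmod (fourier \<psi> (zvec n)) \<le> ?C * weight (zvec n :: real ^ 'n)" for n
    by (rule le_weight[OF zvec_in_lattice]) (use C C0 in auto)
  have sw: "summable (\<lambda>n. ?C * weight (zvec n :: real ^ 'n))" by (intro summable_mult summable_weight)
  show ?thesis by (rule summable_comparison_test'[OF sw, of 0]) (use le in simp)
qed

text \<open>As \<open>\<psi>\<close> lives in the cube, its Fourier transform at a lattice point is
  its Fourier coefficient. Termwise integration and orthogonality show that \<open>\<psi>\<close>
  minus its series has vanishing coefficients; this difference is continuous, so
  \<open>fourier_unique\<close> applies at interior points.\<close>

lemma fourier_series:
  fixes \<psi> :: "real ^ 'n::finite \<Rightarrow> complex"
  assumes sm: "smooth_on UNIV \<psi>" and cs: "compact (supp \<psi>)" and sub: "supp \<psi> \<subseteq> hcube c"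
    and x: "\<And>i. \<bar>x $ i - c $ i\<bar> < 1 / 2"
  shows "\<psi> x = (\<Sum>n. fourier \<psi> (zvec n) * phase (- zvec n) x)"
proof -
  let ?F = "\<lambda>n (x :: real ^ 'n). fourier \<psi> (zvec n) * phase (- zvec n) x"
  have ns: "normally_summable ?F"
    by (rule normally_summable_phase) (simp add: fourier_lattice_summable[OF sm cs])
  have contF: "continuous_on UNIV (\<lambda>x. \<Sum>n. ?F n x)"
    by (rule smooth_on_continuous[OF smooth_on_suminf[OF ns]])
  have contR: "continuous_on UNIV (\<lambda>x. \<psi> x - (\<Sum>n. ?F n x))"
    by (intro continuous_on_diff contF smooth_on_continuous[OF sm])
  have summ: "summable (\<lambda>n. cmod (fourier \<psi> (zvec n)))" using fourier_lattice_summable[OF sm cs, of 0] by simp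
  have "(LINT t|lborel. indicator (hcube c) t *\<^sub>R ((\<psi> t - (\<Sum>n. ?F n t)) * phase k t)) = 0" if k: "k \<in> lattice" for k
  proof -
    have "k \<in> range zvec" using k range_zvec by blast
    then obtain m where m: "k = zvec m" by blast
    have 1: "(LINT t|lborel. indicator (hcube c) t *\<^sub>R (\<psi> t * phase k t)) = fourier \<psi> k"
      unfolding fourier_def
    proof (rule Bochner_Integration.integral_cong[OF refl])
      fix t
      show "indicator (hcube c) t *\<^sub>R (\<psi> t * phase k t) = \<psi> t * phase k t"
        using sub not_in_supp[of t \<psi>] by (cases "t \<in> supp \<psi>") auto
    qed
    define g where "g n t = fourier \<psi> (zvec n) * (indicator (hcube c) t *\<^sub>R phase (k - zvec n) t)" for n and t :: "real ^ 'n"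
    have g: "indicator (hcube c) t *\<^sub>R (?F n t * phase k t) = g n t" for n t
      unfolding g_def using phase_add[of "- zvec n" k t] by (simp add: mult_ac)
    have "(LINT t|lborel. indicator (hcube c) t *\<^sub>R ((\<Sum>n. ?F n t) * phase k t)) = (LINT t|lborel. (\<Sum>n. g n t))"
    proof (rule Bochner_Integration.integral_cong[OF refl])
      fix t
      have s: "summable (\<lambda>n. ?F n t)" using normally_summable_summable[OF ns, of "[]"] by simp
      have "(\<Sum>n. g n t) = (\<Sum>n. indicator (hcube c) t *\<^sub>R (?F n t * phase k t))" using g by simp
      also have "\<dots> = indicator (hcube c) t *\<^sub>R (\<Sum>n. ?F n t * phase k t)"
        by (rule suminf_scaleR_right[symmetric, OF summable_mult2[OF s]])
      also have "(\<Sum>n. ?F n t * phase k t) = (\<Sum>n. ?F n t) * phase k t"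
        by (rule suminf_mult2[symmetric, OF s])
      finally show "indicator (hcube c) t *\<^sub>R ((\<Sum>n. ?F n t) * phase k t) = (\<Sum>n. g n t)" ..
    qed
    also have "\<dots> = (\<Sum>n. LINT t|lborel. g n t)"
    proof (rule integral_suminf)
      have int: "integrable lborel (\<lambda>t. indicator (hcube c) t *\<^sub>R phase (k - zvec n) t)" for n
        by (rule integrable_on_hcube[OF continuous_on_phase hcube_subset_ccube sets_hcube])
      show "integrable lborel (g n)" for n unfolding g_def by (intro integrable_mult_right int)
      have ng: "norm (g n t) = cmod (fourier \<psi> (zvec n)) * indicator (hcube c) t" for n t
        unfolding g_def by (simp add: norm_mult)
      show "AE t in lborel. summable (\<lambda>n. norm (g n t))"
        unfolding ng by (intro AE_I2 summable_mult2 summ)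
      have "(LINT t|lborel. norm (g n t)) = cmod (fourier \<psi> (zvec n))" for n
        unfolding ng using measure_hcube[of c] by simp
      thus "summable (\<lambda>n. LINT t|lborel. norm (g n t))" using summ by simp
    qed
    also have "(\<lambda>n. LINT t|lborel. g n t) = (\<lambda>n. if n = m then fourier \<psi> k else 0)"
    proof
      fix n
      have "(LINT t|lborel. g n t) = fourier \<psi> (zvec n) * (LINT t|lborel. indicator (hcube c) t *\<^sub>R phase (k - zvec n) t)"
        unfolding g_def by (rule integral_mult_right_zero)
      also have "k - zvec n \<in> lattice" using lattice_add[OF k lattice_minus[OF zvec_in_lattice[of n]]] by simp
      hence "(LINT t|lborel. indicator (hcube c) t *\<^sub>R phase (k - zvec n) t) = (if k - zvec n = 0 then 1 else 0)"
        by (rule phase_lattice_orthogonal)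
      also have "k - zvec n = 0 \<longleftrightarrow> n = m" unfolding m using inj_zvec by (auto simp: inj_def)
      finally show "(LINT t|lborel. g n t) = (if n = m then fourier \<psi> k else 0)" using m by simp
    qed
    also have "(\<Sum>n. if n = m then fourier \<psi> k else 0) = fourier \<psi> k"
      using sums_single[of m "\<lambda>_. fourier \<psi> k"] by (simp add: sums_iff)
    finally have 2: "(LINT t|lborel. indicator (hcube c) t *\<^sub>R ((\<Sum>n. ?F n t) * phase k t)) = fourier \<psi> k" .
    have "(LINT t|lborel. indicator (hcube c) t *\<^sub>R ((\<psi> t - (\<Sum>n. ?F n t)) * phase k t)) =
      (LINT t|lborel. indicator (hcube c) t *\<^sub>R (\<psi> t * phase k t) - indicator (hcube c) t *\<^sub>R ((\<Sum>n. ?F n t) * phase k t))"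
      by (simp add: left_diff_distrib scaleR_diff_right)
    also have "\<dots> = 0"
      by (subst Bochner_Integration.integral_diff)
        (use 1 2 in \<open>auto intro!: integrable_on_hcube[OF _ hcube_subset_ccube sets_hcube] continuous_on_mult continuous_on_phase
          contF smooth_on_continuous[OF sm]\<close>)
    finally show ?thesis .
  qed
  from fourier_unique[OF contR this x] show ?thesis by simp
qed

section \<open>Plateau functions with controlled derivatives\<close>

text \<open>A single term of the exponential series is at most its sum.\<close>

lemma power_div_fact_le_exp:
  fixes y :: real
  assumes "y \<ge> 0"
  shows "y ^ k \<le> fact k * exp y"
proof -
  have "(\<Sum>n\<in>{k}. y ^ n /\<^sub>R fact n) \<le> (\<Sum>n. y ^ n /\<^sub>R fact n)"
    by (rule sum_le_suminf[OF summable_exp_generic]) (use assms in auto)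
  hence "y ^ k / fact k \<le> exp y" by (simp add: exp_def divide_inverse mult.commute)
  thus ?thesis by (simp add: divide_le_eq mult.commute)
qed

text \<open>The standard flat function \<open>exp (- 1 / t)\<close> with powers of
  \<open>1 / t\<close> attached: the derivative of a member is a combination of two members, and
  each member is bounded by a factorial.\<close>

definition flat :: "nat \<Rightarrow> real \<Rightarrow> real"
  where "flat k t = (if t \<le> 0 then 0 else (1 / t) ^ k * exp (- (1 / t)))"

lemma flat_nonneg: "flat k t \<ge> 0"
  unfolding flat_def by simp

lemma flat_le: "flat k t \<le> fact k"
proof (cases "t \<le> 0")
  case False
  have "(1 / t) ^ k * exp (- (1 / t)) \<le> (fact k * exp (1 / t)) * exp (- (1 / t))"
    using False by (intro mult_right_mono power_div_fact_le_exp) auto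
  also have "\<dots> = fact k" by (simp add: mult.assoc exp_minus)
  finally show ?thesis using False by (simp add: flat_def)
qed (simp add: flat_def)

lemma flat_shift: "t > 0 \<Longrightarrow> flat k t = t ^ m * flat (k + m) t"
  unfolding flat_def by (simp add: power_add field_simps)

lemma flat_has_derivative:
  "(flat k has_real_derivative (flat (k + 2) t - k * flat (k + 1) t)) (at t)"
proof -
  consider "t > 0" | "t < 0" | "t = 0" by linarith
  thus ?thesis
  proof cases
    case 1
    have "((\<lambda>t. (1 / t) ^ k * exp (- (1 / t))) has_real_derivative
        (real k * (- 1 / t\<^sup>2) * (1 / t) ^ (k - 1)) * exp (- (1 / t)) + (1 / t) ^ k * (exp (- (1 / t)) * (1 / t\<^sup>2))) (at t)"
    proof -
      have "((\<lambda>t. 1 / t) has_real_derivative - 1 / t\<^sup>2) (at t)"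
        using 1 by (auto intro!: derivative_eq_intros simp: power2_eq_square)
      from DERIV_power[OF this, of k] have d1: "((\<lambda>t. (1 / t) ^ k) has_real_derivative real k * (- 1 / t\<^sup>2) * (1 / t) ^ (k - 1)) (at t)"
        by (simp add: mult_ac)
      have d2: "((\<lambda>t. exp (- (1 / t))) has_real_derivative exp (- (1 / t)) * (1 / t\<^sup>2)) (at t)"
        using 1 by (auto intro!: derivative_eq_intros simp: power2_eq_square)
      from DERIV_mult[OF d1 d2] show ?thesis by (simp add: mult_ac)
    qed
    also have "(real k * (- 1 / t\<^sup>2) * (1 / t) ^ (k - 1)) * exp (- (1 / t)) + (1 / t) ^ k * (exp (- (1 / t)) * (1 / t\<^sup>2))
        = flat (k + 2) t - k * flat (k + 1) t"
      using 1 by (cases k) (simp_all add: flat_def power2_eq_square field_simps)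
    finally show ?thesis
      by (rule has_field_derivative_transform_within_open[where S = "{0<..}"]) (use 1 in \<open>auto simp: flat_def\<close>)
  next
    case 2
    have "((\<lambda>_. 0) has_real_derivative 0) (at t)" by simp
    hence "(flat k has_real_derivative 0) (at t)"
      by (rule has_field_derivative_transform_within_open[where S = "{..<0}"]) (use 2 in \<open>auto simp: flat_def\<close>)
    thus ?thesis using 2 by (simp add: flat_def)
  next
    case 3
    \<comment> \<open>At the origin, raising the index by 2 frees a factor \<open>h^2\<close> in
      front of a bounded function: one power cancels the denominator and the other tends to
      0.\<close>
    have "((\<lambda>h. flat k h / h) \<longlongrightarrow> 0) (at 0)"
    proof (rule Lim_null_comparison)
      show "((\<lambda>h::real. fact (k + 2) * \<bar>h\<bar>) \<longlongrightarrow> 0) (at 0)"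
        by (auto intro!: tendsto_eq_intros)
      have "norm (flat k h / h) \<le> fact (k + 2) * \<bar>h\<bar>" for h
      proof (cases "h > 0")
        case True
        have "flat k h = h\<^sup>2 * flat (k + 2) h" by (rule flat_shift[OF True])
        also have "\<dots> \<le> h\<^sup>2 * fact (k + 2)" by (intro mult_left_mono flat_le) simp
        finally show ?thesis using True flat_nonneg[of k h]
          by (simp add: divide_le_eq power2_eq_square mult_ac del: fact_Suc)
      next
        case False
        hence "norm (flat k h / h) = 0" by (simp add: flat_def)
        also have "0 \<le> fact (k + 2) * \<bar>h\<bar>" by (intro mult_nonneg_nonneg fact_ge_zero abs_ge_zero)
        finally show ?thesis .
      qed
      thus "eventually (\<lambda>h. norm (flat k h / h) \<le> fact (k + 2) * \<bar>h\<bar>) (at 0)"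
        by (intro always_eventually allI)
    qed
    hence "(flat k has_real_derivative 0) (at 0)"
      by (simp add: has_field_derivative_iff flat_def)
    thus ?thesis using 3 by (simp add: flat_def)
  qed
qed

text \<open>The derivatives of the bump \<open>t \<mapsto> exp (- 1 / t - 1 / (1 - t))\<close> on \<open>(0, 1)\<close>, generated together
  with those of its products with powers of \<open>1 / t\<close> and \<open>1 / (1 - t)\<close>.\<close>

fun bump :: "nat \<Rightarrow> nat \<Rightarrow> nat \<Rightarrow> real \<Rightarrow> real" where
  "bump 0 k l t = flat k t * flat l (1 - t)"
| "bump (Suc n) k l t = (bump n (k + 2) l t - k * bump n (k + 1) l t)
     - (bump n k (l + 2) t - l * bump n k (l + 1) t)"

lemma bump_has_derivative: "(bump n k l has_real_derivative bump (Suc n) k l t) (at t)"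
proof (induction n arbitrary: k l)
  case 0
  have "((\<lambda>t. flat l (1 - t)) has_real_derivative (flat (l + 2) (1 - t) - l * flat (l + 1) (1 - t)) * (- 1)) (at t)"
    by (rule DERIV_chain2[OF flat_has_derivative]) (auto intro!: derivative_eq_intros)
  from DERIV_mult[OF flat_has_derivative this]
  have "((\<lambda>t. flat k t * flat l (1 - t)) has_real_derivative bump (Suc 0) k l t) (at t)"
    by (rule back_subst[where P = "\<lambda>d. (_ has_real_derivative d) _"]) (simp add: algebra_simps)
  thus ?case by simp
next
  case (Suc n)
  have "((\<lambda>t. (bump n (k + 2) l t - k * bump n (k + 1) l t) - (bump n k (l + 2) t - l * bump n k (l + 1) t))
     has_real_derivative bump (Suc (Suc n)) k l t) (at t)"
    unfolding bump.simps(2)[of "Suc n"] by (intro DERIV_diff DERIV_cmult Suc.IH)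
  thus ?case by simp
qed

text \<open>A derivative gives four terms with coefficients 1, \<open>k\<close>, 1 and
  \<open>l\<close> in absolute value, of total \<open>k + l + 2\<close>, and raises the index sum by
  at most 2. The index sum therefore never exceeds \<open>k + l + 2 * n\<close>, which controls
  every coefficient and factorial that occurs.\<close>

lemma bump_bound: "\<bar>bump n k l t\<bar> \<le> real (k + l + 2 * n + 2) ^ n * fact (k + l + 2 * n)"
proof (induction n arbitrary: k l)
  case 0
  have "flat k t * flat l (1 - t) \<le> fact k * fact l"
    by (intro mult_mono flat_le flat_nonneg) simp
  also have "\<dots> \<le> (fact (k + l) :: real)"
  proof -
    have "(fact k * fact l :: nat) \<le> fact (k + l)" by (intro dvd_imp_le fact_fact_dvd_fact) simp
    hence "real (fact k * fact l) \<le> real (fact (k + l))" by (rule of_nat_mono)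
    thus ?thesis by simp
  qed
  finally show ?case by (simp add: flat_nonneg abs_mult)
next
  case (Suc n)
  define N where "N = k + l + 2 * Suc n"
  define B where "B = real (N + 2) ^ n * fact N"
  have B: "B \<ge> 0" unfolding B_def by simp
  have IH: "\<bar>bump n k' l' t\<bar> \<le> B" if "k' + l' + 2 * n \<le> N" for k' l'
  proof -
    have "\<bar>bump n k' l' t\<bar> \<le> real (k' + l' + 2 * n + 2) ^ n * fact (k' + l' + 2 * n)" by (rule Suc.IH)
    also have "\<dots> \<le> B" unfolding B_def using that by (intro mult_mono power_mono fact_mono) auto
    finally show ?thesis .
  qed
  have "\<bar>bump (Suc n) k l t\<bar> \<le> (\<bar>bump n (k + 2) l t\<bar> + k * \<bar>bump n (k + 1) l t\<bar>)
      + (\<bar>bump n k (l + 2) t\<bar> + l * \<bar>bump n k (l + 1) t\<bar>)"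
  proof -
    have "\<bar>(a - k * b) - (c - l * d)\<bar> \<le> (\<bar>a\<bar> + k * \<bar>b\<bar>) + (\<bar>c\<bar> + l * \<bar>d\<bar>)" for a b c d :: real
    proof -
      have "\<bar>k * b\<bar> = k * \<bar>b\<bar>" "\<bar>l * d\<bar> = l * \<bar>d\<bar>" by (simp_all add: abs_mult)
      thus ?thesis by linarith
    qed
    thus ?thesis by simp
  qed
  also have "\<dots> \<le> (B + k * B) + (B + l * B)"
    by (intro add_mono mult_left_mono IH) (auto simp: N_def)
  also have "\<dots> = real (k + l + 2) * B" by (simp add: algebra_simps)
  also have "\<dots> \<le> real (N + 2) * B" by (intro mult_right_mono B) (auto simp: N_def)
  also have "\<dots> = real (N + 2) ^ Suc n * fact N" unfolding B_def by simp
  finally show ?case unfolding N_def .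
qed

text \<open>The antiderivative \<open>G\<close> of the bump is a smooth step, constant to the left
  of 0 and to the right of 1. The normalized difference of \<open>G (s + 2)\<close> and
  \<open>G (s - 1)\<close> climbs on \<open>[- 2, - 1]\<close> and descends on
  \<open>[1, 2]\<close>. Its derivatives of order \<open>n \<ge> 1\<close> are differences of bump
  derivatives of order \<open>n - 1\<close>.\<close>

lemma plateau_1d:
  "\<exists>(b :: nat \<Rightarrow> real \<Rightarrow> real) C. (\<forall>n s. (b n has_real_derivative b (Suc n) s) (at s)) \<and>
    (\<forall>s. \<bar>s\<bar> \<le> 1 \<longrightarrow> b 0 s = 1) \<and> (\<forall>s. \<bar>s\<bar> \<ge> 2 \<longrightarrow> b 0 s = 0) \<and>
    C \<ge> 1 \<and> (\<forall>n s. \<bar>b n s\<bar> \<le> C ^ Suc n * real n ^ (3 * n))"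
proof -
  define \<rho> where "\<rho> n = bump n 0 0" for n
  have \<rho>': "(\<rho> n has_real_derivative \<rho> (Suc n) s) (at s)" for n s
    unfolding \<rho>_def by (rule bump_has_derivative)
  have shift: "((\<lambda>s. g (s + a)) has_real_derivative g' (s + a)) (at s)"
    if "\<And>x. (g has_real_derivative g' x) (at x)" for g g' :: "real \<Rightarrow> real" and a s
    using that[of "s + a"] by (simp add: DERIV_shift)
  have "\<exists>G. \<forall>x::real. - \<infinity> < ereal x \<longrightarrow> ereal x < \<infinity> \<longrightarrow> (G has_vector_derivative \<rho> 0 x) (at x)"
    by (rule einterval_antiderivative) (use DERIV_isCont[OF \<rho>'] in auto)
  then obtain G where G: "(G has_real_derivative \<rho> 0 x) (at x)" for x
    by (auto simp: has_real_derivative_iff_has_vector_derivative)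
  have nonneg: "\<rho> 0 x \<ge> 0" for x unfolding \<rho>_def by (simp add: flat_nonneg)
  have pos: "\<rho> 0 x > 0" if "0 < x" "x < 1" for x unfolding \<rho>_def using that by (simp add: flat_def)
  have zero: "\<rho> 0 x = 0" if "x \<le> 0 \<or> x \<ge> 1" for x unfolding \<rho>_def using that by (auto simp: flat_def)
  have mono: "G x \<le> G y" if "x \<le> y" for x y
    using that G nonneg by (intro DERIV_nonneg_imp_nondecreasing[of x y G]) blast+
  have contG: "continuous_on S G" for S
    using DERIV_isCont[OF G] by (auto intro: continuous_at_imp_continuous_on)
  have "G 0 < G 1"
    using pos G by (intro DERIV_pos_imp_increasing_open[of 0 1 G] contG) auto
  define c where "c = G 1 - G 0"
  have c: "c > 0" unfolding c_def using \<open>G 0 < G 1\<close> by simp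
  have G0: "G x = G 0" if "x \<le> 0" for x
  proof -
    have "\<exists>a. \<forall>x\<in>{..0}. G x = a"
      by (rule has_field_derivative_zero_constant)
        (use G zero has_field_derivative_at_within in \<open>metis atMost_iff convex_real_interval(2)\<close>)+
    thus ?thesis using that by auto
  qed
  have G1: "G x = G 1" if "x \<ge> 1" for x
  proof -
    have "\<exists>a. \<forall>x\<in>{1..}. G x = a"
      by (rule has_field_derivative_zero_constant)
        (use G zero has_field_derivative_at_within in \<open>metis atLeast_iff convex_real_interval(1)\<close>)+
    thus ?thesis using that by auto
  qed
  have Gbd: "G 0 \<le> G x" "G x \<le> G 1" for x
    using mono[of 0 x] G0[of x] mono[of x 1] G1[of x] by (metis linear order_refl)+
  define b where "b n s = (case n of 0 \<Rightarrow> (G (s + 2) - G (s - 1)) / c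
    | Suc m \<Rightarrow> (\<rho> m (s + 2) - \<rho> m (s - 1)) / c)" for n s
  \<comment> \<open>The 8 comes from \<open>(2 * n) ^ (3 * n) = 8 ^ n * n ^ (3 * n)\<close>, and
    \<open>2 / c\<close> from the two terms of the normalized difference.\<close>
  define C where "C = max 8 (2 / c)"
  show ?thesis
  proof (rule exI[of _ b], rule exI[of _ C], intro conjI allI impI)
    show "(b n has_real_derivative b (Suc n) s) (at s)" for n s
    proof (cases n)
      case 0
      have "((\<lambda>s. (G (s + 2) - G (s - 1)) / c) has_real_derivative (\<rho> 0 (s + 2) - \<rho> 0 (s - 1)) / c) (at s)"
        by (intro DERIV_cdivide DERIV_diff shift[OF G] shift[OF G, of "- 1", simplified])
      thus ?thesis unfolding b_def 0 by simp
    next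
      case (Suc m)
      have "((\<lambda>s. (\<rho> m (s + 2) - \<rho> m (s - 1)) / c) has_real_derivative (\<rho> (Suc m) (s + 2) - \<rho> (Suc m) (s - 1)) / c) (at s)"
        by (intro DERIV_cdivide DERIV_diff shift[OF \<rho>'] shift[OF \<rho>', of m "- 1", simplified])
      thus ?thesis unfolding b_def Suc by simp
    qed
    show "b 0 s = 1" if "\<bar>s\<bar> \<le> 1" for s
      unfolding b_def using that G1[of "s + 2"] G0[of "s - 1"] c by (simp add: c_def)
    show "b 0 s = 0" if "\<bar>s\<bar> \<ge> 2" for s
    proof (cases "s \<ge> 2")
      case True
      thus ?thesis unfolding b_def using G1[of "s + 2"] G1[of "s - 1"] by simp
    next
      case False
      hence "s \<le> - 2" using that by linarith
      thus ?thesis unfolding b_def using G0[of "s + 2"] G0[of "s - 1"] by simp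
    qed
    show C1: "C \<ge> 1" unfolding C_def by simp
    show "\<bar>b n s\<bar> \<le> C ^ Suc n * real n ^ (3 * n)" for n s
    proof (cases n)
      case 0
      have "\<bar>G (s + 2) - G (s - 1)\<bar> \<le> c"
        using Gbd[of "s + 2"] Gbd[of "s - 1"] unfolding c_def by linarith
      hence "\<bar>b n s\<bar> \<le> 1" unfolding b_def 0 using c by simp
      thus ?thesis using C1 unfolding 0 by simp
    next
      case (Suc m)
      have \<rho>bd: "\<bar>\<rho> m x\<bar> \<le> 8 ^ n * real n ^ (3 * n)" for x
      proof -
        have "\<bar>\<rho> m x\<bar> \<le> real (2 * m + 2) ^ m * fact (2 * m)"
          unfolding \<rho>_def using bump_bound[of m 0 0 x] by simp
        also have "\<dots> \<le> real (2 * n) ^ n * real (2 * n) ^ (2 * n)"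
        proof (intro mult_mono)
          have "real (2 * m + 2) ^ m = real (2 * n) ^ m" using Suc by simp
          also have "\<dots> \<le> real (2 * n) ^ n" using Suc by (intro power_increasing) auto
          finally show "real (2 * m + 2) ^ m \<le> real (2 * n) ^ n" .
          have "(fact (2 * m) :: real) \<le> fact (2 * n)" using Suc by (intro fact_mono) auto
          also have "(fact (2 * n) :: real) \<le> of_nat ((2 * n) ^ (2 * n))" by (rule fact_le_power)
          also have "\<dots> = real (2 * n) ^ (2 * n)" by simp
          finally show "(fact (2 * m) :: real) \<le> real (2 * n) ^ (2 * n)" .
        qed auto
        also have "\<dots> = (real (2 * n) ^ 3) ^ n" by (simp only: power_add[symmetric] power_mult[symmetric]) (simp add: algebra_simps)
        also have "\<dots> = 8 ^ n * real n ^ (3 * n)" by (simp add: power_mult_distrib power_mult)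
        finally show ?thesis .
      qed
      have "\<bar>b n s\<bar> \<le> (\<bar>\<rho> m (s + 2)\<bar> + \<bar>\<rho> m (s - 1)\<bar>) / c"
        unfolding b_def Suc using c by (simp add: divide_right_mono)
      also have "\<dots> \<le> (8 ^ n * real n ^ (3 * n) + 8 ^ n * real n ^ (3 * n)) / c"
        using c by (intro divide_right_mono add_mono \<rho>bd) simp
      also have "\<dots> = (2 / c) * 8 ^ n * real n ^ (3 * n)" by simp
      also have "\<dots> \<le> C * C ^ n * real n ^ (3 * n)"
        using c by (intro mult_right_mono mult_mono power_mono) (auto simp: C_def)
      finally show ?thesis by simp
    qed
  qed
qed

text \<open>A product of functions of one coordinate each: a partial derivative only raises the
  order of one factor. The derivative along a list is thus again such a product, with orders given
  by \<open>count_list\<close>, and is estimated factor by factor without the Leibniz rule.\<close>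

lemma plateau:
  fixes r :: real
  assumes r: "r > 0"
  shows "\<exists>(\<phi> :: real ^ 'n::finite \<Rightarrow> complex) A C. smooth_on UNIV \<phi> \<and>
    (\<forall>x. (\<forall>j. \<bar>x $ j\<bar> \<le> r) \<longrightarrow> \<phi> x = 1) \<and> supp \<phi> \<subseteq> {x. \<forall>j. \<bar>x $ j\<bar> \<le> 2 * r} \<and> A > 0 \<and> C > 0 \<and>
    (\<forall>l x. cmod (partials l \<phi> x) \<le> A * (C ^ length l * real (length l) ^ (3 * length l)))"
proof -
  obtain b C where b': "\<And>n s. (b n has_real_derivative b (Suc n) s) (at s)"
    and b1: "\<And>s. \<bar>s\<bar> \<le> 1 \<Longrightarrow> b 0 s = 1" and b0: "\<And>s. \<bar>s\<bar> \<ge> 2 \<Longrightarrow> b 0 s = 0"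
    and C: "C \<ge> 1" and bd: "\<And>n s. \<bar>b n s\<bar> \<le> C ^ Suc n * real n ^ (3 * n)"
    using plateau_1d by blast
  define f where "f n s = (1 / r) ^ n * b n (s / r)" for n s
  have f': "(f n has_real_derivative f (Suc n) s) (at s)" for n s
  proof -
    have "((\<lambda>s. b n (s / r)) has_real_derivative b (Suc n) (s / r) * (1 / r)) (at s)"
      by (rule DERIV_chain2[OF b']) (use r in \<open>auto intro!: derivative_eq_intros\<close>)
    from DERIV_cmult[OF this, of "(1 / r) ^ n"] show ?thesis
      unfolding f_def by (simp add: mult_ac)
  qed
  define \<Phi> :: "('n \<Rightarrow> nat) \<Rightarrow> real ^ 'n \<Rightarrow> complex"
    where "\<Phi> \<beta> x = complex_of_real (\<Prod>j\<in>UNIV. f (\<beta> j) (x $ j))" for \<beta> x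
  have deriv: "(\<Phi> \<beta> has_derivative (\<lambda>h. complex_of_real (\<Sum>i\<in>UNIV. f (Suc (\<beta> i)) (x $ i) * h $ i * (\<Prod>j\<in>UNIV - {i}. f (\<beta> j) (x $ j))))) (at x)" for \<beta> x
  proof -
    have "((\<lambda>x. f (\<beta> j) (x $ j)) has_derivative (\<lambda>h. f (Suc (\<beta> j)) (x $ j) * h $ j)) (at x)" for j
      by (rule has_derivative_compose[OF bounded_linear_imp_has_derivative[OF bounded_linear_vec_nth]
            f'[unfolded has_field_derivative_def]])
    hence "((\<lambda>x. \<Prod>j\<in>UNIV. f (\<beta> j) (x $ j)) has_derivative
        (\<lambda>h. \<Sum>i\<in>UNIV. f (Suc (\<beta> i)) (x $ i) * h $ i * (\<Prod>j\<in>UNIV - {i}. f (\<beta> j) (x $ j)))) (at x)"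
      by (intro has_derivative_prod)
    thus ?thesis unfolding \<Phi>_def by (rule bounded_linear.has_derivative[OF bounded_linear_of_real])
  qed
  have partial: "partial i (\<Phi> \<beta>) = \<Phi> (\<beta>(i := Suc (\<beta> i)))" for i \<beta>
  proof
    fix x
    have "(\<Sum>k\<in>UNIV. f (Suc (\<beta> k)) (x $ k) * axis i 1 $ k * (\<Prod>j\<in>UNIV - {k}. f (\<beta> j) (x $ j)))
        = (\<Sum>k\<in>UNIV. if k = i then f (Suc (\<beta> i)) (x $ i) * (\<Prod>j\<in>UNIV - {i}. f (\<beta> j) (x $ j)) else 0)"
      by (intro sum.cong refl) (simp add: axis_def)
    also have "\<dots> = f (Suc (\<beta> i)) (x $ i) * (\<Prod>j\<in>UNIV - {i}. f (\<beta> j) (x $ j))" by simp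
    also have "(\<Prod>j\<in>UNIV - {i}. f (\<beta> j) (x $ j)) = (\<Prod>j\<in>UNIV - {i}. f ((\<beta>(i := Suc (\<beta> i))) j) (x $ j))"
      by (intro prod.cong refl) simp
    also have "f (Suc (\<beta> i)) (x $ i) * \<dots> = (\<Prod>j\<in>UNIV. f ((\<beta>(i := Suc (\<beta> i))) j) (x $ j))"
      by (subst prod.remove[of UNIV i]) auto
    finally show "partial i (\<Phi> \<beta>) x = \<Phi> (\<beta>(i := Suc (\<beta> i))) x"
      unfolding partial_eqI[OF deriv] \<Phi>_def by simp
  qed
  have smooth: "smooth_on UNIV (\<Phi> \<beta>)" for \<beta>
  proof (rule smooth_on_coinduct[of "\<lambda>g. \<exists>\<beta>. g = \<Phi> \<beta>"])
    show "g differentiable (at x)" if "\<exists>\<beta>. g = \<Phi> \<beta>" for g x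
      using that deriv unfolding differentiable_def by blast
    show "\<exists>\<beta>. partial i g = \<Phi> \<beta>" if "\<exists>\<beta>. g = \<Phi> \<beta>" for g i
      using that partial by blast
  qed blast
  have partials: "partials l (\<Phi> (\<lambda>_. 0)) = \<Phi> (count_list l)" for l
  proof (induction l)
    case (Cons i l)
    have "(count_list l)(i := Suc (count_list l i)) = count_list (i # l)" by auto
    thus ?case by (simp only: foldr_Cons o_apply Cons.IH partial)
  qed (simp add: fun_eq_iff count_list.simps(1)[abs_def])
  define P where "P = \<Phi> (\<lambda>_. 0)"
  show ?thesis
  proof (rule exI[of _ P], rule exI[of _ "C ^ CARD('n)"], rule exI[of _ "C / r"], intro conjI allI impI)
    show "smooth_on UNIV P" unfolding P_def by (rule smooth)
    show "P x = 1" if "\<forall>j. \<bar>x $ j\<bar> \<le> r" for x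
      unfolding P_def \<Phi>_def f_def using that b1 r by simp
    show "supp P \<subseteq> {x. \<forall>j. \<bar>x $ j\<bar> \<le> 2 * r}"
    proof (rule supp_minimal)
      have "{x :: real ^ 'n. \<forall>j. \<bar>x $ j\<bar> \<le> 2 * r} = cbox (- vec (2 * r)) (vec (2 * r))"
        by (auto simp: mem_box_cart abs_le_iff) (metis minus_le_iff)+
      thus "closed {x :: real ^ 'n. \<forall>j. \<bar>x $ j\<bar> \<le> 2 * r}" by (simp add: closed_cbox)
      fix x :: "real ^ 'n" assume "x \<notin> {x. \<forall>j. \<bar>x $ j\<bar> \<le> 2 * r}"
      then obtain j where "\<bar>x $ j\<bar> > 2 * r" by (auto simp: not_le)
      hence "\<bar>x $ j / r\<bar> \<ge> 2" using r by (simp add: field_simps)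
      hence "f 0 (x $ j) = 0" unfolding f_def using b0 by simp
      thus "P x = 0" unfolding P_def \<Phi>_def by auto
    qed
    show "C ^ CARD('n) > 0" "C / r > 0" using C r by simp_all
    fix l :: "'n list" and x :: "real ^ 'n"
    define p where "p = length l"
    define \<beta> where "\<beta> = count_list l"
    have sum\<beta>: "(\<Sum>j\<in>UNIV. \<beta> j) = p" unfolding p_def \<beta>_def by (rule sum_count_set) auto
    have le: "\<beta> j \<le> p" for j using member_le_sum[of j UNIV \<beta>] sum\<beta> by simp
    have "cmod (partials l P x) = (\<Prod>j\<in>UNIV. \<bar>f (\<beta> j) (x $ j)\<bar>)"
      unfolding P_def partials \<beta>_def[symmetric] \<Phi>_def norm_of_real by (rule abs_prod)
    also have "\<dots> \<le> (\<Prod>j\<in>UNIV. C * (C / r) ^ \<beta> j * (real p ^ 3) ^ \<beta> j)"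
    proof (intro prod_mono conjI abs_ge_zero)
      fix j
      have "\<bar>f (\<beta> j) (x $ j)\<bar> = (1 / r) ^ \<beta> j * \<bar>b (\<beta> j) (x $ j / r)\<bar>"
        unfolding f_def abs_mult using r by simp
      also have "\<dots> \<le> (1 / r) ^ \<beta> j * (C ^ Suc (\<beta> j) * real (\<beta> j) ^ (3 * \<beta> j))"
        using r by (intro mult_left_mono bd) simp
      \<comment> \<open>The base \<open>p\<close> is common to all coordinates, so that in the
        product the exponents add up to \<open>p\<close>.\<close>
      also have "\<dots> \<le> (1 / r) ^ \<beta> j * (C ^ Suc (\<beta> j) * real p ^ (3 * \<beta> j))"
        using r C le[of j] by (intro mult_left_mono power_mono) auto
      also have "\<dots> = C * (C / r) ^ \<beta> j * (real p ^ 3) ^ \<beta> j"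
        by (simp add: power_divide power_mult)
      finally show "\<bar>f (\<beta> j) (x $ j)\<bar> \<le> C * (C / r) ^ \<beta> j * (real p ^ 3) ^ \<beta> j" .
    qed
    also have "\<dots> = C ^ CARD('n) * ((C / r) ^ p * real p ^ (3 * p))"
      by (simp only: prod.distrib prod_constant power_sum[symmetric] sum\<beta> power_mult mult.assoc)
    finally show "cmod (partials l P x) \<le> C ^ CARD('n) * ((C / r) ^ length l * real (length l) ^ (3 * length l))"
      unfolding p_def .
  qed
qed

section \<open>The weight sequence and the associated function\<close>

text \<open>Divide by \<open>x + y\<close>: a number \<open>z\<close> in \<open>[0, 1]\<close>
  satisfies \<open>z powr s \<le> z\<close>, and the two fractions add up to 1.\<close>

lemma powr_superadd:
  fixes x y s :: real
  assumes "x \<ge> 0" "y \<ge> 0" "s \<ge> 1"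
  shows "x powr s + y powr s \<le> (x + y) powr s"
proof (cases "x + y = 0")
  case False
  hence pos: "x + y > 0" using assms by simp
  have *: "z powr s \<le> z / (x + y) * (x + y) powr s" if "0 \<le> z" "z \<le> x + y" for z
  proof -
    have "(z / (x + y)) powr s \<le> (z / (x + y)) powr 1"
      using that pos assms(3) by (intro powr_mono') (auto simp: divide_simps)
    also have "\<dots> = z / (x + y)" using that pos by simp
    finally have "(z / (x + y)) powr s \<le> z / (x + y)" .
    moreover have "z powr s = (z / (x + y)) powr s * (x + y) powr s"
      using that pos by (simp add: powr_divide)
    ultimately show ?thesis using mult_right_mono powr_ge_zero by metis
  qed
  have "x powr s + y powr s \<le> x / (x + y) * (x + y) powr s + y / (x + y) * (x + y) powr s"
    by (intro add_mono *) (use assms in auto)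
  also have "\<dots> = (x + y) powr s" using pos by (simp flip: distrib_right add_divide_distrib)
  finally show ?thesis .
next
  case True
  hence "x = 0" "y = 0" using assms by linarith+
  thus ?thesis by simp
qed

lemma powr_subadd:
  fixes x y s :: real
  assumes "x \<ge> 0" "y \<ge> 0" "s \<ge> 0"
  shows "(x + y) powr s \<le> 2 powr s * (x powr s + y powr s)"
proof -
  have "(x + y) powr s \<le> (2 * max x y) powr s" using assms by (intro powr_mono2) auto
  also have "\<dots> = 2 powr s * max x y powr s" using assms by (simp add: powr_mult)
  also have "\<dots> \<le> 2 powr s * (x powr s + y powr s)"
    by (intro mult_left_mono) (auto simp: max_def)
  finally show ?thesis .
qed

section \<open>Growth of the weight sequence\<close>

lemma M_seq_pos: "M_seq \<tau> \<sigma> p > 0"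
  unfolding M_seq_def by simp

lemma M_seq_exp: "p > 0 \<Longrightarrow> M_seq \<tau> \<sigma> p = exp (\<tau> * real p powr \<sigma> * ln p)"
  unfolding M_seq_def by (simp add: powr_def)

text \<open>In logarithms, enlarge \<open>ln j\<close> and \<open>ln k\<close> to
  \<open>ln (j + k)\<close> and use superadditivity of the powers.\<close>

lemma M_seq_mult_le:
  assumes "\<tau> > 0" "\<sigma> > 1"
  shows "M_seq \<tau> \<sigma> j * M_seq \<tau> \<sigma> k \<le> M_seq \<tau> \<sigma> (j + k)"
proof (cases "j = 0 \<or> k = 0")
  case False
  hence jk: "j > 0" "k > 0" by auto
  have "\<tau> * real j powr \<sigma> * ln j + \<tau> * real k powr \<sigma> * ln k
      \<le> \<tau> * real j powr \<sigma> * ln (j + k) + \<tau> * real k powr \<sigma> * ln (j + k)"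
    using assms jk by (intro add_mono mult_left_mono) auto
  also have "\<dots> = \<tau> * ln (j + k) * (real j powr \<sigma> + real k powr \<sigma>)"
    by (simp add: algebra_simps)
  also have "\<dots> \<le> \<tau> * ln (j + k) * (real j + real k) powr \<sigma>"
    using assms jk by (intro mult_left_mono powr_superadd) auto
  finally show ?thesis using jk
    by (simp add: M_seq_exp exp_add[symmetric] mult_ac)
qed (auto simp: M_seq_def)

text \<open>Reduces the bounds for all \<open>p\<close> below to asymptotic comparisons of
  logarithms; the constant absorbs the finitely many exceptions.\<close>

lemma eventually_le_imp_bounded:
  fixes f g :: "nat \<Rightarrow> real"
  assumes "eventually (\<lambda>p. f p \<le> g p) sequentially" "\<And>p. g p > 0"
  shows "\<exists>A>0. \<forall>p. f p \<le> A * g p"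
proof -
  obtain N where N: "\<And>p. p \<ge> N \<Longrightarrow> f p \<le> g p"
    using assms(1) by (auto simp: eventually_sequentially)
  define A where "A = 1 + (\<Sum>p<N. \<bar>f p / g p\<bar>)"
  have A1: "A \<ge> 1" unfolding A_def by (simp add: sum_nonneg)
  have "f p \<le> A * g p" for p
  proof (cases "p < N")
    case True
    have "f p / g p \<le> \<bar>f p / g p\<bar>" by (rule abs_ge_self)
    also have "\<dots> \<le> (\<Sum>p<N. \<bar>f p / g p\<bar>)"
      using True by (intro member_le_sum) auto
    finally have "f p / g p \<le> A" unfolding A_def by simp
    thus ?thesis using assms(2)[of p] by (simp add: pos_divide_le_eq)
  next
    case False
    have "f p \<le> 1 * g p" using N[of p] False by simp
    also have "\<dots> \<le> A * g p" using A1 assms(2)[of p] by (intro mult_right_mono) auto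
    finally show ?thesis .
  qed
  thus ?thesis using A1 by (intro exI[of _ A]) auto
qed

text \<open>After taking logarithms, \<open>\<tau> * p powr \<sigma> * ln p\<close> outgrows both
  \<open>p * ln p\<close> and \<open>p powr \<sigma> * \<bar>ln h\<bar>\<close>, so \<open>h\<close>
  may be arbitrarily small. This places the plateau function in the Beurling class and, with
  \<open>s = 0\<close>, makes the supremum in \<open>assoc_fun\<close> finite.\<close>

lemma power_le_M_seq:
  assumes "\<tau> > 0" "\<sigma> > 1" "h > 0" "C > 0"
  shows "\<exists>A>0. \<forall>p. C ^ p * real p ^ (s * p) \<le> A * (h powr (real p powr \<sigma>) * M_seq \<tau> \<sigma> p)"
proof (rule eventually_le_imp_bounded)
  have "eventually (\<lambda>p::nat. real p * ln C + real s * real p * ln (real p) \<le>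
      real p powr \<sigma> * ln h + \<tau> * real p powr \<sigma> * ln (real p)) sequentially"
    using assms by real_asymp
  thus "eventually (\<lambda>p. C ^ p * real p ^ (s * p) \<le> h powr (real p powr \<sigma>) * M_seq \<tau> \<sigma> p) sequentially"
    using eventually_gt_at_top[of 0]
  proof eventually_elim
    case (elim p)
    have "C ^ p * real p ^ (s * p) = exp (real p * ln C + real s * real p * ln (real p))"
      using assms elim(2) by (simp add: exp_add exp_of_nat_mult mult.assoc flip: of_nat_mult)
    also have "\<dots> \<le> exp (real p powr \<sigma> * ln h + \<tau> * real p powr \<sigma> * ln (real p))"
      using elim(1) by simp
    also have "\<dots> = h powr (real p powr \<sigma>) * M_seq \<tau> \<sigma> p"
      using assms elim(2) by (simp add: M_seq_exp exp_add powr_def)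
    finally show ?case .
  qed
qed (use assms M_seq_pos in auto)

text \<open>Geometric factors cost a doubling of \<open>h\<close>: this is the origin of the 2 in
  front of \<open>prod_scale\<close> below.\<close>

lemma power_le_powr_powr:
  assumes "\<sigma> > 1"
  shows "\<exists>A>0. \<forall>p. c ^ p \<le> A * 2 powr (real p powr \<sigma>)"
proof (rule eventually_le_imp_bounded)
  have "eventually (\<lambda>p::nat. real p * ln (\<bar>c\<bar> + 1) \<le> real p powr \<sigma> * ln 2) sequentially"
    using assms by real_asymp
  thus "eventually (\<lambda>p. c ^ p \<le> 2 powr (real p powr \<sigma>)) sequentially"
  proof eventually_elim
    case (elim p)
    have "c ^ p \<le> \<bar>c\<bar> ^ p" by (metis abs_ge_self power_abs)
    also have "\<dots> \<le> (\<bar>c\<bar> + 1) ^ p" by (intro power_mono) auto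
    also have "\<dots> = exp (real p * ln (\<bar>c\<bar> + 1))" by (simp add: exp_of_nat_mult)
    also have "\<dots> \<le> exp (real p powr \<sigma> * ln 2)" using elim by simp
    finally show ?case by (simp add: powr_def)
  qed
qed auto

text \<open>The shift raises \<open>\<tau> * p powr \<sigma> * ln p\<close> by a term of order
  \<open>p powr (\<sigma> - 1) * ln p\<close>, which is small compared with
  \<open>p powr \<sigma>\<close>. Hence it costs a doubling of \<open>h\<close> as well, even
  together with a geometric factor.\<close>

lemma M_seq_shift:
  assumes "\<tau> > 0" "\<sigma> > 1"
  shows "\<exists>A>0. \<forall>p. c ^ p * M_seq \<tau> \<sigma> (p + m) \<le> A * (2 powr (real p powr \<sigma>) * M_seq \<tau> \<sigma> p)"
proof (rule eventually_le_imp_bounded)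
  have "eventually (\<lambda>p::nat. real p * ln (\<bar>c\<bar> + 1) + \<tau> * (real p + real m) powr \<sigma> * ln (real p + real m)
      \<le> real p powr \<sigma> * ln 2 + \<tau> * real p powr \<sigma> * ln (real p)) sequentially"
    using assms by real_asymp
  thus "eventually (\<lambda>p. c ^ p * M_seq \<tau> \<sigma> (p + m) \<le> 2 powr (real p powr \<sigma>) * M_seq \<tau> \<sigma> p) sequentially"
    using eventually_gt_at_top[of 0]
  proof eventually_elim
    case (elim p)
    have "c ^ p \<le> \<bar>c\<bar> ^ p" by (metis abs_ge_self power_abs)
    also have "\<dots> \<le> (\<bar>c\<bar> + 1) ^ p" by (intro power_mono) auto
    also have "\<dots> = exp (real p * ln (\<bar>c\<bar> + 1))" by (simp add: exp_of_nat_mult)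
    finally have "c ^ p * M_seq \<tau> \<sigma> (p + m) \<le> exp (real p * ln (\<bar>c\<bar> + 1)) * M_seq \<tau> \<sigma> (p + m)"
      using M_seq_pos[of \<tau> \<sigma> "p + m"] by (intro mult_right_mono) auto
    also have "\<dots> = exp (real p * ln (\<bar>c\<bar> + 1) + \<tau> * (real p + real m) powr \<sigma> * ln (real p + real m))"
      using elim(2) by (simp add: M_seq_exp exp_add)
    also have "\<dots> \<le> exp (real p powr \<sigma> * ln 2 + \<tau> * real p powr \<sigma> * ln (real p))"
      using elim(1) by simp
    also have "\<dots> = 2 powr (real p powr \<sigma>) * M_seq \<tau> \<sigma> p"
      using elim(2) by (simp add: M_seq_exp exp_add powr_def)
    finally show ?case .
  qed
qed (use M_seq_pos in auto)

text \<open>The content is that the supremum is over a bounded set: \<open>power_le_M_seq\<close>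
  with parameter \<open>1 / h\<close> bounds all its terms at once.\<close>

lemma assoc_term_le:
  assumes "\<tau> > 0" "\<sigma> > 1" "h > 0" "k > 0"
  shows "ln_plus (h powr (real p powr \<sigma>) * k ^ p / M_seq \<tau> \<sigma> p) \<le> assoc_fun \<tau> \<sigma> h k"
proof -
  obtain A where A: "A > 0" "\<And>p. k ^ p \<le> A * ((1 / h) powr (real p powr \<sigma>) * M_seq \<tau> \<sigma> p)"
    using power_le_M_seq[OF assms(1,2), of "1 / h" k 0] assms(3,4) by auto
  have "ln_plus (h powr (real p powr \<sigma>) * k ^ p / M_seq \<tau> \<sigma> p) \<le> max 0 (ln A)" for p
  proof -
    have "h powr (real p powr \<sigma>) * k ^ p / M_seq \<tau> \<sigma> p \<le>
        h powr (real p powr \<sigma>) * (A * ((1 / h) powr (real p powr \<sigma>) * M_seq \<tau> \<sigma> p)) / M_seq \<tau> \<sigma> p"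
      using A(2)[of p] M_seq_pos[of \<tau> \<sigma> p] by (intro divide_right_mono mult_left_mono) auto
    also have "\<dots> = A" using M_seq_pos[of \<tau> \<sigma> p] assms(3) by (simp add: powr_divide)
    finally have "ln (h powr (real p powr \<sigma>) * k ^ p / M_seq \<tau> \<sigma> p) \<le> ln A"
      using M_seq_pos[of \<tau> \<sigma> p] assms(3,4) by (intro ln_mono) auto
    thus ?thesis unfolding ln_plus_def by auto
  qed
  thus ?thesis unfolding assoc_fun_def by (intro cSUP_upper bdd_aboveI2) auto
qed

text \<open>One half of the exchange between exponential decay and the family of power bounds with
  parameter \<open>1 / h\<close>; \<open>le_exp_assoc_fun\<close> is the other half.\<close>

lemma exp_assoc_fun_le:
  assumes "\<tau> > 0" "\<sigma> > 1" "h > 0" "k > 0"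
  shows "k ^ p * exp (- assoc_fun \<tau> \<sigma> h k) \<le> (1 / h) powr (real p powr \<sigma>) * M_seq \<tau> \<sigma> p"
proof -
  define Q where "Q = h powr (real p powr \<sigma>) * k ^ p / M_seq \<tau> \<sigma> p"
  have Q: "Q > 0" unfolding Q_def using assms M_seq_pos[of \<tau> \<sigma> p] by simp
  have "ln Q \<le> assoc_fun \<tau> \<sigma> h k"
    using assoc_term_le[OF assms, of p] unfolding ln_plus_def Q_def by simp
  hence "exp (- assoc_fun \<tau> \<sigma> h k) \<le> exp (- ln Q)" by simp
  also have "\<dots> = 1 / Q" using Q by (simp add: exp_minus field_simps)
  finally have "k ^ p * exp (- assoc_fun \<tau> \<sigma> h k) \<le> k ^ p * (1 / Q)"
    using assms by (intro mult_left_mono) auto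
  also have "\<dots> = (1 / h) powr (real p powr \<sigma>) * M_seq \<tau> \<sigma> p"
    unfolding Q_def using assms by (simp add: powr_divide)
  finally show ?thesis .
qed

lemma le_exp_assoc_fun:
  assumes "h > 0" "k > 0" "A > 0" "V \<ge> 0"
    and bound: "\<And>p. k ^ p * V \<le> A * ((1 / h) powr (real p powr \<sigma>) * M_seq \<tau> \<sigma> p)"
    and "\<sigma> > 1"
  shows "V \<le> A * exp (- assoc_fun \<tau> \<sigma> h k)"
proof (cases "V = 0")
  case False
  hence V: "V > 0" using assms by simp
  \<comment> \<open>The order \<open>p = 0\<close> gives \<open>ln (A / V) \<ge> 0\<close>, which
    takes care of the cut-off at 0 in \<open>ln_plus\<close>.\<close>
  have VA: "V \<le> A" using bound[of 0] assms by (simp add: M_seq_def)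
  have "ln_plus (h powr (real p powr \<sigma>) * k ^ p / M_seq \<tau> \<sigma> p) \<le> ln (A / V)" for p
  proof -
    have "h powr (real p powr \<sigma>) * (k ^ p * V) \<le>
        h powr (real p powr \<sigma>) * (A * ((1 / h) powr (real p powr \<sigma>) * M_seq \<tau> \<sigma> p))"
      using bound[of p] by (intro mult_left_mono) auto
    also have "\<dots> = A * M_seq \<tau> \<sigma> p" using assms(1) by (simp add: powr_divide)
    finally have "h powr (real p powr \<sigma>) * k ^ p / M_seq \<tau> \<sigma> p \<le> A / V"
      using V M_seq_pos[of \<tau> \<sigma> p] by (simp add: field_simps)
    hence "ln (h powr (real p powr \<sigma>) * k ^ p / M_seq \<tau> \<sigma> p) \<le> ln (A / V)"
      using M_seq_pos[of \<tau> \<sigma> p] assms(1,2) by (intro ln_mono) auto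
    moreover have "ln (A / V) \<ge> 0" using V VA by simp
    ultimately show ?thesis unfolding ln_plus_def by simp
  qed
  hence "assoc_fun \<tau> \<sigma> h k \<le> ln (A / V)"
    unfolding assoc_fun_def by (intro cSUP_least) auto
  hence "exp (- ln (A / V)) \<le> exp (- assoc_fun \<tau> \<sigma> h k)" by simp
  moreover have "exp (- ln (A / V)) = V / A" using V assms(3) by (simp add: exp_minus)
  ultimately show ?thesis using assms(3) by (simp add: field_simps)
qed (use assms in auto)

section \<open>Decay of the short-time Fourier transform\<close>

lemma E_h_bound:
  assumes "f \<in> E_h \<tau> \<sigma> h K" "h > 0"
  shows "\<exists>A>0. \<forall>\<alpha>. \<forall>x\<in>K. cmod (mderiv \<alpha> f x) \<le> A * (h powr (real (mlength \<alpha>) powr \<sigma>) * M_seq \<tau> \<sigma> (mlength \<alpha>))"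
proof -
  let ?D = "\<lambda>\<alpha>. h powr (real (mlength \<alpha>) powr \<sigma>) * M_seq \<tau> \<sigma> (mlength \<alpha>)"
  have D: "?D \<alpha> > 0" for \<alpha> :: "'a \<Rightarrow> nat" using assms(2) M_seq_pos by simp
  obtain B where B: "\<And>\<alpha> x. x \<in> K \<Longrightarrow> cmod (mderiv \<alpha> f x) / ?D \<alpha> \<le> B"
    using assms(1) unfolding E_h_def bdd_above_def by blast
  have "cmod (mderiv \<alpha> f x) \<le> (\<bar>B\<bar> + 1) * ?D \<alpha>" if "x \<in> K" for \<alpha> x
  proof -
    have "cmod (mderiv \<alpha> f x) / ?D \<alpha> \<le> \<bar>B\<bar> + 1" using B[OF that, of \<alpha>] by linarith
    thus ?thesis using D[of \<alpha>] by (simp add: pos_divide_le_eq)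
  qed
  moreover have "\<bar>B\<bar> + 1 > 0" by linarith
  ultimately show ?thesis by blast
qed

text \<open>Enlarging the parameter to \<open>h0\<close> lets the function and the window share one
  parameter in the Leibniz estimate.\<close>

lemma E_h_bound_mono:
  assumes "f \<in> E_h \<tau> \<sigma> h K" "0 < h" "h \<le> h0"
  shows "\<exists>A>0. \<forall>i j. \<forall>x\<in>K. cmod ((partial i ^^ j) f x) \<le> A * (h0 powr (real j powr \<sigma>) * M_seq \<tau> \<sigma> j)"
proof -
  obtain A where A: "A > 0"
    "\<And>\<alpha> x. x \<in> K \<Longrightarrow> cmod (mderiv \<alpha> f x) \<le> A * (h powr (real (mlength \<alpha>) powr \<sigma>) * M_seq \<tau> \<sigma> (mlength \<alpha>))"
    using E_h_bound[OF assms(1,2)] by blast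
  have "cmod ((partial i ^^ j) f x) \<le> A * (h0 powr (real j powr \<sigma>) * M_seq \<tau> \<sigma> j)" if "x \<in> K" for i j x
  proof -
    have "cmod ((partial i ^^ j) f x) \<le> A * (h powr (real j powr \<sigma>) * M_seq \<tau> \<sigma> j)"
      using A(2)[OF that, of "\<lambda>k. if k = i then j else 0"] by (simp only: mderiv_single mlength_single)
    also have "\<dots> \<le> A * (h0 powr (real j powr \<sigma>) * M_seq \<tau> \<sigma> j)"
      using A(1) assms(2,3) M_seq_pos[of \<tau> \<sigma> j] by (intro mult_left_mono mult_right_mono powr_mono2) auto
    finally show ?thesis .
  qed
  thus ?thesis using A(1) by blast
qed

lemma E_hI:
  assumes "smooth_on UNIV f" "h > 0"
    and "\<And>l x. cmod (partials l f x) \<le> A * (h powr (real (length l) powr \<sigma>) * M_seq \<tau> \<sigma> (length l))"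
  shows "f \<in> E_h \<tau> \<sigma> h K"
proof -
  let ?D = "\<lambda>\<alpha>. h powr (real (mlength \<alpha>) powr \<sigma>) * M_seq \<tau> \<sigma> (mlength \<alpha>)"
  have D: "?D \<alpha> > 0" for \<alpha> :: "'a \<Rightarrow> nat" using assms(2) M_seq_pos by simp
  have "cmod (mderiv \<alpha> f x) / ?D \<alpha> \<le> A" for \<alpha> x
    using assms(3)[of "index_list \<alpha>" x] D[of \<alpha>]
    by (simp add: mderiv_eq_partials length_index_list pos_divide_le_eq)
  hence "bdd_above {cmod (mderiv \<alpha> f x) / ?D \<alpha> | \<alpha> x. x \<in> K}"
    unfolding bdd_above_def by blast
  moreover have "\<exists>W. open W \<and> K \<subseteq> W \<and> smooth_on W f"
    using assms(1) open_UNIV by blast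
  ultimately show ?thesis unfolding E_h_def by blast
qed

text \<open>How the parameter \<open>h\<close> degrades under the product of two functions, and under a shift of the
  order by a constant. Both maps are onto \<open>(0, \<infinity>)\<close>, which is what the Beurling case needs.\<close>

definition prod_scale :: "real \<Rightarrow> real \<Rightarrow> real"
  where "prod_scale \<sigma> h = (if h \<ge> 1 then h else h powr (2 powr (- \<sigma>)))"

definition shift_scale :: "real \<Rightarrow> real \<Rightarrow> real"
  where "shift_scale \<sigma> h = (if h \<ge> 1 then h powr (2 powr \<sigma>) else h)"

lemma prod_scale_pos: "h > 0 \<Longrightarrow> prod_scale \<sigma> h > 0"
  and shift_scale_pos: "h > 0 \<Longrightarrow> shift_scale \<sigma> h > 0"
  by (auto simp: prod_scale_def shift_scale_def)

lemma prod_scale_surj: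
  assumes "y > 0"
  shows "\<exists>h>0. prod_scale \<sigma> h = y"
proof (cases "y \<ge> 1")
  case False
  have "y powr (2 powr \<sigma>) < 1 powr (2 powr \<sigma>)" using False assms by (intro powr_less_mono2) auto
  hence "prod_scale \<sigma> (y powr (2 powr \<sigma>)) = y"
    using assms by (simp add: prod_scale_def powr_powr powr_add[symmetric])
  thus ?thesis using assms by (intro exI[of _ "y powr (2 powr \<sigma>)"]) auto
qed (use assms in \<open>auto simp: prod_scale_def\<close>)

lemma shift_scale_surj:
  assumes "y > 0"
  shows "\<exists>h>0. shift_scale \<sigma> h = y"
proof (cases "y \<ge> 1")
  case True
  have "y powr (2 powr (- \<sigma>)) \<ge> 1" using True by (intro ge_one_powr_ge_zero) auto
  hence "shift_scale \<sigma> (y powr (2 powr (- \<sigma>))) = y"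
    using assms by (simp add: shift_scale_def powr_powr powr_add[symmetric])
  thus ?thesis using assms by (intro exI[of _ "y powr (2 powr (- \<sigma>))"]) auto
qed (use assms in \<open>auto simp: shift_scale_def\<close>)

text \<open>For \<open>h \<ge> 1\<close> the exponent may be enlarged, so superadditivity suffices.
  For \<open>h < 1\<close> it may only be reduced, and \<open>powr_subadd\<close> allows this at the
  price of the factor \<open>2 powr (- \<sigma>)\<close> in the exponent.\<close>

lemma prod_scale_mult:
  fixes x y :: real
  assumes "h > 0" "x \<ge> 0" "y \<ge> 0" "\<sigma> \<ge> 1"
  shows "h powr (x powr \<sigma>) * h powr (y powr \<sigma>) \<le> prod_scale \<sigma> h powr ((x + y) powr \<sigma>)"
proof (cases "h \<ge> 1")
  case True
  have "h powr (x powr \<sigma> + y powr \<sigma>) \<le> h powr ((x + y) powr \<sigma>)"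
    using True assms by (intro powr_mono powr_superadd) auto
  thus ?thesis using True by (simp add: prod_scale_def powr_add)
next
  case False
  have "2 powr (- \<sigma>) * (x + y) powr \<sigma> \<le> 2 powr (- \<sigma>) * (2 powr \<sigma> * (x powr \<sigma> + y powr \<sigma>))"
    using assms by (intro mult_left_mono powr_subadd) auto
  also have "\<dots> = x powr \<sigma> + y powr \<sigma>" by (simp add: mult.assoc[symmetric] powr_add[symmetric])
  finally have "h powr (x powr \<sigma> + y powr \<sigma>) \<le> h powr (2 powr (- \<sigma>) * (x + y) powr \<sigma>)"
    using False assms by (intro powr_mono') auto
  thus ?thesis using False assms(1) by (simp add: prod_scale_def powr_add powr_powr)
qed

text \<open>Here the sum in the exponent has to be split, so the loss occurs for
  \<open>h \<ge> 1\<close>, while for \<open>h < 1\<close> dropping \<open>y\<close> suffices. The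
  part that depends on the fixed shift \<open>y\<close> goes into the constant.\<close>

lemma shift_scale_add:
  fixes x y :: real
  assumes "h > 0" "x \<ge> 0" "y \<ge> 0" "\<sigma> \<ge> 1"
  shows "h powr ((x + y) powr \<sigma>) \<le> max 1 (h powr (2 powr \<sigma> * y powr \<sigma>)) * shift_scale \<sigma> h powr (x powr \<sigma>)"
proof (cases "h \<ge> 1")
  case True
  have "h powr ((x + y) powr \<sigma>) \<le> h powr (2 powr \<sigma> * (x powr \<sigma> + y powr \<sigma>))"
    using True assms by (intro powr_mono powr_subadd) auto
  also have "\<dots> = h powr (2 powr \<sigma> * y powr \<sigma>) * shift_scale \<sigma> h powr (x powr \<sigma>)"
    using True by (simp add: shift_scale_def powr_powr powr_add distrib_left)
  also have "\<dots> \<le> max 1 (h powr (2 powr \<sigma> * y powr \<sigma>)) * shift_scale \<sigma> h powr (x powr \<sigma>)"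
    by (intro mult_right_mono) auto
  finally show ?thesis .
next
  case False
  have "h powr ((x + y) powr \<sigma>) \<le> h powr (x powr \<sigma>)"
    using False assms by (intro powr_mono' powr_mono2) auto
  also have "\<dots> = 1 * shift_scale \<sigma> h powr (x powr \<sigma>)" using False by (simp add: shift_scale_def)
  also have "\<dots> \<le> max 1 (h powr (2 powr \<sigma> * y powr \<sigma>)) * shift_scale \<sigma> h powr (x powr \<sigma>)"
    by (intro mult_right_mono) auto
  finally show ?thesis .
qed

section \<open>Decay for distributions given by a function of the class\<close>

lemma stft_eq: "stft \<phi> u x \<xi> = u (\<lambda>t. cnj (\<phi> (t - x)) * phase \<xi> t)"
  unfolding stft_def fourier_cs_def dist_mult_def translate_def phase_def ..

lemma supp_translate_cnj:
  "supp (\<lambda>t. cnj (\<phi> (t - x))) \<subseteq> {t. t - x \<in> supp \<phi>}"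
proof (rule supp_minimal)
  have "closed ((\<lambda>t. t - x) -` supp \<phi>)"
    by (intro closed_vimage closed_supp continuous_intros)
  thus "closed {t. t - x \<in> supp \<phi>}" by (simp add: vimage_def)
qed (auto simp: not_in_supp)

text \<open>The constant is uniform in \<open>x\<close> because all the products are supported in
  the one compact set \<open>B\<close> and translation does not change the bounds on the
  window.\<close>

lemma fourier_product_decay:
  fixes f \<phi> :: "real ^ 'n::finite \<Rightarrow> complex"
  assumes par: "\<tau> > 0" "\<sigma> > 1" "h > 0"
    and f: "open \<Omega>" "smooth_on \<Omega> f" and B: "compact B" "B \<subseteq> \<Omega>"
    and f_bd: "\<And>i j t. t \<in> B \<Longrightarrow> cmod ((partial i ^^ j) f t) \<le> A1 * (h powr (real j powr \<sigma>) * M_seq \<tau> \<sigma> j)"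
    and \<phi>: "smooth_on UNIV \<phi>"
    and \<phi>_bd: "\<And>i j s. s \<in> supp \<phi> \<Longrightarrow> cmod ((partial i ^^ j) \<phi> s) \<le> A2 * (h powr (real j powr \<sigma>) * M_seq \<tau> \<sigma> j)"
    and X: "\<And>x s. x \<in> X \<Longrightarrow> s \<in> supp \<phi> \<Longrightarrow> s + x \<in> B"
    and A: "A1 > 0" "A2 > 0"
  shows "\<exists>A>0. \<forall>x\<in>X. \<forall>\<xi>. \<xi> \<noteq> 0 \<longrightarrow> cmod (fourier (\<lambda>t. f t * cnj (\<phi> (t - x))) \<xi>)
    \<le> A * exp (- assoc_fun \<tau> \<sigma> (1 / (2 * prod_scale \<sigma> h)) (norm \<xi>))"
proof -
  define \<kappa> where "\<kappa> = prod_scale \<sigma> h"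
  have \<kappa>: "\<kappa> > 0" unfolding \<kappa>_def using par(3) by (rule prod_scale_pos)
  define Z where "Z p = A1 * A2 * (\<kappa> powr (real p powr \<sigma>) * M_seq \<tau> \<sigma> p)" for p
  have Z: "Z p > 0" for p unfolding Z_def using A \<kappa> M_seq_pos by simp
  \<comment> \<open>Absorbs both the \<open>2 ^ p\<close> of the Leibniz estimate and the
    \<open>CARD('n) ^ p\<close> of \<open>fourier_decay\<close>.\<close>
  obtain A3 where A3: "A3 > 0" "\<And>p. (2 * real CARD('n)) ^ p \<le> A3 * 2 powr (real p powr \<sigma>)"
    using power_le_powr_powr[OF par(2)] by blast
  \<comment> \<open>The summand 1 keeps \<open>A\<close> positive if \<open>B\<close> is a null
    set.\<close>
  define A where "A = measure lborel B * (A1 * A2) * A3 + 1"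
  have A_pos: "A > 0" unfolding A_def using A A3(1) by (simp add: add_nonneg_pos)
  have "cmod (fourier (\<lambda>t. f t * cnj (\<phi> (t - x))) \<xi>)
      \<le> A * exp (- assoc_fun \<tau> \<sigma> (1 / (2 * prod_scale \<sigma> h)) (norm \<xi>))" if x: "x \<in> X" and \<xi>: "\<xi> \<noteq> 0" for x \<xi>
  proof -
    let ?g = "\<lambda>t. cnj (\<phi> (t - x))"
    let ?F = "\<lambda>t. f t * ?g t"
    define D where "D = {t. t - x \<in> supp \<phi>}"
    have DB: "D \<subseteq> B" unfolding D_def using X[OF x] by force
    have "supp ?F \<subseteq> supp ?g" using supp_mult[of ?g f] by (simp add: mult.commute)
    also have "\<dots> \<subseteq> D" unfolding D_def by (rule supp_translate_cnj)
    finally have suppF: "supp ?F \<subseteq> D" .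
    have smg: "smooth_on UNIV ?g" by (rule smooth_on_translate_cnj[OF \<phi>])
    have smg\<Omega>: "smooth_on \<Omega> ?g" by (rule smooth_on_subset[OF smg]) simp
    have smF: "smooth_on UNIV ?F"
      by (rule smooth_on_extend[OF f(1) smooth_on_mult[OF f smg\<Omega>]]) (use suppF DB B in blast)
    have bd: "cmod ((partial i ^^ p) ?F t) \<le> 2 ^ p * Z p" for i p t
    \<comment> \<open>Off \<open>D\<close>, possibly outside \<open>B\<close>, the bounds on
      \<open>f\<close> may fail, but there the product vanishes with all its derivatives.\<close>
    proof (cases "t \<in> D")
      case True
      hence t: "t \<in> B" "t \<in> \<Omega>" "t - x \<in> supp \<phi>" using DB B unfolding D_def by auto
      show ?thesis
      proof (rule Leibniz_bound[OF f smg\<Omega> t(2)])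
        fix j k
        have "cmod ((partial i ^^ j) f t) * cmod ((partial i ^^ k) ?g t)
            = cmod ((partial i ^^ j) f t) * cmod ((partial i ^^ k) \<phi> (t - x))"
          by (simp add: funpow_translate_cnj[OF \<phi>])
        also have "\<dots> \<le> (A1 * (h powr (real j powr \<sigma>) * M_seq \<tau> \<sigma> j)) * (A2 * (h powr (real k powr \<sigma>) * M_seq \<tau> \<sigma> k))"
          using A(1) M_seq_pos[of \<tau> \<sigma> j] by (intro mult_mono f_bd \<phi>_bd t) auto
        also have "\<dots> = A1 * A2 * ((h powr (real j powr \<sigma>) * h powr (real k powr \<sigma>)) * (M_seq \<tau> \<sigma> j * M_seq \<tau> \<sigma> k))"
          by (simp add: mult_ac)
        also have "\<dots> \<le> A1 * A2 * (\<kappa> powr ((real j + real k) powr \<sigma>) * M_seq \<tau> \<sigma> (j + k))"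
          unfolding \<kappa>_def using A par M_seq_pos[of \<tau> \<sigma>]
          by (intro mult_left_mono mult_mono prod_scale_mult M_seq_mult_le) (auto intro: less_imp_le)
        finally show "cmod ((partial i ^^ j) f t) * cmod ((partial i ^^ k) ?g t) \<le> Z (j + k)"
          unfolding Z_def by simp
      qed
    next
      case False
      hence "(partial i ^^ p) ?F t = 0"
        using supp_funpow[of p i ?F] suppF by (intro not_in_supp) blast
      thus ?thesis using Z[of p] by simp
    qed
    have "norm \<xi> ^ p * cmod (fourier ?F \<xi>) \<le> A * ((1 / (1 / (2 * \<kappa>))) powr (real p powr \<sigma>) * M_seq \<tau> \<sigma> p)" for p
    proof -
      have "norm \<xi> ^ p * cmod (fourier ?F \<xi>) \<le> CARD('n) ^ p * (measure lborel B * (2 ^ p * Z p))"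
        by (rule fourier_decay[OF smF B(1) _ bd]) (use suppF DB in blast)
      also have "\<dots> = measure lborel B * (A1 * A2) * (\<kappa> powr (real p powr \<sigma>) * M_seq \<tau> \<sigma> p) * (2 * real CARD('n)) ^ p"
        unfolding Z_def by (simp add: power_mult_distrib mult_ac)
      also have "\<dots> \<le> measure lborel B * (A1 * A2) * (\<kappa> powr (real p powr \<sigma>) * M_seq \<tau> \<sigma> p) * (A3 * 2 powr (real p powr \<sigma>))"
        using A M_seq_pos[of \<tau> \<sigma> p] by (intro mult_left_mono A3) auto
      also have "\<dots> = measure lborel B * (A1 * A2) * A3 * ((2 * \<kappa>) powr (real p powr \<sigma>) * M_seq \<tau> \<sigma> p)"
        using \<kappa> by (simp add: powr_mult mult_ac)
      also have "\<dots> \<le> A * ((2 * \<kappa>) powr (real p powr \<sigma>) * M_seq \<tau> \<sigma> p)"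
        unfolding A_def using M_seq_pos[of \<tau> \<sigma> p] by (intro mult_right_mono) auto
      finally show ?thesis by simp
    qed
    from le_exp_assoc_fun[OF _ _ A_pos _ this par(2)] show ?thesis
      using \<kappa> \<xi> unfolding \<kappa>_def by simp
  qed
  thus ?thesis using A_pos by blast
qed

text \<open>With \<open>x\<close> within \<open>r\<close> of \<open>x0\<close> and the window
  supported within \<open>r\<close> of the origin, the translated window is supported in
  \<open>cball x0 (2 * r)\<close>, where \<open>u\<close> is given by \<open>f\<close>; this is the
  origin of the radius \<open>2 * r\<close>.\<close>

lemma stft_decay:
  fixes f :: "real ^ 'n::finite \<Rightarrow> complex"
  assumes par: "\<tau> > 0" "\<sigma> > 1" "h > 0" "0 < h1" "h1 \<le> h" "0 < h2" "h2 \<le> h"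
    and \<Omega>: "open \<Omega>" "smooth_on \<Omega> f" "cball x0 (2 * r) \<subseteq> \<Omega>"
    and u: "\<And>\<psi>. \<psi> \<in> test_fun \<Omega> \<Longrightarrow> u \<psi> = (LINT x|lborel. f x * \<psi> x)"
    and f: "f \<in> E_h \<tau> \<sigma> h1 (cball x0 (2 * r))"
    and \<phi>: "\<phi> \<in> D_h \<tau> \<sigma> h2 {y. y + x0 \<in> cball x0 r}"
  shows "\<exists>A>0. \<forall>x\<in>cball x0 r. \<forall>\<xi>. \<xi> \<noteq> 0 \<longrightarrow>
    cmod (stft \<phi> u x \<xi>) \<le> A * exp (- assoc_fun \<tau> \<sigma> (1 / (2 * prod_scale \<sigma> h)) (norm \<xi>))"
proof -
  let ?K = "{y. y + x0 \<in> cball x0 r}"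
  have \<phi>E: "\<phi> \<in> E_h \<tau> \<sigma> h2 ?K" and supp\<phi>: "supp \<phi> \<subseteq> ?K" using \<phi> by (auto simp: D_h_def)
  obtain W where W: "open W" "?K \<subseteq> W" "smooth_on W \<phi>" using \<phi>E unfolding E_h_def by blast
  have sm\<phi>: "smooth_on UNIV \<phi>" by (rule smooth_on_extend[OF W(1,3)]) (use supp\<phi> W(2) in blast)
  have K: "y \<in> ?K \<longleftrightarrow> norm y \<le> r" for y by (simp add: dist_norm)
  have X: "s + x \<in> cball x0 (2 * r)" if "x \<in> cball x0 r" "s \<in> supp \<phi>" for x s
  proof -
    have "norm s \<le> r" using that(2) supp\<phi> K by blast
    moreover have "norm (x - x0) \<le> r" using that(1) by (simp add: dist_norm norm_minus_commute)
    ultimately have "norm (s + (x - x0)) \<le> 2 * r" using norm_triangle_ineq[of s "x - x0"] by linarith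
    thus ?thesis by (simp add: dist_norm norm_minus_commute algebra_simps)
  qed
  obtain A1 where A1: "A1 > 0" "\<And>i j x. x \<in> cball x0 (2 * r) \<Longrightarrow>
      cmod ((partial i ^^ j) f x) \<le> A1 * (h powr (real j powr \<sigma>) * M_seq \<tau> \<sigma> j)"
    using E_h_bound_mono[OF f par(4,5)] by blast
  obtain A2 where A2: "A2 > 0" "\<And>i j x. x \<in> ?K \<Longrightarrow>
      cmod ((partial i ^^ j) \<phi> x) \<le> A2 * (h powr (real j powr \<sigma>) * M_seq \<tau> \<sigma> j)"
    using E_h_bound_mono[OF \<phi>E par(6,7)] by blast
  have A2': "cmod ((partial i ^^ j) \<phi> x) \<le> A2 * (h powr (real j powr \<sigma>) * M_seq \<tau> \<sigma> j)" if "x \<in> supp \<phi>" for i j x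
    using A2(2) supp\<phi> that by blast
  have "\<exists>A>0. \<forall>x\<in>cball x0 r. \<forall>\<xi>. \<xi> \<noteq> 0 \<longrightarrow> cmod (fourier (\<lambda>t. f t * cnj (\<phi> (t - x))) \<xi>)
    \<le> A * exp (- assoc_fun \<tau> \<sigma> (1 / (2 * prod_scale \<sigma> h)) (norm \<xi>))"
    by (rule fourier_product_decay[OF par(1-3) \<Omega>(1,2) compact_cball \<Omega>(3) A1(2) sm\<phi> A2' X A1(1) A2(1)])
  moreover have "stft \<phi> u x \<xi> = fourier (\<lambda>t. f t * cnj (\<phi> (t - x))) \<xi>" if x: "x \<in> cball x0 r" for x \<xi>
  proof -
    let ?\<psi> = "\<lambda>t. cnj (\<phi> (t - x)) * phase \<xi> t"
    have "supp ?\<psi> \<subseteq> {t. t - x \<in> supp \<phi>}"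
      using supp_mult[of "\<lambda>t. cnj (\<phi> (t - x))" "phase \<xi>"] supp_translate_cnj[of \<phi> x] by blast
    also have "\<dots> \<subseteq> cball x0 (2 * r)" using X[OF x] by force
    finally have s: "supp ?\<psi> \<subseteq> cball x0 (2 * r)" .
    have "?\<psi> \<in> test_fun \<Omega>"
      unfolding test_fun_def using s \<Omega>(3) compact_supp_subset[OF s compact_cball]
      by (auto intro: smooth_on_mult smooth_on_translate_cnj[OF sm\<phi>] smooth_on_phase)
    from u[OF this] show ?thesis unfolding stft_eq fourier_def by (simp add: mult.assoc)
  qed
  ultimately show ?thesis by simp
qed

section \<open>Regularity from decay\<close>

text \<open>Differentiating \<open>p\<close> times brings down at most
  \<open>(2 * pi * norm k) ^ p\<close>. Decay of order \<open>p + d\<close> with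
  \<open>d = 2 * CARD('n)\<close> pays for this power and for summability over the lattice. The
  shift by \<open>d\<close> is then absorbed by \<open>M_seq_shift\<close> and
  \<open>shift_scale_add\<close>.\<close>

lemma synthesis_bound:
  fixes v :: "real ^ 'n::finite \<Rightarrow> complex"
  assumes par: "\<tau> > 0" "\<sigma> > 1" "h > 0" "A > 0"
    and v: "\<And>\<xi>. \<xi> \<noteq> 0 \<Longrightarrow> cmod (v \<xi>) \<le> A * exp (- assoc_fun \<tau> \<sigma> h (norm \<xi>))"
  shows "normally_summable (\<lambda>n (t :: real ^ 'n). v (- zvec n) * phase (zvec n) t)"
    and "\<exists>A. \<forall>l x. cmod (partials l (\<lambda>t :: real ^ 'n. \<Sum>n. v (- zvec n) * phase (zvec n) t) x)
      \<le> A * ((2 * shift_scale \<sigma> (1 / h)) powr (real (length l) powr \<sigma>) * M_seq \<tau> \<sigma> (length l))"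
proof -
  define d where "d = 2 * CARD('n)"
  define C where "C p = A * ((1 / h) powr (real (p + d) powr \<sigma>) * M_seq \<tau> \<sigma> (p + d))" for p
  \<comment> \<open>The hypothesis is silent at frequency 0. The constant term of the series is
    therefore carried separately; it contributes only to the order 0, since its derivatives
    vanish.\<close>
  define C0 where "C0 p = (if p = 0 then cmod (v 0) else 0)" for p :: nat
  define B where "B p = 2 ^ CARD('n) * C p + C0 p" for p
  have C: "C p \<ge> 0" for p unfolding C_def using par M_seq_pos[of \<tau> \<sigma> "p + d"] by simp
  have tm: "norm (zvec n :: real ^ 'n) ^ p * cmod (v (- zvec n)) \<le> B p * weight (zvec n :: real ^ 'n)" for n p
    unfolding B_def
  proof (rule le_weight[OF zvec_in_lattice _ C])
    show "norm (zvec n :: real ^ 'n) ^ (p + 2 * CARD('n)) * cmod (v (- zvec n)) \<le> C p"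
    proof (cases "zvec n = (0 :: real ^ 'n)")
      case True
      hence z: "norm (zvec n :: real ^ 'n) ^ (p + 2 * CARD('n)) = 0" by (simp add: power_0_left)
      show ?thesis unfolding z using C[of p] by simp
    next
      case False
      hence "norm (zvec n :: real ^ 'n) ^ (p + d) * cmod (v (- zvec n))
          \<le> norm (zvec n :: real ^ 'n) ^ (p + d) * (A * exp (- assoc_fun \<tau> \<sigma> h (norm (zvec n :: real ^ 'n))))"
        using v[of "- zvec n"] by (intro mult_left_mono) auto
      also have "\<dots> = A * (norm (zvec n :: real ^ 'n) ^ (p + d) * exp (- assoc_fun \<tau> \<sigma> h (norm (zvec n :: real ^ 'n))))"
        by simp
      also have "\<dots> \<le> C p"
        unfolding C_def using par False by (intro mult_left_mono exp_assoc_fun_le) auto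
      finally show ?thesis unfolding d_def .
    qed
  qed (auto simp: C0_def)
  define W where "W = (\<Sum>n. weight (zvec n :: real ^ 'n))"
  have sw: "summable (\<lambda>n. B p * weight (zvec n :: real ^ 'n))" for p
    by (intro summable_mult summable_weight)
  have summ: "summable (\<lambda>n. norm (zvec n :: real ^ 'n) ^ p * cmod (v (- zvec n)))" for p
    by (rule summable_comparison_test'[OF sw[of p], of 0]) (use tm in simp)
  show ns: "normally_summable (\<lambda>n (t :: real ^ 'n). v (- zvec n) * phase (zvec n) t)"
    by (rule normally_summable_phase) (rule summ)
  obtain A4 where A4: "A4 > 0" "\<And>p. (2 * pi) ^ p * M_seq \<tau> \<sigma> (p + d) \<le> A4 * (2 powr (real p powr \<sigma>) * M_seq \<tau> \<sigma> p)"
    using M_seq_shift[OF par(1,2)] by blast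
  define A5 where "A5 = max 1 ((1 / h) powr (2 powr \<sigma> * real d powr \<sigma>))"
  have A5: "A5 \<ge> 1" unfolding A5_def by simp
  let ?G = "\<lambda>p. (2 * shift_scale \<sigma> (1 / h)) powr (real p powr \<sigma>) * M_seq \<tau> \<sigma> p"
  have pos: "shift_scale \<sigma> (1 / h) > 0" using par by (intro shift_scale_pos) simp
  have Cbd: "(2 * pi) ^ p * C p \<le> A * A5 * A4 * ?G p" for p
  proof -
    have "(2 * pi) ^ p * C p = A * (1 / h) powr ((real p + real d) powr \<sigma>) * ((2 * pi) ^ p * M_seq \<tau> \<sigma> (p + d))"
      unfolding C_def by simp
    also have "\<dots> \<le> A * (A5 * shift_scale \<sigma> (1 / h) powr (real p powr \<sigma>)) * (A4 * (2 powr (real p powr \<sigma>) * M_seq \<tau> \<sigma> p))"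
    proof (rule mult_mono[OF mult_left_mono A4(2)])
      show "(1 / h) powr ((real p + real d) powr \<sigma>) \<le> A5 * shift_scale \<sigma> (1 / h) powr (real p powr \<sigma>)"
        unfolding A5_def using par by (intro shift_scale_add) auto
      show "0 \<le> (2 * pi) ^ p * M_seq \<tau> \<sigma> (p + d)"
        using M_seq_pos[of \<tau> \<sigma> "p + d"] by simp
      show "0 \<le> A * (A5 * shift_scale \<sigma> (1 / h) powr (real p powr \<sigma>))"
        using par A5 by simp
    qed (use par in auto)
    also have "\<dots> = A * A5 * A4 * ?G p" using pos by (simp add: powr_mult mult_ac)
    finally show ?thesis .
  qed
  have C0bd: "(2 * pi) ^ p * C0 p \<le> cmod (v 0) * ?G p" for p
  proof (cases "p = 0")
    case True
    thus ?thesis using pos by (simp add: C0_def M_seq_def)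
  next
    case False
    thus ?thesis using M_seq_pos[of \<tau> \<sigma> p] by (simp add: C0_def)
  qed
  have W: "W \<ge> 0" unfolding W_def by (rule suminf_nonneg[OF summable_weight less_imp_le[OF weight_pos]])
  define A' where "A' = (2 ^ CARD('n) * (A * A5 * A4) + cmod (v 0)) * W"
  have "cmod (partials l (\<lambda>t :: real ^ 'n. \<Sum>n. v (- zvec n) * phase (zvec n) t) x) \<le> A' * ?G (length l)" for l x
  proof -
    let ?p = "length l"
    let ?F = "\<lambda>n (t :: real ^ 'n). v (- zvec n) * phase (zvec n) t"
    have le: "cmod (partials l (?F n) x) \<le> (2 * pi) ^ ?p * (B ?p * weight (zvec n :: real ^ 'n))" for n
    proof -
      have "cmod (partials l (?F n) x) \<le> cmod (v (- zvec n)) * (2 * pi * norm (zvec n :: real ^ 'n)) ^ ?p"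
        by (rule norm_partials_cmult_phase)
      also have "\<dots> = (2 * pi) ^ ?p * (norm (zvec n :: real ^ 'n) ^ ?p * cmod (v (- zvec n)))"
        by (simp add: power_mult_distrib)
      also have "\<dots> \<le> (2 * pi) ^ ?p * (B ?p * weight (zvec n :: real ^ 'n))"
        by (intro mult_left_mono tm) simp
      finally show ?thesis .
    qed
    have s2: "summable (\<lambda>n. (2 * pi) ^ ?p * (B ?p * weight (zvec n :: real ^ 'n)))"
      by (intro summable_mult summable_weight)
    have s1: "summable (\<lambda>n. cmod (partials l (?F n) x))"
      by (rule summable_comparison_test'[OF s2, of 0]) (use le in simp)
    have "cmod (partials l (\<lambda>t. \<Sum>n. ?F n t) x) = cmod (\<Sum>n. partials l (?F n) x)"
      by (simp only: partials_suminf[OF ns])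
    also have "\<dots> \<le> (\<Sum>n. cmod (partials l (?F n) x))" by (rule summable_norm[OF s1])
    also have "\<dots> \<le> (\<Sum>n. (2 * pi) ^ ?p * (B ?p * weight (zvec n :: real ^ 'n)))"
      by (rule suminf_le[OF le s1 s2])
    also have "\<dots> = (2 * pi) ^ ?p * (\<Sum>n. B ?p * weight (zvec n :: real ^ 'n))"
      by (rule suminf_mult[OF sw])
    also have "(\<Sum>n. B ?p * weight (zvec n :: real ^ 'n)) = B ?p * W"
      unfolding W_def by (rule suminf_mult[OF summable_weight])
    also have "(2 * pi) ^ ?p * (B ?p * W) = (2 ^ CARD('n) * ((2 * pi) ^ ?p * C ?p) + (2 * pi) ^ ?p * C0 ?p) * W"
      unfolding B_def by (simp add: algebra_simps)
    also have "\<dots> \<le> (2 ^ CARD('n) * (A * A5 * A4 * ?G ?p) + cmod (v 0) * ?G ?p) * W"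
      by (intro mult_right_mono add_mono mult_left_mono Cbd C0bd W) simp
    also have "\<dots> = A' * ?G ?p" unfolding A'_def by (simp add: algebra_simps)
    finally show ?thesis .
  qed
  thus "\<exists>A. \<forall>l x. cmod (partials l (\<lambda>t :: real ^ 'n. \<Sum>n. v (- zvec n) * phase (zvec n) t) x)
      \<le> A * ((2 * shift_scale \<sigma> (1 / h)) powr (real (length l) powr \<sigma>) * M_seq \<tau> \<sigma> (length l))"
    by blast
qed

text \<open>Truncated characters have seminorms of polynomial growth in the frequency: each
  derivative falls on \<open>g\<close> or brings down a factor of size at most
  \<open>2 * pi * norm \<xi>\<close>. The innermost derivative is split off, so that the induction
  hypothesis applies to \<open>partial i g\<close> as well.\<close>

lemma partials_mult_phase_bound:
  fixes g :: "real ^ 'n::finite \<Rightarrow> complex"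
  assumes "smooth_on UNIV g" "compact (supp g)"
  shows "\<exists>G\<ge>0. \<forall>\<xi> x. cmod (partials l (\<lambda>t. g t * phase \<xi> t) x) \<le> G * (1 + 2 * pi * norm \<xi>) ^ length l"
  using assms
proof (induction l arbitrary: g rule: rev_induct)
  case Nil
  obtain C where "C > 0" "\<And>x. cmod (g x) \<le> C" using smooth_compact_supp_bounded[OF Nil] by blast
  thus ?case by (intro exI[of _ C]) (simp add: norm_mult)
next
  case (snoc i l)
  obtain G1 where G1: "G1 \<ge> 0"
    "\<And>\<xi> x. cmod (partials l (\<lambda>t. partial i g t * phase \<xi> t) x) \<le> G1 * (1 + 2 * pi * norm \<xi>) ^ length l"
    using snoc.IH[OF smooth_on_partial[OF snoc.prems(1)] compact_supp_partial[OF snoc.prems(2)]] by blast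
  obtain G2 where G2: "G2 \<ge> 0"
    "\<And>\<xi> x. cmod (partials l (\<lambda>t. g t * phase \<xi> t) x) \<le> G2 * (1 + 2 * pi * norm \<xi>) ^ length l"
    using snoc.IH[OF snoc.prems] by blast
  have "cmod (partials (l @ [i]) (\<lambda>t. g t * phase \<xi> t) x) \<le> (G1 + G2) * (1 + 2 * pi * norm \<xi>) ^ length (l @ [i])" for \<xi> x
  proof -
    let ?c = "- 2 * complex_of_real pi * \<i> * complex_of_real (\<xi> $ i)"
    let ?E = "1 + 2 * pi * norm \<xi>"
    have sm1: "smooth_on UNIV (\<lambda>t. partial i g t * phase \<xi> t)" and sm2: "smooth_on UNIV (\<lambda>t. g t * phase \<xi> t)"
      by (intro smooth_on_mult open_UNIV smooth_on_phase smooth_on_partial snoc.prems)+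
    have sm3: "smooth_on UNIV (\<lambda>t. ?c * (g t * phase \<xi> t))"
      by (intro smooth_on_mult[OF open_UNIV smooth_on_const sm2])
    have "partial i (\<lambda>t. g t * phase \<xi> t) = (\<lambda>t. partial i g t * phase \<xi> t + ?c * (g t * phase \<xi> t))"
      using partial_mult[OF smooth_on_differentiable[OF snoc.prems(1) UNIV_I] differentiable_phase]
      by (simp add: partial_phase fun_eq_iff)
    hence "partials (l @ [i]) (\<lambda>t. g t * phase \<xi> t) x = partials l (\<lambda>t. partial i g t * phase \<xi> t) x + ?c * partials l (\<lambda>t. g t * phase \<xi> t) x"
      by (simp only: foldr_append foldr_Cons foldr_Nil o_apply id_apply partials_add[OF sm1 sm3] partials_cmult[OF sm2])
    also have "cmod \<dots> \<le> cmod (partials l (\<lambda>t. partial i g t * phase \<xi> t) x) + cmod (?c * partials l (\<lambda>t. g t * phase \<xi> t) x)"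
      by (rule norm_triangle_ineq)
    also have "\<dots> \<le> G1 * ?E ^ length l * ?E + ?E * (G2 * ?E ^ length l)"
    proof (intro add_mono)
      have E1: "?E \<ge> 1" by simp
      have "cmod (partials l (\<lambda>t. partial i g t * phase \<xi> t) x) \<le> G1 * ?E ^ length l * 1" using G1(2) by simp
      also have "\<dots> \<le> G1 * ?E ^ length l * ?E" using E1 G1(1) by (intro mult_left_mono) auto
      finally show "cmod (partials l (\<lambda>t. partial i g t * phase \<xi> t) x) \<le> G1 * ?E ^ length l * ?E" .
      have "cmod ?c = 2 * pi * \<bar>\<xi> $ i\<bar>" by (simp add: norm_mult)
      also have "\<dots> \<le> 2 * pi * norm \<xi>" by (intro mult_left_mono component_le_norm_cart) simp
      finally have "cmod ?c \<le> ?E" by linarith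
      thus "cmod (?c * partials l (\<lambda>t. g t * phase \<xi> t) x) \<le> ?E * (G2 * ?E ^ length l)"
        unfolding norm_mult[of ?c] using E1 by (intro mult_mono G2(2)) auto
    qed
    also have "\<dots> = (G1 + G2) * ?E ^ length (l @ [i])" by (simp add: algebra_simps)
    finally show ?thesis .
  qed
  moreover have "G1 + G2 \<ge> 0" using G1(1) G2(1) by simp
  ultimately show ?case by blast
qed

lemma normally_summable_mult_phase:
  fixes g :: "real ^ 'n::finite \<Rightarrow> complex"
  assumes g: "smooth_on UNIV g" "compact (supp g)"
    and a: "\<And>p. summable (\<lambda>n. norm (\<xi> n) ^ p * cmod (a n))"
  shows "normally_summable (\<lambda>n t. a n * (g t * phase (\<xi> n) t))"
  unfolding normally_summable_def
proof (intro conjI allI)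
  have sm: "smooth_on UNIV (\<lambda>t. g t * phase \<xi> t)" for \<xi>
    by (intro smooth_on_mult open_UNIV g smooth_on_phase)
  thus "smooth_on UNIV (\<lambda>t. a n * (g t * phase (\<xi> n) t))" for n
    by (intro smooth_on_mult[OF open_UNIV smooth_on_const])
  fix l
  obtain G where G: "G \<ge> 0" "\<And>\<xi> x. cmod (partials l (\<lambda>t. g t * phase \<xi> t) x) \<le> G * (1 + 2 * pi * norm \<xi>) ^ length l"
    using partials_mult_phase_bound[OF g] by blast
  let ?p = "length l"
  let ?M = "\<lambda>n. G * 2 ^ ?p * (norm (\<xi> n) ^ 0 * cmod (a n) + (2 * pi) ^ ?p * (norm (\<xi> n) ^ ?p * cmod (a n)))"
  have "summable ?M" by (intro summable_mult summable_add a)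
  moreover have "cmod (partials l (\<lambda>t. a n * (g t * phase (\<xi> n) t)) x) \<le> ?M n" for n x
  proof -
    let ?y = "2 * pi * norm (\<xi> n)"
    have y: "?y \<ge> 0" by simp
    have "(1 + ?y) ^ ?p \<le> (2 * max 1 ?y) ^ ?p" using y by (intro power_mono) auto
    also have "\<dots> = 2 ^ ?p * max 1 ?y ^ ?p" by (rule power_mult_distrib)
    also have "\<dots> \<le> 2 ^ ?p * (1 + ?y ^ ?p)" using y by (intro mult_left_mono) (auto simp: max_def)
    finally have pw: "(1 + ?y) ^ ?p \<le> 2 ^ ?p * (1 + ?y ^ ?p)" .
    have "cmod (partials l (\<lambda>t. a n * (g t * phase (\<xi> n) t)) x) = cmod (a n) * cmod (partials l (\<lambda>t. g t * phase (\<xi> n) t) x)"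
      by (simp only: partials_cmult[OF sm] norm_mult)
    also have "\<dots> \<le> cmod (a n) * (G * (2 ^ ?p * (1 + ?y ^ ?p)))"
      by (intro mult_left_mono order_trans[OF G(2)] pw G(1)) simp
    also have "\<dots> = ?M n" by (simp add: power_mult_distrib algebra_simps)
    finally show ?thesis .
  qed
  ultimately show "\<exists>M. summable M \<and> (\<forall>n x. cmod (partials l (\<lambda>t. a n * (g t * phase (\<xi> n) t)) x) \<le> M n)" by blast
qed

lemma normally_summable_shift:
  assumes "normally_summable F"
  shows "normally_summable (\<lambda>n. F (n + m))"
  unfolding normally_summable_def
proof (intro conjI allI normally_summable_smooth[OF assms])
  fix l
  obtain M where "summable M" "\<And>n x. cmod (partials l (F n) x) \<le> M n"
    using normally_summable_bound[OF assms, of l] by blast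
  thus "\<exists>M. summable M \<and> (\<forall>n x. cmod (partials l (F (n + m)) x) \<le> M n)"
    by (intro exI[of _ "\<lambda>n. M (n + m)"]) (simp add: summable_iff_shift)
qed

text \<open>The continuity needed to apply \<open>u\<close> termwise. All tails are supported in the
  same \<open>K\<close>, so one seminorm estimate serves for all of them, and its seminorms are
  bounded by tails of convergent numerical series.\<close>

lemma distribution_tail_tendsto_0:
  fixes F :: "nat \<Rightarrow> real ^ 'n::finite \<Rightarrow> complex"
  assumes u: "distribution U u" and K: "compact K" "K \<subseteq> U"
    and F: "normally_summable F" and supp: "\<And>n. supp (F n) \<subseteq> K"
  shows "(\<lambda>m. u (\<lambda>t. \<Sum>n. F (n + m) t)) \<longlonglongrightarrow> 0"
    and "(\<lambda>t. \<Sum>n. F (n + m) t) \<in> test_fun U"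
proof -
  let ?W = "\<lambda>m t. \<Sum>n. F (n + m) t"
  have suppW: "supp (?W m) \<subseteq> K" for m
  proof (rule supp_minimal[OF compact_imp_closed[OF K(1)]])
    fix t assume "t \<notin> K"
    hence "F n t = 0" for n using supp[of n] by (intro not_in_supp) blast
    thus "?W m t = 0" by simp
  qed
  have test: "?W m \<in> test_fun U" for m
    unfolding test_fun_def
    using smooth_on_suminf[OF normally_summable_shift[OF F]] compact_supp_subset[OF suppW K(1)] suppW[of m] K(2)
    by blast
  show "?W m \<in> test_fun U" by (rule test)
  have "\<exists>C N. \<forall>\<phi>\<in>test_fun U. supp \<phi> \<subseteq> K \<longrightarrow>
      cmod (u \<phi>) \<le> C * (\<Sum>\<alpha> | mlength \<alpha> \<le> N. SUP x. cmod (mderiv \<alpha> \<phi> x))"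
    by (rule u[unfolded distribution_def, THEN conjunct2, rule_format]) (use K in simp)
  then obtain C N where CN: "\<And>\<phi>. \<phi> \<in> test_fun U \<Longrightarrow> supp \<phi> \<subseteq> K \<Longrightarrow>
      cmod (u \<phi>) \<le> C * (\<Sum>\<alpha> | mlength \<alpha> \<le> N. SUP x. cmod (mderiv \<alpha> \<phi> x))"
    by blast
  obtain M where M: "\<And>l. summable (M l)" "\<And>l n x. cmod (partials l (F n) x) \<le> M l n"
    using normally_summable_bound[OF F] by metis
  define T where "T l m = (\<Sum>n. M l (n + m))" for l m
  have T0: "T l \<longlonglongrightarrow> 0" for l
  proof -
    have "(\<lambda>m. (\<Sum>n. M l n) - (\<Sum>n<m. M l n)) \<longlonglongrightarrow> (\<Sum>n. M l n) - (\<Sum>n. M l n)"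
      by (intro tendsto_diff tendsto_const summable_LIMSEQ M)
    thus ?thesis unfolding T_def by (simp add: suminf_minus_initial_segment[OF M(1)])
  qed
  have W_le: "cmod (partials l (?W m) x) \<le> T l m" for l m x
  proof -
    have s2: "summable (\<lambda>n. M l (n + m))" using M(1)[of l] by (simp add: summable_iff_shift)
    have s1: "summable (\<lambda>n. cmod (partials l (F (n + m)) x))"
      by (rule summable_comparison_test'[OF s2, of 0]) (use M(2) in simp)
    have "cmod (partials l (?W m) x) = cmod (\<Sum>n. partials l (F (n + m)) x)"
      by (simp only: partials_suminf[OF normally_summable_shift[OF F]])
    also have "\<dots> \<le> (\<Sum>n. cmod (partials l (F (n + m)) x))" by (rule summable_norm[OF s1])
    also have "\<dots> \<le> T l m" unfolding T_def by (rule suminf_le[OF M(2) s1 s2])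
    finally show ?thesis .
  qed
  have SUP_bounds: "0 \<le> (SUP x. cmod (mderiv \<alpha> (?W m) x))" "(SUP x. cmod (mderiv \<alpha> (?W m) x)) \<le> T (index_list \<alpha>) m" for \<alpha> m
  proof -
    have bdd: "bdd_above (range (\<lambda>x. cmod (mderiv \<alpha> (?W m) x)))"
      unfolding mderiv_eq_partials by (intro bdd_aboveI2[of _ _ "T (index_list \<alpha>) m"] W_le)
    show "0 \<le> (SUP x. cmod (mderiv \<alpha> (?W m) x))"
      by (rule cSUP_upper2[OF bdd UNIV_I]) simp
    show "(SUP x. cmod (mderiv \<alpha> (?W m) x)) \<le> T (index_list \<alpha>) m"
      unfolding mderiv_eq_partials by (intro cSUP_least W_le) simp
  qed
  show "(\<lambda>m. u (?W m)) \<longlonglongrightarrow> 0"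
  proof (rule Lim_null_comparison)
    have "cmod (u (?W m)) \<le> \<bar>C\<bar> * (\<Sum>\<alpha> | mlength \<alpha> \<le> N. T (index_list \<alpha>) m)" for m
    proof -
      have "cmod (u (?W m)) \<le> C * (\<Sum>\<alpha> | mlength \<alpha> \<le> N. SUP x. cmod (mderiv \<alpha> (?W m) x))"
        by (rule CN[OF test suppW])
      also have "\<dots> \<le> \<bar>C\<bar> * (\<Sum>\<alpha> | mlength \<alpha> \<le> N. T (index_list \<alpha>) m)"
        by (intro mult_mono abs_ge_self sum_mono sum_nonneg SUP_bounds) simp
      finally show ?thesis .
    qed
    thus "eventually (\<lambda>m. norm (u (?W m)) \<le> \<bar>C\<bar> * (\<Sum>\<alpha> | mlength \<alpha> \<le> N. T (index_list \<alpha>) m)) sequentially"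
      by (intro always_eventually allI)
    have "(\<lambda>m. \<bar>C\<bar> * (\<Sum>\<alpha> | mlength \<alpha> \<le> N. T (index_list \<alpha>) m)) \<longlonglongrightarrow> \<bar>C\<bar> * (\<Sum>\<alpha> | mlength (\<alpha> :: 'n \<Rightarrow> nat) \<le> N. 0)"
      by (intro tendsto_mult tendsto_const tendsto_sum T0)
    thus "(\<lambda>m. \<bar>C\<bar> * (\<Sum>\<alpha> | mlength \<alpha> \<le> N. T (index_list \<alpha>) m)) \<longlonglongrightarrow> 0" by simp
  qed
qed

text \<open>A Parseval identity. Multiplying the Fourier series of \<open>\<psi>\<close> by
  \<open>g\<close> leaves its sum unchanged and turns its terms into test functions, so
  \<open>u\<close> can be applied termwise. Integrating the synthesized series against
  \<open>\<psi>\<close> termwise gives the same sum.\<close>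

lemma distribution_eq_synthesis:
  fixes g :: "real ^ 'n::finite \<Rightarrow> complex"
  assumes u: "distribution U u"
    and g: "smooth_on UNIV g" "compact (supp g)" "supp g \<subseteq> U" "\<And>x i. x \<in> supp g \<Longrightarrow> \<bar>x $ i - c $ i\<bar> < 1 / 2"
    and v: "normally_summable (\<lambda>n (t :: real ^ 'n). u (\<lambda>t. g t * phase (- zvec n) t) * phase (zvec n) t)"
    and \<psi>: "smooth_on UNIV \<psi>" "compact (supp \<psi>)" "supp \<psi> \<subseteq> supp g" "\<And>t. g t * \<psi> t = \<psi> t"
  shows "u \<psi> = (LINT t|lborel. (\<Sum>n. u (\<lambda>t. g t * phase (- zvec n) t) * phase (zvec n) t) * \<psi> t)"
proof -
  define v where "v \<xi> = u (\<lambda>t. g t * phase \<xi> t)" for \<xi>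
  define a where "a n = fourier \<psi> (zvec n)" for n
  define F where "F n t = a n * (g t * phase (- zvec n) t)" for n t
  have a: "summable (\<lambda>n. norm (zvec n :: real ^ 'n) ^ p * cmod (a n))" for p
    unfolding a_def by (rule fourier_lattice_summable[OF \<psi>(1,2)])
  have nsF: "normally_summable F"
    unfolding F_def by (rule normally_summable_mult_phase[OF g(1,2)]) (simp only: norm_minus_cancel a)
  have suppF: "supp (F n) \<subseteq> supp g" for n
    by (rule supp_minimal) (auto simp: F_def not_in_supp)
  let ?W = "\<lambda>m t. \<Sum>n. F (n + m) t"
  note tail = distribution_tail_tendsto_0[OF u g(2,3) nsF suppF]
  have W0: "?W 0 = \<psi>"
  proof
    fix t
    show "?W 0 t = \<psi> t"
    proof (cases "t \<in> supp g")
      case True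
      have "supp \<psi> \<subseteq> hcube c"
      proof
        fix y assume "y \<in> supp \<psi>"
        hence y: "\<bar>y $ i - c $ i\<bar> < 1 / 2" for i using \<psi>(3) g(4) by blast
        have "c $ i - 1 / 2 \<le> y $ i \<and> y $ i < c $ i + 1 / 2" for i using y[of i] by linarith
        thus "y \<in> hcube c" unfolding hcube_def by blast
      qed
      hence "\<psi> t = (\<Sum>n. a n * phase (- zvec n) t)"
        unfolding a_def by (rule fourier_series[OF \<psi>(1,2) _ g(4)[OF True]])
      moreover have "summable (\<lambda>n. a n * phase (- zvec n) t)"
        using normally_summable_summable[OF normally_summable_phase[of "\<lambda>n. - zvec n" a], of "[]" t] a by simp
      ultimately have "g t * \<psi> t = (\<Sum>n. g t * (a n * phase (- zvec n) t))"
        by (simp add: suminf_mult)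
      hence "\<psi> t = (\<Sum>n. g t * (a n * phase (- zvec n) t))" unfolding \<psi>(4) .
      thus ?thesis by (simp add: F_def mult.left_commute)
    next
      case False
      hence "\<psi> t = 0" using \<psi>(3) by (intro not_in_supp) blast
      moreover have "g t = 0" by (rule not_in_supp[OF False])
      ultimately show ?thesis by (simp add: F_def)
    qed
  qed
  have g_phase: "(\<lambda>t. g t * phase \<xi> t) \<in> test_fun U" for \<xi>
    unfolding test_fun_def
    using smooth_on_mult[OF open_UNIV g(1) smooth_on_phase] compact_supp_subset[OF supp_mult g(2)] supp_mult[of g "phase \<xi>"] g(3)
    by blast
  have lin: "u (\<lambda>x. p * \<phi> x + q * \<eta> x) = p * u \<phi> + q * u \<eta>"
    if "\<phi> \<in> test_fun U" "\<eta> \<in> test_fun U" for \<phi> \<eta> p q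
    by (rule u[unfolded distribution_def, THEN conjunct1, rule_format, OF that])
  have uW: "u (?W m) = u \<psi> - (\<Sum>n<m. a n * v (- zvec n))" for m
  proof (induction m)
    case 0
    show ?case using W0 by simp
  next
    case (Suc m)
    \<comment> \<open>One term is peeled off, in the shape of the linearity clause of
      \<open>distribution\<close>.\<close>
    have eq: "?W (Suc m) = (\<lambda>t. 1 * ?W m t + (- a m) * (g t * phase (- zvec m) t))"
    proof
      fix t
      have "summable (\<lambda>n. F (n + m) t)"
        using normally_summable_summable[OF normally_summable_shift[OF nsF, of m], where l = "[]" and x = t] by simp
      from suminf_split_head[OF this] have "?W (Suc m) t = ?W m t - F m t" by simp
      thus "?W (Suc m) t = 1 * ?W m t + (- a m) * (g t * phase (- zvec m) t)"
        by (simp add: F_def[of m])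
    qed
    have "u (?W (Suc m)) = 1 * u (?W m) + (- a m) * u (\<lambda>t. g t * phase (- zvec m) t)"
      unfolding eq by (rule lin[OF tail(2) g_phase])
    thus ?case using Suc by (simp add: v_def)
  qed
  \<comment> \<open>By \<open>uW\<close> the difference is a partial sum, so vanishing of the tails
    is convergence of the series to \<open>u \<psi>\<close>.\<close>
  have "(\<lambda>m. u \<psi> - u (?W m)) \<longlonglongrightarrow> u \<psi> - 0" by (intro tendsto_diff tendsto_const tail(1))
  hence "(\<lambda>n. a n * v (- zvec n)) sums u \<psi>" unfolding sums_def by (simp add: uW)
  hence sum_u: "u \<psi> = (\<Sum>n. a n * v (- zvec n))" by (simp add: sums_iff)
  have summv: "summable (\<lambda>n. cmod (v (- zvec n)))"
  proof -
    obtain M where M: "summable M" "\<And>n x. cmod (partials [] (\<lambda>t :: real ^ 'n. v (- zvec n) * phase (zvec n) t) x) \<le> M n"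
      using normally_summable_bound[OF v[folded v_def], of "[]"] by blast
    show ?thesis by (rule summable_comparison_test'[OF M(1), of 0]) (use M(2) in \<open>simp add: norm_mult\<close>)
  qed
  have cont\<psi>: "continuous_on UNIV \<psi>" by (rule smooth_on_continuous[OF \<psi>(1)])
  have int: "integrable lborel (\<lambda>t. \<psi> t * phase \<xi> t)" for \<xi>
    by (intro integrable_compact_supp continuous_on_mult cont\<psi> continuous_on_phase compact_supp_subset[OF supp_mult \<psi>(2)])
  have int_norm: "integrable lborel (\<lambda>t. cmod (\<psi> t))"
    by (intro integrable_norm integrable_compact_supp cont\<psi> \<psi>)
  have "(LINT t|lborel. (\<Sum>n. v (- zvec n) * phase (zvec n) t) * \<psi> t) = (LINT t|lborel. (\<Sum>n. v (- zvec n) * (\<psi> t * phase (zvec n) t)))"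
  proof (rule Bochner_Integration.integral_cong[OF refl])
    fix t :: "real ^ 'n"
    have "summable (\<lambda>n. v (- zvec n) * phase (zvec n) t)"
      using normally_summable_summable[OF v[folded v_def], of "[]" t] by simp
    from suminf_mult2[OF this, of "\<psi> t"]
    show "(\<Sum>n. v (- zvec n) * phase (zvec n) t) * \<psi> t = (\<Sum>n. v (- zvec n) * (\<psi> t * phase (zvec n) t))"
      by (simp add: mult_ac)
  qed
  also have "\<dots> = (\<Sum>n. LINT t|lborel. v (- zvec n) * (\<psi> t * phase (zvec n) t))"
  proof (rule integral_suminf)
    show "integrable lborel (\<lambda>t. v (- zvec n) * (\<psi> t * phase (zvec n) t))" for n
      by (intro integrable_mult_right int)
    have eq: "norm (v (- zvec n) * (\<psi> t * phase (zvec n) t)) = cmod (v (- zvec n)) * cmod (\<psi> t)" for n t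
      by (simp add: norm_mult)
    show "AE t in lborel. summable (\<lambda>n. norm (v (- zvec n) * (\<psi> t * phase (zvec n) t)))"
      unfolding eq by (intro AE_I2 summable_mult2 summv)
    show "summable (\<lambda>n. LINT t|lborel. norm (v (- zvec n) * (\<psi> t * phase (zvec n) t)))"
      unfolding eq by (simp add: summable_mult2 summv)
  qed
  also have "\<dots> = (\<Sum>n. a n * v (- zvec n))"
    unfolding a_def fourier_def by (simp add: mult.commute)
  finally show ?thesis using sum_u unfolding v_def by simp
qed

text \<open>The order of the quantifiers is essential: window, neighbourhood and \<open>f\<close>
  come before \<open>A\<close> and \<open>h\<close>, since in the Beurling case one \<open>f\<close>
  has to satisfy the estimates for all parameters. Likewise the window lies in \<open>D_h\<close>
  for every \<open>h\<close>, so it serves both cases.\<close>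

lemma local_synthesis:
  fixes U K :: "(real ^ 'n::finite) set"
  assumes par: "\<tau> > 0" "\<sigma> > 1" and u: "distribution U u"
    and K: "compact K" "x0 \<in> interior K" "K \<subseteq> U"
  shows "\<exists>\<phi> \<Omega> (f :: real ^ 'n \<Rightarrow> complex). (\<forall>h>0. \<phi> \<in> D_h \<tau> \<sigma> h {y. y + x0 \<in> K}) \<and> open \<Omega> \<and> x0 \<in> \<Omega> \<and> \<Omega> \<subseteq> U \<and>
    (\<forall>A>0. \<forall>h>0. (\<forall>\<xi>. \<xi> \<noteq> 0 \<longrightarrow> cmod (stft \<phi> u x0 \<xi>) \<le> A * exp (- assoc_fun \<tau> \<sigma> h (norm \<xi>))) \<longrightarrow>
      smooth_on UNIV f \<and> (\<forall>\<psi>\<in>test_fun \<Omega>. u \<psi> = (LINT x|lborel. f x * \<psi> x)) \<and>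
      (\<forall>K'. f \<in> E_h \<tau> \<sigma> (2 * shift_scale \<sigma> (1 / h)) K'))"
proof -
  obtain e where e: "e > 0" "ball x0 e \<subseteq> K"
    using K(2) unfolding mem_interior by blast
  \<comment> \<open>The window is supported in a cube of half side \<open>2 * r\<close>. The bound
    \<open>1 / 8\<close> makes it fit strictly inside the unit cube, and the other bound puts it
    inside the ball of radius \<open>e\<close>, since the norm is at most the sum of the
    \<open>CARD('n)\<close> coordinates.\<close>
  define r where "r = min (1 / 8) (e / (4 * CARD('n)))"
  have r: "r > 0" "r \<le> 1 / 8" "r \<le> e / (4 * CARD('n))" unfolding r_def using e(1) by auto
  have cubeK: "x \<in> K" if "\<And>j. \<bar>x $ j - x0 $ j\<bar> \<le> 2 * r" for x
  proof -
    have "norm (x - x0) \<le> (\<Sum>j\<in>UNIV. \<bar>(x - x0) $ j\<bar>)" by (rule norm_le_l1_cart)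
    also have "\<dots> \<le> (\<Sum>j\<in>(UNIV :: 'n set). 2 * r)" by (intro sum_mono) (use that in simp)
    also have "\<dots> = CARD('n) * (2 * r)" by simp
    also have "\<dots> \<le> CARD('n) * (2 * (e / (4 * CARD('n))))"
      using r(3) by (intro mult_left_mono) auto
    also have "\<dots> < e" using e(1) by simp
    finally have "x \<in> ball x0 e" by (simp add: dist_norm norm_minus_commute)
    thus ?thesis using e(2) by blast
  qed
  obtain \<phi> :: "real ^ 'n \<Rightarrow> complex" and A0 C0 where \<phi>: "smooth_on UNIV \<phi>"
    and one: "\<And>x. (\<And>j. \<bar>x $ j\<bar> \<le> r) \<Longrightarrow> \<phi> x = 1"
    and supp\<phi>: "supp \<phi> \<subseteq> {x. \<forall>j. \<bar>x $ j\<bar> \<le> 2 * r}" and A0: "A0 > 0" and C0: "C0 > 0"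
    and \<phi>_bd: "\<And>l x. cmod (partials l \<phi> x) \<le> A0 * (C0 ^ length l * real (length l) ^ (3 * length l))"
    using plateau[OF r(1), where ?'n = 'n] by blast
  let ?K0 = "{y. y + x0 \<in> K}"
  have supp\<phi>K: "supp \<phi> \<subseteq> ?K0"
  proof
    fix y assume "y \<in> supp \<phi>"
    hence "\<bar>y $ j\<bar> \<le> 2 * r" for j using supp\<phi> by blast
    thus "y \<in> ?K0" using cubeK[of "y + x0"] by simp
  qed
  have \<phi>D: "\<phi> \<in> D_h \<tau> \<sigma> h ?K0" if h: "h > 0" for h
  proof -
    obtain A where A: "A > 0" "\<And>p. C0 ^ p * real p ^ (3 * p) \<le> A * (h powr (real p powr \<sigma>) * M_seq \<tau> \<sigma> p)"
      using power_le_M_seq[OF par h C0] by blast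
    have "\<phi> \<in> E_h \<tau> \<sigma> h ?K0"
    proof (rule E_hI[OF \<phi> h])
      fix l x
      have "cmod (partials l \<phi> x) \<le> A0 * (A * (h powr (real (length l) powr \<sigma>) * M_seq \<tau> \<sigma> (length l)))"
        by (rule order_trans[OF \<phi>_bd mult_left_mono[OF A(2)]]) (use A0 in simp)
      thus "cmod (partials l \<phi> x) \<le> (A0 * A) * (h powr (real (length l) powr \<sigma>) * M_seq \<tau> \<sigma> (length l))"
        by (simp only: mult.assoc)
    qed
    thus ?thesis using supp\<phi>K by (simp add: D_h_def)
  qed
  define g where "g t = cnj (\<phi> (t - x0))" for t
  \<comment> \<open>The cube on which the translated window \<open>g\<close> is identically 1, so
    that multiplication by \<open>g\<close> fixes the test functions on it.\<close>
  define \<Omega> where "\<Omega> = box (x0 - vec r) (x0 + vec r)"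
  have \<Omega>: "\<bar>x $ j - x0 $ j\<bar> < r" if "x \<in> \<Omega>" for x j
  proof -
    have "x0 $ j - r < x $ j \<and> x $ j < x0 $ j + r" using that unfolding \<Omega>_def by (simp add: mem_box_cart)
    thus ?thesis by linarith
  qed
  have x0\<Omega>: "x0 \<in> \<Omega>" unfolding \<Omega>_def using r(1) by (simp add: mem_box_cart)
  have \<Omega>K: "\<Omega> \<subseteq> K"
  proof
    fix x assume x: "x \<in> \<Omega>"
    have "\<bar>x $ j - x0 $ j\<bar> \<le> 2 * r" for j using \<Omega>[OF x, of j] r(1) by linarith
    thus "x \<in> K" by (rule cubeK)
  qed
  have g_one: "g x = 1" if "x \<in> \<Omega>" for x
    unfolding g_def using \<Omega>[OF that] one[of "x - x0"] by (simp add: less_imp_le)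
  have smg: "smooth_on UNIV g" unfolding g_def by (rule smooth_on_translate_cnj[OF \<phi>])
  have suppg: "\<bar>x $ j - x0 $ j\<bar> \<le> 2 * r" if "x \<in> supp g" for x j
  proof -
    have "x - x0 \<in> supp \<phi>" using that supp_translate_cnj[of \<phi> x0] unfolding g_def by blast
    hence "\<bar>(x - x0) $ j\<bar> \<le> 2 * r" using supp\<phi> by blast
    thus ?thesis by simp
  qed
  have suppgK: "supp g \<subseteq> K" using suppg cubeK by blast
  have csg: "compact (supp g)" by (rule compact_supp_subset[OF suppgK K(1)])
  have g_half: "\<bar>x $ j - x0 $ j\<bar> < 1 / 2" if "x \<in> supp g" for x j
    using suppg[OF that, of j] r(2) by linarith
  define v where "v \<xi> = u (\<lambda>t. g t * phase \<xi> t)" for \<xi>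
  have stft_v: "stft \<phi> u x0 \<xi> = v \<xi>" for \<xi> unfolding stft_eq v_def g_def ..
  define f where "f t = (\<Sum>n. v (- zvec n) * phase (zvec n) t)" for t :: "real ^ 'n"
  have main: "smooth_on UNIV f \<and> (\<forall>\<psi>\<in>test_fun \<Omega>. u \<psi> = (LINT x|lborel. f x * \<psi> x)) \<and>
      (\<forall>K'. f \<in> E_h \<tau> \<sigma> (2 * shift_scale \<sigma> (1 / h)) K')"
    if that: "A > 0" "h > 0" and hyp: "\<forall>\<xi>. \<xi> \<noteq> 0 \<longrightarrow> cmod (stft \<phi> u x0 \<xi>) \<le> A * exp (- assoc_fun \<tau> \<sigma> h (norm \<xi>))" for A h
  proof -
    have vb: "cmod (v \<xi>) \<le> A * exp (- assoc_fun \<tau> \<sigma> h (norm \<xi>))" if "\<xi> \<noteq> 0" for \<xi>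
      using hyp[rule_format, OF that] unfolding stft_v .
    note sb = synthesis_bound[OF par that(2,1) vb]
    have smf: "smooth_on UNIV f" unfolding f_def by (rule smooth_on_suminf[OF sb(1)])
    obtain B where B: "\<And>l x. cmod (partials l f x)
        \<le> B * ((2 * shift_scale \<sigma> (1 / h)) powr (real (length l) powr \<sigma>) * M_seq \<tau> \<sigma> (length l))"
      using sb(2) unfolding f_def by blast
    have "f \<in> E_h \<tau> \<sigma> (2 * shift_scale \<sigma> (1 / h)) K'" for K'
      by (rule E_hI[OF smf _ B]) (use that(2) shift_scale_pos[of "1 / h"] in simp)
    moreover have "u \<psi> = (LINT x|lborel. f x * \<psi> x)" if "\<psi> \<in> test_fun \<Omega>" for \<psi>
    proof -
      have \<psi>: "smooth_on UNIV \<psi>" "compact (supp \<psi>)" "supp \<psi> \<subseteq> \<Omega>"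
        using that by (auto simp: test_fun_def)
      have g\<psi>: "g t * \<psi> t = \<psi> t" for t
      proof (cases "t \<in> supp \<psi>")
        case True
        thus ?thesis using g_one \<psi>(3) by auto
      qed (simp add: not_in_supp)
      have "supp \<psi> \<subseteq> supp g"
      proof
        fix t assume "t \<in> supp \<psi>"
        hence "g t = 1" using g_one \<psi>(3) by blast
        thus "t \<in> supp g" by (intro supp_subset) simp
      qed
      thus ?thesis unfolding f_def v_def
        by (intro distribution_eq_synthesis[OF u smg csg _ g_half sb(1)[unfolded v_def] \<psi>(1,2) _ g\<psi>])
          (use suppgK K(3) in auto)
    qed
    ultimately show ?thesis using smf by blast
  qed
  show ?thesis
  proof (rule exI[of _ \<phi>], rule exI[of _ \<Omega>], rule exI[of _ f], intro conjI)
    show "\<forall>h>0. \<phi> \<in> D_h \<tau> \<sigma> h ?K0" by (intro allI impI \<phi>D)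
    show "open \<Omega>" unfolding \<Omega>_def by (rule open_box)
    show "x0 \<in> \<Omega>" by (rule x0\<Omega>)
    show "\<Omega> \<subseteq> U" using \<Omega>K K(3) by blast
    show "\<forall>A>0. \<forall>h>0. (\<forall>\<xi>. \<xi> \<noteq> 0 \<longrightarrow> cmod (stft \<phi> u x0 \<xi>) \<le> A * exp (- assoc_fun \<tau> \<sigma> h (norm \<xi>))) \<longrightarrow>
      smooth_on UNIV f \<and> (\<forall>\<psi>\<in>test_fun \<Omega>. u \<psi> = (LINT x|lborel. f x * \<psi> x)) \<and>
      (\<forall>K'. f \<in> E_h \<tau> \<sigma> (2 * shift_scale \<sigma> (1 / h)) K')"
      by (intro allI impI) (rule main; assumption)
  qed
qed

section \<open>Choice of the neighbourhood and the two equivalences\<close>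

lemma cball_window:
  assumes "open \<Omega>" "x0 \<in> \<Omega>"
  shows "\<exists>r>0. cball x0 (2 * r) \<subseteq> \<Omega>"
proof -
  obtain e where "e > 0" "cball x0 e \<subseteq> \<Omega>" using assms open_contains_cball by blast
  thus ?thesis by (intro exI[of _ "e / 2"]) simp
qed

lemma regular_compact_cball:
  assumes "r > 0"
  shows "regular_compact (cball x0 r)"
  using assms by (simp add: regular_compact_def)

lemma sum_cball_subset:
  fixes x0 :: "real ^ 'n::finite"
  shows "{x + y - x0 | x y. x \<in> cball x0 r \<and> y \<in> cball x0 r} \<subseteq> cball x0 (2 * r)"
proof clarify
  fix x y assume "x \<in> cball x0 r" "y \<in> cball x0 r"
  hence "norm (x - x0) \<le> r" "norm (y - x0) \<le> r" by (simp_all add: dist_norm norm_minus_commute)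
  hence "norm ((x - x0) + (y - x0)) \<le> 2 * r" using norm_triangle_ineq[of "x - x0" "y - x0"] by linarith
  moreover have "x + y - x0 - x0 = (x - x0) + (y - x0)" by simp
  ultimately show "x + y - x0 \<in> cball x0 (2 * r)"
    by (metis dist_norm dist_commute mem_cball)
qed

lemma subset_of_sum_window:
  fixes x0 :: "'a::ab_group_add"
  assumes "x0 \<in> K" "{x + y - x0 | x y. x \<in> K \<and> y \<in> K} \<subseteq> U"
  shows "K \<subseteq> U"
proof
  fix x assume "x \<in> K"
  hence "x + x0 - x0 \<in> U" using assms by blast
  thus "x \<in> U" by simp
qed

theorem theorem4p2:
  fixes U :: "(real ^ 'n::finite) set" and x0 :: "real ^ 'n"
    and u :: "(real ^ 'n \<Rightarrow> complex) \<Rightarrow> complex" and \<tau> \<sigma> :: real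
  assumes "open U" and "x0 \<in> U" and "distribution U u" and "\<tau> > 0" and "\<sigma> > 1"
  shows "(x0 \<notin> singsupp_Roumieu \<tau> \<sigma> U u \<longleftrightarrow>
           (\<exists>K. compact K \<and> x0 \<in> interior K \<and> {x + y - x0 | x y. x \<in> K \<and> y \<in> K} \<subseteq> U \<and>
             (\<forall>\<phi> \<in> D_Roumieu \<tau> \<sigma> {y. y + x0 \<in> K}. \<exists>A>0. \<exists>h>0. \<forall>x\<in>K. \<forall>\<xi>. \<xi> \<noteq> 0 \<longrightarrow>
                cmod (stft \<phi> u x \<xi>) \<le> A * exp (- assoc_fun \<tau> \<sigma> h (norm \<xi>))))) \<and>
         (x0 \<notin> singsupp_Beurling \<tau> \<sigma> U u \<longleftrightarrow>
           (\<exists>K. compact K \<and> x0 \<in> interior K \<and> {x + y - x0 | x y. x \<in> K \<and> y \<in> K} \<subseteq> U \<and>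
             (\<forall>\<phi> \<in> D_Beurling \<tau> \<sigma> {y. y + x0 \<in> K}. \<forall>h>0. \<exists>A>0. \<forall>x\<in>K. \<forall>\<xi>. \<xi> \<noteq> 0 \<longrightarrow>
                cmod (stft \<phi> u x \<xi>) \<le> A * exp (- assoc_fun \<tau> \<sigma> h (norm \<xi>)))))"
    (is "(?sR \<longleftrightarrow> (\<exists>K. ?window K \<and> x0 \<in> interior K \<and> ?sum K \<and> ?R K)) \<and>
      (?sB \<longleftrightarrow> (\<exists>K. ?window K \<and> x0 \<in> interior K \<and> ?sum K \<and> ?B K))")
proof (intro conjI iffI)
  assume ?sR
  then obtain \<Omega> f where \<Omega>: "open \<Omega>" "x0 \<in> \<Omega>" "\<Omega> \<subseteq> U" and f: "f \<in> E_Roumieu \<tau> \<sigma> \<Omega>"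
    and uf: "\<And>\<psi>. \<psi> \<in> test_fun \<Omega> \<Longrightarrow> u \<psi> = (LINT x|lborel. f x * \<psi> x)"
    using assms(2) unfolding singsupp_Roumieu_def in_class_on_def by blast
  obtain r where r: "r > 0" "cball x0 (2 * r) \<subseteq> \<Omega>" using cball_window[OF \<Omega>(1,2)] by blast
  have smf: "smooth_on \<Omega> f" using f by (simp add: E_Roumieu_def)
  obtain h1 where h1: "h1 > 0" "f \<in> E_h \<tau> \<sigma> h1 (cball x0 (2 * r))"
    using f regular_compact_cball[of "2 * r" x0] r unfolding E_Roumieu_def by auto
  have win: "?R (cball x0 r)"
  proof
    fix \<phi> assume "\<phi> \<in> D_Roumieu \<tau> \<sigma> {y. y + x0 \<in> cball x0 r}"
    then obtain h2 where h2: "h2 > 0" "\<phi> \<in> D_h \<tau> \<sigma> h2 {y. y + x0 \<in> cball x0 r}"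
      by (auto simp: D_Roumieu_def)
    \<comment> \<open>In the Roumieu case the function and the window come with parameters of their
      own.\<close>
    define h where "h = max h1 h2"
    have "h > 0" "h1 \<le> h" "h2 \<le> h" unfolding h_def using h1 by auto
    from stft_decay[OF assms(4,5) this(1) h1(1) this(2) h2(1) this(3) \<Omega>(1) smf r(2) uf h1(2) h2(2)]
    show "\<exists>A>0. \<exists>h>0. \<forall>x\<in>cball x0 r. \<forall>\<xi>. \<xi> \<noteq> 0 \<longrightarrow>
        cmod (stft \<phi> u x \<xi>) \<le> A * exp (- assoc_fun \<tau> \<sigma> h (norm \<xi>))"
      using prod_scale_pos[OF \<open>h > 0\<close>, of \<sigma>] by (metis divide_pos_pos mult_pos_pos zero_less_numeral zero_less_one)
  qed
  have "?sum (cball x0 r)" by (intro order_trans[OF sum_cball_subset] order_trans[OF r(2)] \<Omega>(3))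
  moreover have "x0 \<in> interior (cball x0 r)" using r(1) by simp
  ultimately show "\<exists>K. ?window K \<and> x0 \<in> interior K \<and> ?sum K \<and> ?R K"
    by (intro exI[of _ "cball x0 r"] conjI compact_cball win)
next
  assume "\<exists>K. ?window K \<and> x0 \<in> interior K \<and> ?sum K \<and> ?R K"
  then obtain K where K: "compact K" "x0 \<in> interior K" "?sum K" and R: "?R K"
    by (elim exE conjE) (rule that; assumption)
  have "x0 \<in> K" using K(2) interior_subset by blast
  have "K \<subseteq> U" by (rule subset_of_sum_window[OF \<open>x0 \<in> K\<close> K(3)])
  from local_synthesis[OF assms(4,5,3) K(1,2) this]
  obtain \<phi> \<Omega> f where \<phi>: "\<forall>h>0. \<phi> \<in> D_h \<tau> \<sigma> h {y. y + x0 \<in> K}"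
    and \<Omega>: "open \<Omega>" "x0 \<in> \<Omega>" "\<Omega> \<subseteq> U"
    and syn: "\<forall>A>0. \<forall>h>0. (\<forall>\<xi>. \<xi> \<noteq> 0 \<longrightarrow> cmod (stft \<phi> u x0 \<xi>) \<le> A * exp (- assoc_fun \<tau> \<sigma> h (norm \<xi>))) \<longrightarrow>
      smooth_on UNIV f \<and> (\<forall>\<psi>\<in>test_fun \<Omega>. u \<psi> = (LINT x|lborel. f x * \<psi> x)) \<and>
      (\<forall>K'. f \<in> E_h \<tau> \<sigma> (2 * shift_scale \<sigma> (1 / h)) K')"
    by (elim exE conjE) (rule that; assumption)
  have "\<phi> \<in> D_h \<tau> \<sigma> 1 {y. y + x0 \<in> K}" using \<phi> by simp
  hence "\<phi> \<in> D_Roumieu \<tau> \<sigma> {y. y + x0 \<in> K}"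
    unfolding D_Roumieu_def by (intro UN_I[of 1]) auto
  from bspec[OF R this] obtain A h where Ah: "A > 0" "h > 0"
    and bd: "\<forall>x\<in>K. \<forall>\<xi>. \<xi> \<noteq> 0 \<longrightarrow> cmod (stft \<phi> u x \<xi>) \<le> A * exp (- assoc_fun \<tau> \<sigma> h (norm \<xi>))"
    by (elim exE conjE) (rule that; assumption)
  note s = syn[THEN spec, THEN mp, OF Ah(1), THEN spec, THEN mp, OF Ah(2), THEN mp, OF bspec[OF bd \<open>x0 \<in> K\<close>]]
  have "2 * shift_scale \<sigma> (1 / h) > 0" using Ah(2) shift_scale_pos[of "1 / h"] by simp
  moreover have "smooth_on \<Omega> f" by (rule smooth_on_subset[OF conjunct1[OF s] subset_UNIV])
  ultimately have "f \<in> E_Roumieu \<tau> \<sigma> \<Omega>" using s unfolding E_Roumieu_def by blast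
  hence "in_class_on \<Omega> u (E_Roumieu \<tau> \<sigma> \<Omega>)" using s unfolding in_class_on_def by blast
  thus ?sR using \<Omega> unfolding singsupp_Roumieu_def by blast
next
  assume ?sB
  then obtain \<Omega> f where \<Omega>: "open \<Omega>" "x0 \<in> \<Omega>" "\<Omega> \<subseteq> U" and f: "f \<in> E_Beurling \<tau> \<sigma> \<Omega>"
    and uf: "\<And>\<psi>. \<psi> \<in> test_fun \<Omega> \<Longrightarrow> u \<psi> = (LINT x|lborel. f x * \<psi> x)"
    using assms(2) unfolding singsupp_Beurling_def in_class_on_def by blast
  obtain r where r: "r > 0" "cball x0 (2 * r) \<subseteq> \<Omega>" using cball_window[OF \<Omega>(1,2)] by blast
  have smf: "smooth_on \<Omega> f" using f by (simp add: E_Beurling_def)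
  have f_E: "f \<in> E_h \<tau> \<sigma> h (cball x0 (2 * r))" if "h > 0" for h
    using f regular_compact_cball[of "2 * r" x0] r that unfolding E_Beurling_def by auto
  have win: "?B (cball x0 r)"
  proof (intro ballI allI impI)
    fix \<phi> and h' :: real
    assume \<phi>: "\<phi> \<in> D_Beurling \<tau> \<sigma> {y. y + x0 \<in> cball x0 r}" and h': "h' > 0"
    \<comment> \<open>The parameter is chosen backwards, so that after its degradation exactly the
      prescribed \<open>h'\<close> results.\<close>
    have "1 / (2 * h') > 0" using h' by simp
    then obtain h where h: "h > 0" "prod_scale \<sigma> h = 1 / (2 * h')" using prod_scale_surj by blast
    have eq: "1 / (2 * prod_scale \<sigma> h) = h'" unfolding h(2) using h' by simp
    have \<phi>_h: "\<phi> \<in> D_h \<tau> \<sigma> h {y. y + x0 \<in> cball x0 r}"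
      using \<phi> h(1) by (simp add: D_Beurling_def)
    show "\<exists>A>0. \<forall>x\<in>cball x0 r. \<forall>\<xi>. \<xi> \<noteq> 0 \<longrightarrow>
        cmod (stft \<phi> u x \<xi>) \<le> A * exp (- assoc_fun \<tau> \<sigma> h' (norm \<xi>))"
      using stft_decay[OF assms(4,5) h(1,1) order_refl h(1) order_refl \<Omega>(1) smf r(2) uf f_E[OF h(1)] \<phi>_h]
      unfolding eq .
  qed
  have "?sum (cball x0 r)" by (intro order_trans[OF sum_cball_subset] order_trans[OF r(2)] \<Omega>(3))
  moreover have "x0 \<in> interior (cball x0 r)" using r(1) by simp
  ultimately show "\<exists>K. ?window K \<and> x0 \<in> interior K \<and> ?sum K \<and> ?B K"
    by (intro exI[of _ "cball x0 r"] conjI compact_cball win)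
next
  assume "\<exists>K. ?window K \<and> x0 \<in> interior K \<and> ?sum K \<and> ?B K"
  then obtain K where K: "compact K" "x0 \<in> interior K" "?sum K" and B: "?B K"
    by (elim exE conjE) (rule that; assumption)
  have "x0 \<in> K" using K(2) interior_subset by blast
  have "K \<subseteq> U" by (rule subset_of_sum_window[OF \<open>x0 \<in> K\<close> K(3)])
  from local_synthesis[OF assms(4,5,3) K(1,2) this]
  obtain \<phi> \<Omega> f where \<phi>: "\<forall>h>0. \<phi> \<in> D_h \<tau> \<sigma> h {y. y + x0 \<in> K}"
    and \<Omega>: "open \<Omega>" "x0 \<in> \<Omega>" "\<Omega> \<subseteq> U"
    and syn: "\<forall>A>0. \<forall>h>0. (\<forall>\<xi>. \<xi> \<noteq> 0 \<longrightarrow> cmod (stft \<phi> u x0 \<xi>) \<le> A * exp (- assoc_fun \<tau> \<sigma> h (norm \<xi>))) \<longrightarrow>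
      smooth_on UNIV f \<and> (\<forall>\<psi>\<in>test_fun \<Omega>. u \<psi> = (LINT x|lborel. f x * \<psi> x)) \<and>
      (\<forall>K'. f \<in> E_h \<tau> \<sigma> (2 * shift_scale \<sigma> (1 / h)) K')"
    by (elim exE conjE) (rule that; assumption)
  have \<phi>_B: "\<phi> \<in> D_Beurling \<tau> \<sigma> {y. y + x0 \<in> K}"
    unfolding D_Beurling_def using \<phi> by auto
  have syn': "smooth_on UNIV f \<and> (\<forall>\<psi>\<in>test_fun \<Omega>. u \<psi> = (LINT x|lborel. f x * \<psi> x)) \<and>
      (\<forall>K'. f \<in> E_h \<tau> \<sigma> h' K')" if h': "h' > 0" for h'
  proof -
    \<comment> \<open>Again backwards: the decay is used at \<open>1 / z\<close>, where
      \<open>z\<close> is chosen so that the regularity obtained has the prescribed parameter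
      \<open>h'\<close>.\<close>
    have "h' / 2 > 0" using h' by simp
    then obtain z where z: "z > 0" "shift_scale \<sigma> z = h' / 2" using shift_scale_surj by blast
    hence h: "1 / z > 0" by simp
    from bspec[OF B \<phi>_B, THEN spec, THEN mp, OF h] obtain A where A: "A > 0"
      and bd: "\<forall>x\<in>K. \<forall>\<xi>. \<xi> \<noteq> 0 \<longrightarrow> cmod (stft \<phi> u x \<xi>) \<le> A * exp (- assoc_fun \<tau> \<sigma> (1 / z) (norm \<xi>))"
      by (elim exE conjE) (rule that; assumption)
    have "2 * shift_scale \<sigma> (1 / (1 / z)) = h'" using z by simp
    with syn[THEN spec, THEN mp, OF A, THEN spec, THEN mp, OF h, THEN mp, OF bspec[OF bd \<open>x0 \<in> K\<close>]]
    show ?thesis by simp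
  qed
  \<comment> \<open>Smoothness and the representation of \<open>u\<close> do not involve the
    parameter, so they can be read off at the value 1.\<close>
  note s = syn'[OF zero_less_one]
  have "smooth_on \<Omega> f" by (rule smooth_on_subset[OF conjunct1[OF s] subset_UNIV])
  hence "f \<in> E_Beurling \<tau> \<sigma> \<Omega>" using syn' unfolding E_Beurling_def by blast
  moreover have "\<forall>\<psi>\<in>test_fun \<Omega>. u \<psi> = (LINT x|lborel. f x * \<psi> x)" using s by blast
  ultimately have "in_class_on \<Omega> u (E_Beurling \<tau> \<sigma> \<Omega>)" unfolding in_class_on_def by blast
  thus ?sB using \<Omega> unfolding singsupp_Beurling_def by blast
qed

end
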